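(* Let $\Lambda$ be a QID random measure on the $\sigma$-algebra $\mathcal{S}$ satisfying the bounded-case assumptions described in the context, with $\lambda,a,\sigma^2,F,\rho$ as defined there. Let $f:S\to\mathbb{R}$ be an $\mathcal{S}$-measurable function, and for $u\in\mathbb{R}$, $s\in S$ put $$U(u,s)=u\,a(s)+\int_{\mathbb{R}}\big(\tau(xu)-u\tau(x)\big)\rho(s,dx),\qquad V_0(u,s)=\int_{\mathbb{R}}(1\wedge|xu|^2)\,|\rho|(s,dx).$$ Then $f$ is $\Lambda$-integrable if and only if the following three conditions hold: (i) $\int_S|U(f(s),s)|\,\lambda(ds)<\infty$; (ii) $\int_S|f(s)|^2\sigma^2(s)\,\lambda(ds)<\infty$; (iii) $\int_S V_0(f(s),s)\,\lambda(ds)<\infty$. Further, if $f$ is $\Lambda$-integrable, then for every $\theta\in\mathbb{R}$ $$\mathbb{E}\Big[e^{i\theta\int_S f d\Lambda}\Big]=\exp\Big(i\theta a_f-\tfrac12\theta^2\sigma_f^2+\int_{\mathbb{R}}\big(e^{i\theta x}-1-i\theta\tau(x)\big)F_f(dx)\Big),$$ where $a_f=\int_S U(f(s),s)\lambda(ds)$, $\sigma_f^2=\int_S|f(s)|^2\sigma^2(s)\lambda(ds)$ and $$F_f(B)=F\big(\{(s,x)\in S\times\mathbb{R}: f(s)x\in B\setminus\{0\}\}\big),\qquad B\in\mathcal{B}(\mathbb{R}).$$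
   Context: $\mathcal{B}_0(\mathbb{R})$ is the class of Borel sets $B\subset\mathbb{R}$ with $0\notin\overline B$. $\tau(x)=x$ if $|x|\le1$, $\tau(x)=x/|x|$ if $|x|>1$. A quasi-Lévy type measure is a function $\nu:\mathcal{B}_0(\mathbb{R})\to\mathbb{R}$ whose restriction to $\{B\text{ Borel}: B\cap(-r,r)=\emptyset\}$ is a finite signed measure for each $r>0$ and with $\int_{\mathbb{R}}(1\wedge x^2)|\nu|(dx)<\infty$; $\nu^+,\nu^-,|\nu|$ denote the unique measures on $\mathcal{B}(\mathbb{R})$ with no mass at $0$ which coincide on those classes with the positive part, negative part and total variation of the restriction. If $\nu$ extends to a signed measure on $\mathcal{B}(\mathbb{R})$ (with no mass at $0$) it is identified with the extension. For $g$ $|\nu|$-integrable, $\int g\,d\nu:=\int g\,d\nu^+-\int g\,d\nu^-$. A distribution on $\mathbb{R}$ is quasi-infinitely divisible (QID) with characteristic triplet $(\gamma,a,\nu)$ if its characteristic function is $\exp(i\theta\gamma-\frac{\theta^2}{2}a+\int(e^{i\theta x}-1-i\theta\tau(x))\nu(dx))$ with $\gamma,a\in\mathbb{R}$, $\nu$ a quasi-Lévy type measure; then $\nu$ is called a quasi-Lévy measure. $S$ is a non-empty set and $\mathcal{S}$ a $\sigma$-algebra on $S$. A QID random measure is a real process $\{\Lambda(A):A\in\mathcal{S}\}$ such that for disjoint $A_n\in\mathcal{S}$ the $\Lambda(A_n)$ are independent, $\Lambda(\bigcup_nA_n)=\sum_n\Lambda(A_n)$ a.s., and each $\Lambda(A)$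 is QID. Setting (bounded case). $\Lambda$ is a QID random measure such that $\Lambda(A)$ has characteristic triplet $(\nu_0(A),\nu_1(A),F_A)$ for every $A\in\mathcal{S}$, where $\nu_0:\mathcal{S}\to\mathbb{R}$ is a signed measure, $\nu_1:\mathcal{S}\to[0,\infty)$ is a measure, and $(A,B)\mapsto F_A(B)$ is a signed bimeasure on $\mathcal{S}\times\mathcal{B}(\mathbb{R})$: $F_A(\cdot)$ is a quasi-Lévy measure and a signed measure on $\mathcal{B}(\mathbb{R})$ for every $A\in\mathcal{S}$, and $A\mapsto F_A(B)\in(-\infty,\infty)$ is a signed measure on $\mathcal{S}$ for every $B\in\mathcal{B}(\mathbb{R})$. It is assumed that $\sup_I\sum_{i\in I}|F_{A_i}(B_i)|<\infty$, the supremum being over all finite families $(A_i,B_i)_{i\in I}$ in $\mathcal{S}\times\mathcal{B}(\mathbb{R})$ with pairwise disjoint rectangles $A_i\times B_i$. For $A\in\mathcal{S}$ let $\nu(A)=\sup_{I_A}\sum_{i\in I_A}|F_{A_i}(B_i)|$, the supremum over such families with all $A_i\subset A$; $\nu$ is a finite measure. Control measure: $\lambda(A)=|\nu_0|(A)+\nu_1(A)+\nu(A)$. $a=d\nu_0/d\lambda$, $\sigma^2=d\nu_1/d\lambda$. $F$ is the unique finite signed measure on $\mathcal{S}\otimes\mathcal{B}(\mathbb{R})$ with $F(A\times B)=F_A(B)$. $\rho:S\times\mathcal{B}(\mathbb{R})\to\mathbb{R}$ is a kernel, $\rho(s,\cdot)$ a quasi-Lévy type (signed) measure for every $s$, $\rho(\cdot,B)$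 measurable for every $B$, such that $\int_{S\times\mathbb{R}}h\,dF=\int_S\int_{\mathbb{R}}h(s,x)\rho(s,dx)\lambda(ds)$ for all $F$-integrable $h$ (in particular $F_A(B)=\int_A\rho(s,B)\lambda(ds)$); such a $\rho$ exists. Integral: for a simple function $f=\sum_{j=1}^nx_j\mathbf{1}_{A_j}$ with disjoint $A_j\in\mathcal{S}$ and $A\in\mathcal{S}$, $\int_Af\,d\Lambda=\sum_jx_j\Lambda(A\cap A_j)$. A measurable $f$ is $\Lambda$-integrable if there are simple $f_n\to f$ $\lambda$-a.e. such that for every $A\in\mathcal{S}$ the sequence $\int_Af_n\,d\Lambda$ converges in probability; $\int_Af\,d\Lambda$ is the limit in probability (independent of the sequence). *)

theory Defs
  imports "HOL-Probability.Probability"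
begin

text \<open>
  A measurable space \<open>(S, \<S>)\<close> is represented by a \<open>'s measure\<close> of which only
  \<^const>\<open>space\<close> and \<^const>\<open>sets\<close> are used.  Signed measures are real-valued set functions
  (hence finite); their values outside the \<open>\<sigma>\<close>-algebra are irrelevant.
\<close>

definition signed_measure :: "'a measure \<Rightarrow> ('a set \<Rightarrow> real) \<Rightarrow> bool" where
  "signed_measure M \<mu> \<longleftrightarrow> \<mu> {} = 0 \<and>
     (\<forall>A :: nat \<Rightarrow> 'a set. range A \<subseteq> sets M \<longrightarrow> disjoint_family A \<longrightarrow>
        (\<lambda>n. \<mu> (A n)) sums \<mu> (\<Union>n. A n))"

text \<open>Jordan decomposition and total variation; \<^const>\<open>ennreal\<close> truncates negative values to \<open>0\<close>,
  which does not affect the supremum because \<open>B = {}\<close> is admissible.\<close>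

definition pos_part :: "'a measure \<Rightarrow> ('a set \<Rightarrow> real) \<Rightarrow> 'a measure" where
  "pos_part M \<mu> = measure_of (space M) (sets M)
     (\<lambda>A. SUP B\<in>{B \<in> sets M. B \<subseteq> A}. ennreal (\<mu> B))"

definition neg_part :: "'a measure \<Rightarrow> ('a set \<Rightarrow> real) \<Rightarrow> 'a measure" where
  "neg_part M \<mu> = pos_part M (\<lambda>A. - \<mu> A)"

definition total_variation :: "'a measure \<Rightarrow> ('a set \<Rightarrow> real) \<Rightarrow> 'a measure" where
  "total_variation M \<mu> = measure_of (space M) (sets M)
     (\<lambda>A. emeasure (pos_part M \<mu>) A + emeasure (neg_part M \<mu>) A)"

definition signed_integral ::
    "'a measure \<Rightarrow> ('a set \<Rightarrow> real) \<Rightarrow> ('a \<Rightarrow> 'b :: {banach, second_countable_topology}) \<Rightarrow> 'b" where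
  "signed_integral M \<mu> g = (\<integral>x. g x \<partial>pos_part M \<mu>) - (\<integral>x. g x \<partial>neg_part M \<mu>)"

definition is_RN_deriv :: "'a measure \<Rightarrow> ('a set \<Rightarrow> real) \<Rightarrow> ('a \<Rightarrow> real) \<Rightarrow> bool" where
  "is_RN_deriv M \<mu> g \<longleftrightarrow> integrable M g \<and> (\<forall>A\<in>sets M. \<mu> A = (LINT s:A|M. g s))"


subsection \<open>Quasi-Levy type measures\<close>

text \<open>
  A quasi-Levy type measure is a set function that is only relevant on the Borel sets
  \<open>B\<close> with \<open>0 \<notin> closure B\<close>.  These are exactly the measurable sets of the spaces
  \<open>away r\<close>, \<open>r > 0\<close>.
\<close>

definition away :: "real \<Rightarrow> real measure" where
  "away r = restrict_space borel (- {-r<..<r})"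

text \<open>The Borel measure without mass at \<open>0\<close> that coincides on each \<open>away r\<close> with the
  given part (positive, negative, total variation) of the restriction of \<open>\<nu>\<close> to \<open>away r\<close>.\<close>

definition glue ::
    "(real measure \<Rightarrow> (real set \<Rightarrow> real) \<Rightarrow> real measure) \<Rightarrow> (real set \<Rightarrow> real) \<Rightarrow> real measure" where
  "glue Q \<nu> = (THE m. sets m = sets borel \<and> emeasure m {0} = 0 \<and>
     (\<forall>r>0. \<forall>B\<in>sets (away r). emeasure m B = emeasure (Q (away r) \<nu>) B))"

definition levy_pos :: "(real set \<Rightarrow> real) \<Rightarrow> real measure" where
  "levy_pos = glue pos_part"

definition levy_neg :: "(real set \<Rightarrow> real) \<Rightarrow> real measure" where
  "levy_neg = glue neg_part"

definition levy_var :: "(real set \<Rightarrow> real) \<Rightarrow> real measure" where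
  "levy_var = glue total_variation"

definition quasi_levy_type :: "(real set \<Rightarrow> real) \<Rightarrow> bool" where
  "quasi_levy_type \<nu> \<longleftrightarrow> (\<forall>r>0. signed_measure (away r) \<nu>) \<and>
     (\<integral>\<^sup>+x. ennreal (min 1 (x\<^sup>2)) \<partial>levy_var \<nu>) < \<infinity>"

text \<open>The identification of \<open>\<nu>\<close> with an extension to all Borel sets, without mass at \<open>0\<close>.\<close>

definition extended_to_signed_measure :: "(real set \<Rightarrow> real) \<Rightarrow> bool" where
  "extended_to_signed_measure \<nu> \<longleftrightarrow> signed_measure borel \<nu> \<and> \<nu> {0} = 0"

definition levy_integral ::
    "(real set \<Rightarrow> real) \<Rightarrow> (real \<Rightarrow> 'b :: {banach, second_countable_topology}) \<Rightarrow> 'b" where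
  "levy_integral \<nu> g = (\<integral>x. g x \<partial>levy_pos \<nu>) - (\<integral>x. g x \<partial>levy_neg \<nu>)"


subsection \<open>Quasi-infinitely divisible distributions\<close>

definition \<tau> :: "real \<Rightarrow> real" where
  "\<tau> x = (if \<bar>x\<bar> \<le> 1 then x else x / \<bar>x\<bar>)"

definition qid_char :: "real \<Rightarrow> real \<Rightarrow> (real set \<Rightarrow> real) \<Rightarrow> real \<Rightarrow> complex" where
  "qid_char \<gamma> a \<nu> \<theta> =
     exp (\<i> * of_real \<theta> * of_real \<gamma> - of_real (\<theta>\<^sup>2 / 2 * a)
          + levy_integral \<nu> (\<lambda>x. exp (\<i> * of_real (\<theta> * x)) - 1 - \<i> * of_real (\<theta> * \<tau> x)))"

definition has_triplet :: "real measure \<Rightarrow> real \<Rightarrow> real \<Rightarrow> (real set \<Rightarrow> real) \<Rightarrow> bool" where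
  "has_triplet D \<gamma> a \<nu> \<longleftrightarrow>
     real_distribution D \<and> quasi_levy_type \<nu> \<and> (\<forall>\<theta>. char D \<theta> = qid_char \<gamma> a \<nu> \<theta>)"

definition qid :: "real measure \<Rightarrow> bool" where
  "qid D \<longleftrightarrow> (\<exists>\<gamma> a \<nu>. has_triplet D \<gamma> a \<nu>)"

definition quasi_levy_measure :: "(real set \<Rightarrow> real) \<Rightarrow> bool" where
  "quasi_levy_measure \<nu> \<longleftrightarrow> (\<exists>D \<gamma> a. has_triplet D \<gamma> a \<nu>)"

definition qid_random_measure :: "'w measure \<Rightarrow> 's measure \<Rightarrow> ('s set \<Rightarrow> 'w \<Rightarrow> real) \<Rightarrow> bool" where
  "qid_random_measure P S \<Lambda> \<longleftrightarrow>
     (\<forall>A\<in>sets S. \<Lambda> A \<in> borel_measurable P) \<and>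
     (\<forall>A :: nat \<Rightarrow> 's set. range A \<subseteq> sets S \<longrightarrow> disjoint_family A \<longrightarrow>
        prob_space.indep_vars P (\<lambda>_. borel) (\<lambda>n. \<Lambda> (A n)) UNIV \<and>
        (AE \<omega> in P. (\<lambda>n. \<Lambda> (A n) \<omega>) sums \<Lambda> (\<Union>n. A n) \<omega>)) \<and>
     (\<forall>A\<in>sets S. qid (distr P borel (\<Lambda> A)))"


subsection \<open>Bimeasures and the control measure\<close>

definition signed_bimeasure :: "'s measure \<Rightarrow> ('s set \<Rightarrow> real set \<Rightarrow> real) \<Rightarrow> bool" where
  "signed_bimeasure S FA \<longleftrightarrow>
     (\<forall>A\<in>sets S. quasi_levy_measure (FA A) \<and> extended_to_signed_measure (FA A)) \<and>
     (\<forall>B\<in>sets borel. signed_measure S (\<lambda>A. FA A B))"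

definition bimeasure_variation ::
    "'s measure \<Rightarrow> ('s set \<Rightarrow> real set \<Rightarrow> real) \<Rightarrow> 's set \<Rightarrow> ennreal" where
  "bimeasure_variation S FA A =
     (SUP (I, As, Bs) \<in> {(I :: nat set, As, Bs). finite I \<and>
          (\<forall>i\<in>I. As i \<in> sets S \<and> As i \<subseteq> A \<and> Bs i \<in> sets borel) \<and>
          disjoint_family_on (\<lambda>i. As i \<times> Bs i) I}.
        ennreal (\<Sum>i\<in>I. \<bar>FA (As i) (Bs i)\<bar>))"

definition control_measure ::
    "'s measure \<Rightarrow> ('s set \<Rightarrow> real) \<Rightarrow> 's measure \<Rightarrow> ('s set \<Rightarrow> real set \<Rightarrow> real) \<Rightarrow> 's measure" where
  "control_measure S \<nu>0 \<nu>1 FA = measure_of (space S) (sets S)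
     (\<lambda>A. emeasure (total_variation S \<nu>0) A + emeasure \<nu>1 A + bimeasure_variation S FA A)"

text \<open>In the disintegration property, the finiteness of the iterated integral on the
  right-hand side has to be stated, as Bochner integrals of non-integrable functions are \<open>0\<close>.\<close>

definition disintegration ::
    "'s measure \<Rightarrow> 's measure \<Rightarrow> (('s \<times> real) set \<Rightarrow> real) \<Rightarrow> ('s \<Rightarrow> real set \<Rightarrow> real) \<Rightarrow> bool" where
  "disintegration S lam F \<rho> \<longleftrightarrow>
     (\<forall>s\<in>space S. quasi_levy_type (\<rho> s) \<and> extended_to_signed_measure (\<rho> s)) \<and>
     (\<forall>B\<in>sets borel. (\<lambda>s. \<rho> s B) \<in> borel_measurable S) \<and>
     (\<forall>h :: 's \<times> real \<Rightarrow> real. integrable (total_variation (S \<Otimes>\<^sub>M borel) F) h \<longrightarrow>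
        (AE s in lam. integrable (levy_var (\<rho> s)) (\<lambda>x. h (s, x))) \<and>
        integrable lam (\<lambda>s. levy_integral (\<rho> s) (\<lambda>x. h (s, x))) \<and>
        signed_integral (S \<Otimes>\<^sub>M borel) F h = (\<integral>s. levy_integral (\<rho> s) (\<lambda>x. h (s, x)) \<partial>lam))"


subsection \<open>Stochastic integrals\<close>

definition converges_in_prob :: "'w measure \<Rightarrow> (nat \<Rightarrow> 'w \<Rightarrow> real) \<Rightarrow> ('w \<Rightarrow> real) \<Rightarrow> bool" where
  "converges_in_prob P X Y \<longleftrightarrow> Y \<in> borel_measurable P \<and>
     (\<forall>\<epsilon>>0. (\<lambda>n. measure P {\<omega> \<in> space P. \<epsilon> < \<bar>X n \<omega> - Y \<omega>\<bar>}) \<longlonglongrightarrow> 0)"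

text \<open>The integral of a simple function, computed from its canonical representation
  \<open>f = (\<Sum>y. y * indicator {f = y})\<close>; any other representation by disjoint sets gives the
  same random variable almost surely, see \<open>simple_stoch_integral_representation\<close> below.\<close>

definition simple_stoch_integral ::
    "'s measure \<Rightarrow> ('s set \<Rightarrow> 'w \<Rightarrow> real) \<Rightarrow> 's set \<Rightarrow> ('s \<Rightarrow> real) \<Rightarrow> 'w \<Rightarrow> real" where
  "simple_stoch_integral S \<Lambda> A f \<omega> =
     (\<Sum>y\<in>f ` space S. y * \<Lambda> (A \<inter> (f -` {y} \<inter> space S)) \<omega>)"

lemma qid_random_measure_empty:
  fixes S :: "'s measure"
  assumes "qid_random_measure P S \<Lambda>"
  shows "AE \<omega> in P. \<Lambda> {} \<omega> = 0"
proof -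
  define A :: "nat \<Rightarrow> 's set" where "A = (\<lambda>_. {})"
  have "range A \<subseteq> sets S" "disjoint_family A"
    by (auto simp: A_def disjoint_family_on_def)
  then have "AE \<omega> in P. (\<lambda>n. \<Lambda> (A n) \<omega>) sums \<Lambda> (\<Union>n. A n) \<omega>"
    using assms unfolding qid_random_measure_def by blast
  then show ?thesis
    by eventually_elim (simp add: A_def, metis sums_summable summable_const_iff)
qed

lemma qid_random_measure_finite_additive:
  assumes L: "qid_random_measure P S \<Lambda>"
    and J: "finite (J :: nat set)" "\<And>j. j \<in> J \<Longrightarrow> E j \<in> sets S" "disjoint_family_on E J"
  shows "AE \<omega> in P. \<Lambda> (\<Union>j\<in>J. E j) \<omega> = (\<Sum>j\<in>J. \<Lambda> (E j) \<omega>)"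
proof -
  define G where "G n = (if n \<in> J then E n else {})" for n
  have "range G \<subseteq> sets S" "disjoint_family G"
    using J unfolding G_def disjoint_family_on_def by auto
  then have "AE \<omega> in P. (\<lambda>n. \<Lambda> (G n) \<omega>) sums \<Lambda> (\<Union>n. G n) \<omega>"
    using L unfolding qid_random_measure_def by blast
  then show ?thesis
    using qid_random_measure_empty[OF L]
  proof eventually_elim
    case (elim \<omega>)
    have "(\<lambda>n. \<Lambda> (G n) \<omega>) sums (\<Sum>n\<in>J. \<Lambda> (G n) \<omega>)"
      by (rule sums_finite) (use J elim in \<open>auto simp: G_def\<close>)
    moreover have "(\<Union>n. G n) = (\<Union>j\<in>J. E j)"
      by (auto simp: G_def split: if_splits)
    ultimately show ?case
      using elim(1) by (auto simp: G_def dest: sums_unique2)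
  qed
qed

lemma simple_stoch_integral_representation:
  assumes L: "qid_random_measure P S \<Lambda>" and A: "A \<in> sets S"
    and E: "\<And>j. j < n \<Longrightarrow> E j \<in> sets S" and disj: "disjoint_family_on E {..<n :: nat}"
    and f: "\<And>s. s \<in> space S \<Longrightarrow> f s = (\<Sum>j<n. x j * indicator (E j) s)"
  shows "AE \<omega> in P. simple_stoch_integral S \<Lambda> A f \<omega> = (\<Sum>j<n. x j * \<Lambda> (A \<inter> E j) \<omega>)"
proof -
  have val: "f s = x j" if "j < n" "s \<in> E j" for s j
  proof -
    have "s \<in> space S" using E that sets.sets_into_space by blast
    then have "f s = (\<Sum>i<n. x i * indicator (E i) s)" by (rule f)
    also have "\<dots> = (\<Sum>i<n. if i = j then x j else 0)"
      using that disj by (intro sum.cong) (auto simp: indicator_def disjoint_family_on_def)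
    finally show ?thesis using that by simp
  qed
  have ex: "\<exists>j<n. s \<in> E j" if "s \<in> space S" "f s \<noteq> 0" for s
    using that f[OF that(1)] by (metis (no_types, lifting) indicator_simps(2) lessThan_iff mult_zero_right sum.neutral)
  let ?J = "\<lambda>y. {j. j < n \<and> x j = y}"
  let ?Y = "f ` space S"
  have finY: "finite ?Y"
  proof (rule finite_subset)
    show "?Y \<subseteq> insert 0 (x ` {..<n})" using ex val by fastforce
  qed simp
  have lev: "A \<inter> (f -` {y} \<inter> space S) = (\<Union>j\<in>?J y. A \<inter> E j)" if "y \<noteq> 0" for y
    using ex val that E[THEN sets.sets_into_space] by fastforce
  have "AE \<omega> in P. \<forall>y\<in>?Y - {0}. \<Lambda> (\<Union>j\<in>?J y. A \<inter> E j) \<omega> = (\<Sum>j\<in>?J y. \<Lambda> (A \<inter> E j) \<omega>)"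
  proof (rule AE_finite_allI)
    show "finite (?Y - {0})" using finY by simp
    fix y
    show "AE \<omega> in P. \<Lambda> (\<Union>j\<in>?J y. A \<inter> E j) \<omega> = (\<Sum>j\<in>?J y. \<Lambda> (A \<inter> E j) \<omega>)"
      by (rule qid_random_measure_finite_additive[OF L])
         (use A E disj in \<open>auto simp: disjoint_family_on_def\<close>)
  qed
  then show ?thesis
    using qid_random_measure_empty[OF L]
  proof eventually_elim
    case (elim \<omega>)
    have zero: "x j * \<Lambda> (A \<inter> E j) \<omega> = 0" if "j < n" "x j \<notin> ?Y - {0}" for j
    proof (cases "x j = 0")
      case False
      have "E j = {}"
      proof (rule equals0I)
        fix s assume s: "s \<in> E j"
        then have "s \<in> space S" using E[OF \<open>j < n\<close>] sets.sets_into_space by blast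
        then have "x j \<in> ?Y" using val[OF \<open>j < n\<close> s] by (metis imageI)
        then show False using that(2) False by simp
      qed
      then show ?thesis using elim by simp
    qed simp
    have "simple_stoch_integral S \<Lambda> A f \<omega> =
        (\<Sum>y\<in>?Y - {0}. y * \<Lambda> (A \<inter> (f -` {y} \<inter> space S)) \<omega>)"
      unfolding simple_stoch_integral_def by (rule sum.mono_neutral_right) (use finY in auto)
    also have "\<dots> = (\<Sum>y\<in>?Y - {0}. \<Sum>j\<in>?J y. x j * \<Lambda> (A \<inter> E j) \<omega>)"
      using elim by (intro sum.cong) (simp_all add: lev sum_distrib_left)
    also have "\<dots> = (\<Sum>j\<in>{j\<in>{..<n}. x j \<in> ?Y - {0}}. x j * \<Lambda> (A \<inter> E j) \<omega>)"
      using finY by (subst sum.UNION_disjoint[symmetric]) (auto intro!: sum.cong)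
    also have "\<dots> = (\<Sum>j<n. x j * \<Lambda> (A \<inter> E j) \<omega>)"
      by (rule sum.mono_neutral_left) (use zero in auto)
    finally show ?case .
  qed
qed

definition defining_sequence ::
    "'w measure \<Rightarrow> 's measure \<Rightarrow> ('s set \<Rightarrow> 'w \<Rightarrow> real) \<Rightarrow> 's measure \<Rightarrow> ('s \<Rightarrow> real) \<Rightarrow>
     (nat \<Rightarrow> 's \<Rightarrow> real) \<Rightarrow> bool" where
  "defining_sequence P S \<Lambda> lam f fs \<longleftrightarrow>
     (\<forall>n. simple_function S (fs n)) \<and>
     (AE s in lam. (\<lambda>n. fs n s) \<longlonglongrightarrow> f s) \<and>
     (\<forall>A\<in>sets S. \<exists>X. converges_in_prob P (\<lambda>n. simple_stoch_integral S \<Lambda> A (fs n)) X)"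

definition stoch_integrable ::
    "'w measure \<Rightarrow> 's measure \<Rightarrow> ('s set \<Rightarrow> 'w \<Rightarrow> real) \<Rightarrow> 's measure \<Rightarrow> ('s \<Rightarrow> real) \<Rightarrow> bool" where
  "stoch_integrable P S \<Lambda> lam f \<longleftrightarrow>
     f \<in> borel_measurable S \<and> (\<exists>fs. defining_sequence P S \<Lambda> lam f fs)"

text \<open>\<open>X\<close> is a version of the integral of \<open>f\<close> over \<open>A\<close>, which is determined up to almost sure
  equality only.\<close>

definition is_stoch_integral ::
    "'w measure \<Rightarrow> 's measure \<Rightarrow> ('s set \<Rightarrow> 'w \<Rightarrow> real) \<Rightarrow> 's measure \<Rightarrow> 's set \<Rightarrow> ('s \<Rightarrow> real) \<Rightarrow>
     ('w \<Rightarrow> real) \<Rightarrow> bool" where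
  "is_stoch_integral P S \<Lambda> lam A f X \<longleftrightarrow>
     (\<exists>fs. defining_sequence P S \<Lambda> lam f fs \<and>
        converges_in_prob P (\<lambda>n. simple_stoch_integral S \<Lambda> A (fs n)) X)"

definition U :: "('s \<Rightarrow> real) \<Rightarrow> ('s \<Rightarrow> real set \<Rightarrow> real) \<Rightarrow> real \<Rightarrow> 's \<Rightarrow> real" where
  "U a \<rho> u s = u * a s + levy_integral (\<rho> s) (\<lambda>x. \<tau> (x * u) - u * \<tau> x)"

definition V0 :: "('s \<Rightarrow> real set \<Rightarrow> real) \<Rightarrow> real \<Rightarrow> 's \<Rightarrow> ennreal" where
  "V0 \<rho> u s = (\<integral>\<^sup>+x. ennreal (min 1 (\<bar>x * u\<bar>\<^sup>2)) \<partial>levy_var (\<rho> s))"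

end

theory Submission
  imports Defs
begin

text \<open>
  The bounded case is, up to a drift and a Gaussian part, a compound Poisson situation with signed
  jump intensity: \<open>F\<close> is a finite signed measure on \<open>S \<times> \<real>\<close>, so \<open>\<tau>\<close>, \<open>1 \<and> x\<^sup>2\<close> and
  \<open>exp(i\<theta>x) - 1\<close> are all integrable without compensation.  With the uncompensated drift density
  \<open>\<beta>(s) = a(s) - \<integral>\<tau> d\<rho>(s,\<cdot>)\<close> (\<open>pure_drift\<close> below) the independence of \<open>\<Lambda>\<close> on disjoint sets and the
  triplets of the \<open>\<Lambda>(A)\<close> give, for simple \<open>f\<close>,
  \<open>E exp(i\<theta>\<integral>\<^sub>A f d\<Lambda>) = exp(i\<theta>\<integral>\<^sub>A f \<beta> d\<lambda> - \<theta>\<^sup>2/2 \<integral>\<^sub>A f\<^sup>2 \<sigma>\<^sup>2 d\<lambda> + \<integral>\<^sub>A\<^sub>\<times>\<^sub>\<real> (exp(i\<theta>f(s)x) - 1) dF)\<close>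
  (\<open>char_simple_stoch_integral\<close>).  The last integrand is bounded by 2 and \<open>|F|(\<cdot> \<times> \<real>) \<lless> \<lambda>\<close>, hence
  the jump term passes to \<open>\<lambda>\<close>-a.e. limits whatever \<open>f\<close> is (\<open>jump_tendsto\<close>); only the first two terms
  restrict \<open>f\<close>.

  The conditions translate accordingly.  Condition (iii) always holds, because its integral is at
  most \<open>\<integral>|\<rho>|(s,\<real>) \<lambda>(ds) = |F|(S \<times> \<real>) < \<infinity>\<close>; the identity uses that the sections of a Hahn set of \<open>F\<close>
  are Hahn sets of \<open>\<rho>(s,\<cdot>)\<close> for \<open>\<lambda>\<close>-a.e. \<open>s\<close> (\<open>AE_hahn_sections\<close>).  Since
  \<open>U(f(s),s) = f(s) \<beta>(s) + \<integral>\<tau>(f(s)x) \<rho>(s,dx)\<close> with an integrable second summand, condition (i) says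
  \<open>f \<beta> \<in> L\<^sup>1(\<lambda>)\<close>, and (ii) says \<open>f \<in> L\<^sup>2(\<sigma>\<^sup>2\<lambda>)\<close>.

  Sufficiency: take simple \<open>f\<^sub>n \<rightarrow> f\<close> with \<open>|f\<^sub>n| \<le> 2|f|\<close>.  By dominated convergence the characteristic
  functions of \<open>\<integral>\<^sub>A (f\<^sub>n - f\<^sub>m) d\<Lambda>\<close> tend to 1, so \<open>\<integral>\<^sub>A f\<^sub>n d\<Lambda>\<close> is Cauchy in probability.

  Necessity: if \<open>\<integral>\<^sub>A f\<^sub>n d\<Lambda>\<close> converges in probability for every \<open>A\<close>, the characteristic functions of
  \<open>\<integral>\<^sub>A (f\<^sub>n - f\<^sub>m) d\<Lambda>\<close> tend to 1, and so do their jump factors.  The modulus of what remains gives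
  \<open>\<integral>\<^sub>A (f\<^sub>n - f\<^sub>m)\<^sup>2 \<sigma>\<^sup>2 d\<lambda> \<rightarrow> 0\<close>, the phase gives \<open>\<integral>\<^sub>A (f\<^sub>n - f\<^sub>m) \<beta> d\<lambda> \<rightarrow> 0\<close>.  The first is Cauchy
  convergence in \<open>L\<^sup>2(\<sigma>\<^sup>2\<lambda>)\<close>.  The second is only setwise, but as it holds for every \<open>A\<close>, a gliding
  hump argument in the manner of Vitali, Hahn and Saks (\<open>gliding_hump_L1\<close>) upgrades it to Cauchy
  convergence in \<open>L\<^sup>1(\<lambda>)\<close>.  Fatou's lemma identifies both limits with \<open>f\<close>, which proves (i) and (ii),
  and all three terms of the exponent converge to those of \<open>f\<close>, which is the formula for the
  characteristic function of the integral.
\<close>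

section \<open>Hahn and Jordan decompositions of signed measures\<close>

lemma signed_measure_empty: "signed_measure M \<mu> \<Longrightarrow> \<mu> {} = 0"
  by (simp add: signed_measure_def)

lemma signed_measure_sums:
  assumes "signed_measure M \<mu>" "\<And>n. A n \<in> sets M" "disjoint_family (A :: nat \<Rightarrow> _)"
  shows "(\<lambda>n. \<mu> (A n)) sums \<mu> (\<Union>n. A n)"
  using assms unfolding signed_measure_def by blast

lemma signed_measure_Un:
  assumes \<mu>: "signed_measure M \<mu>" and AB: "A \<in> sets M" "B \<in> sets M" "A \<inter> B = {}"
  shows "\<mu> (A \<union> B) = \<mu> A + \<mu> B"
proof -
  have "(\<lambda>n. \<mu> (binaryset A B n)) sums \<mu> (\<Union>n. binaryset A B n)"
    using AB by (intro signed_measure_sums[OF \<mu>])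
      (auto simp: binaryset_def disjoint_family_on_def)
  moreover have "(\<lambda>n. \<mu> (binaryset A B n)) sums (\<Sum>n\<in>{0, 1}. \<mu> (binaryset A B n))"
    by (rule sums_finite) (auto simp: binaryset_def signed_measure_empty[OF \<mu>])
  ultimately show ?thesis
    by (auto simp: UN_binaryset_eq binaryset_def dest: sums_unique2)
qed

lemma signed_measure_Diff:
  assumes "signed_measure M \<mu>" "A \<in> sets M" "B \<in> sets M" "B \<subseteq> A"
  shows "\<mu> (A - B) = \<mu> A - \<mu> B"
proof -
  have "\<mu> (B \<union> (A - B)) = \<mu> B + \<mu> (A - B)"
    using assms by (intro signed_measure_Un) auto
  then show ?thesis using assms(4) by (simp add: Un_absorb1)
qed

lemma signed_measure_split:
  assumes "signed_measure M \<mu>" "A \<in> sets M" "P \<in> sets M"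
  shows "\<mu> A = \<mu> (A \<inter> P) + \<mu> (A - P)"
proof -
  have "\<mu> ((A \<inter> P) \<union> (A - P)) = \<mu> (A \<inter> P) + \<mu> (A - P)"
    using assms by (intro signed_measure_Un) auto
  then show ?thesis by (simp add: Int_Diff_Un)
qed

definition positive_set :: "'a measure \<Rightarrow> ('a set \<Rightarrow> real) \<Rightarrow> 'a set \<Rightarrow> bool" where
  "positive_set M \<mu> P \<longleftrightarrow> P \<in> sets M \<and> (\<forall>B\<in>sets M. B \<subseteq> P \<longrightarrow> 0 \<le> \<mu> B)"

text \<open>
  A choice of \<open>B\<close> that removes a fixed share of the negative mass available in \<open>A\<close>.  The cap at 1
  keeps the choice possible while the finiteness of that mass is still unknown.
\<close>

lemma greedy_negative_subset:
  assumes \<mu>: "signed_measure M \<mu>"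
  shows "\<exists>B\<in>sets M. B \<subseteq> A \<and> \<mu> B \<le> 0 \<and>
     (\<forall>C\<in>sets M. C \<subseteq> A \<longrightarrow> min 1 (- \<mu> C) \<le> - 2 * \<mu> B)"
proof (cases "\<exists>B\<in>sets M. B \<subseteq> A \<and> \<mu> B \<le> - 1")
  case True
  then obtain B where "B \<in> sets M" "B \<subseteq> A" "\<mu> B \<le> -1" by blast
  then show ?thesis by (intro bexI[of _ B]) (auto simp: min_def)
next
  case False
  define X where "X = {- \<mu> C |C. C \<in> sets M \<and> C \<subseteq> A}"
  have "0 \<in> X" unfolding X_def using signed_measure_empty[OF \<mu>] by force
  have bdd: "bdd_above X" unfolding X_def bdd_above_def using False
    by (intro exI[of _ 1]) force
  have 0: "0 \<le> Sup X" using \<open>0 \<in> X\<close> bdd by (rule cSup_upper)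
  show ?thesis
  proof (cases "Sup X = 0")
    case True
    have "- \<mu> C \<le> 0" if "C \<in> sets M" "C \<subseteq> A" for C
      using cSup_upper[OF _ bdd, of "- \<mu> C"] that True unfolding X_def by auto
    then have "min 1 (- \<mu> C) \<le> 0" if "C \<in> sets M" "C \<subseteq> A" for C
      using that by (simp add: min_le_iff_disj)
    then show ?thesis using signed_measure_empty[OF \<mu>] by (intro bexI[of _ "{}"]) auto
  next
    case False
    then have "Sup X / 2 < Sup X" using 0 by simp
    then obtain y where "y \<in> X" "Sup X / 2 < y"
      using less_cSup_iff[of X "Sup X / 2"] \<open>0 \<in> X\<close> bdd by auto
    then obtain B where B: "B \<in> sets M" "B \<subseteq> A" "Sup X / 2 < - \<mu> B"
      unfolding X_def by auto
    have "min 1 (- \<mu> C) \<le> - 2 * \<mu> B" if "C \<in> sets M" "C \<subseteq> A" for C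
      using cSup_upper[OF _ bdd, of "- \<mu> C"] that B unfolding X_def by fastforce
    then show ?thesis using B 0 by (intro bexI[of _ B]) auto
  qed
qed

text \<open>
  Remove from \<open>D\<close> successively sets chosen by \<open>greedy_negative_subset\<close>.  Their measures form a convergent series, hence
  tend to 0, and so does the bound that they put on the negative mass of what is left.
\<close>

lemma ex_positive_subset:
  assumes \<mu>: "signed_measure M \<mu>" and D: "D \<in> sets M"
  shows "\<exists>P. positive_set M \<mu> P \<and> P \<subseteq> D \<and> \<mu> D \<le> \<mu> P"
proof -
  obtain g where g: "\<And>A. g A \<in> sets M" "\<And>A. g A \<subseteq> A" "\<And>A. \<mu> (g A) \<le> 0"
    "\<And>A C. C \<in> sets M \<Longrightarrow> C \<subseteq> A \<Longrightarrow> min 1 (- \<mu> C) \<le> - 2 * \<mu> (g A)"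
    using greedy_negative_subset[OF \<mu>] by metis
  define A where "A n = ((\<lambda>A. A - g A) ^^ n) D" for n :: nat
  have A_Suc: "A (Suc n) = A n - g (A n)" for n by (simp add: A_def)
  have A0: "A 0 = D" by (simp add: A_def)
  have A_sets: "A n \<in> sets M" for n by (induction n) (auto simp: A0 A_Suc D g)
  have A_dec: "A n \<subseteq> A m" if "m \<le> n" for m n
    using lift_Suc_antimono_le[of A m n] that by (auto simp: A_Suc)
  have disj: "disjoint_family (\<lambda>n. g (A n))"
  proof -
    have "g (A m) \<inter> g (A n) = {}" if "m < n" for m n
    proof -
      have "A n \<subseteq> A m - g (A m)" using A_dec[of "Suc m" n] that unfolding A_Suc by simp
      then show ?thesis using g(2)[of "A n"] by auto
    qed
    then show ?thesis unfolding disjoint_family_on_def by (auto simp: neq_iff Int_commute)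
  qed
  let ?U = "\<Union>n. g (A n)"
  have sums: "(\<lambda>n. \<mu> (g (A n))) sums \<mu> ?U"
    by (rule signed_measure_sums[OF \<mu> _ disj]) (rule g)
  have UD: "?U \<subseteq> D" using g(2) A_dec[of 0] A0 by blast
  have U: "?U \<in> sets M" using g(1) by auto
  have "\<mu> ?U \<le> 0" by (rule sums_le[OF _ sums sums_zero]) (rule g(3))
  then have le: "\<mu> D \<le> \<mu> (D - ?U)" using signed_measure_Diff[OF \<mu> D U UD] by simp
  have sub: "D - ?U \<subseteq> A n" for n by (induction n) (auto simp: A0 A_Suc)
  have lim: "(\<lambda>n. - 2 * \<mu> (g (A n))) \<longlonglongrightarrow> - 2 * 0"
    by (intro tendsto_intros summable_LIMSEQ_zero sums_summable[OF sums])
  have "0 \<le> \<mu> B" if B: "B \<in> sets M" "B \<subseteq> D - ?U" for B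
  proof -
    have "min 1 (- \<mu> B) \<le> - 2 * 0"
    proof (rule LIMSEQ_le_const[OF lim], intro exI allI impI)
      fix n show "min 1 (- \<mu> B) \<le> - 2 * \<mu> (g (A n))"
        using B sub[of n] by (intro g(4)) auto
    qed
    then show ?thesis by (auto simp: min_def split: if_splits)
  qed
  then show ?thesis using le U D unfolding positive_set_def by (intro exI[of _ "D - ?U"]) auto
qed

lemma positive_set_UN:
  assumes \<mu>: "signed_measure M \<mu>" and P: "\<And>n :: nat. positive_set M \<mu> (P n)"
  shows "positive_set M \<mu> (\<Union>n. P n)"
  unfolding positive_set_def
proof (intro conjI ballI impI)
  show "(\<Union>n. P n) \<in> sets M" using P unfolding positive_set_def by auto
  fix B assume B: "B \<in> sets M" "B \<subseteq> (\<Union>n. P n)"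
  let ?C = "\<lambda>n. B \<inter> disjointed P n"
  have Ps: "range P \<subseteq> sets M" using P by (auto simp: positive_set_def)
  have C: "?C n \<in> sets M" for n using sets.range_disjointed_sets[OF Ps] B(1) by auto
  have sums: "(\<lambda>n. \<mu> (?C n)) sums \<mu> (\<Union>n. ?C n)"
    using disjoint_family_disjointed[of P]
    by (intro signed_measure_sums[OF \<mu> C]) (auto simp: disjoint_family_on_def)
  have eq: "(\<Union>n. ?C n) = B"
    using B(2) UN_disjointed_eq[of P] by auto
  have "0 \<le> \<mu> (?C n)" for n
    using P[of n] C[of n] disjointed_subset[of P n] unfolding positive_set_def by blast
  then show "0 \<le> \<mu> B" using sums_le[OF _ sums_zero sums] unfolding eq by blast
qed

lemma positive_set_mono:
  assumes \<mu>: "signed_measure M \<mu>" and P: "positive_set M \<mu> P" and Q: "Q \<in> sets M" "Q \<subseteq> P"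
  shows "\<mu> Q \<le> \<mu> P"
proof -
  have "0 \<le> \<mu> (P - Q)" using P Q by (auto simp: positive_set_def)
  then show ?thesis using signed_measure_Diff[OF \<mu> _ Q] P by (simp add: positive_set_def)
qed

definition hahn_set :: "'a measure \<Rightarrow> ('a set \<Rightarrow> real) \<Rightarrow> 'a set \<Rightarrow> bool" where
  "hahn_set M \<mu> P \<longleftrightarrow> positive_set M \<mu> P \<and> (\<forall>B\<in>sets M. B \<inter> P = {} \<longrightarrow> \<mu> B \<le> 0)"

text \<open>
  A positive set of maximal measure works: a set of positive measure outside of it would contain a
  positive set of at least the same measure, contradicting maximality.
\<close>

lemma ex_hahn_set:
  assumes \<mu>: "signed_measure M \<mu>"
  shows "\<exists>P. hahn_set M \<mu> P"
proof -
  let ?X = "{ereal (\<mu> Q) |Q. positive_set M \<mu> Q}"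
  have "{} \<in> sets M \<and> positive_set M \<mu> {}"
    using signed_measure_empty[OF \<mu>] by (auto simp: positive_set_def)
  then have "?X \<noteq> {}" by blast
  then obtain u where u: "incseq u" "range u \<subseteq> ?X" "Sup ?X = (SUP i. u i)"
    using Sup_countable_SUP[of ?X] by auto
  then have "\<forall>n. \<exists>Q. u n = ereal (\<mu> Q) \<and> positive_set M \<mu> Q" by blast
  then obtain Q where Q: "\<And>n. u n = ereal (\<mu> (Q n))" "\<And>n. positive_set M \<mu> (Q n)" by metis
  define P where "P = (\<Union>n. Q n)"
  have P: "positive_set M \<mu> P" unfolding P_def by (rule positive_set_UN[OF \<mu> Q(2)])
  have "u n \<le> ereal (\<mu> P)" for n
    unfolding Q(1) using positive_set_mono[OF \<mu> P] Q(2)[of n] by (auto simp: P_def positive_set_def)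
  then have sup: "Sup ?X \<le> ereal (\<mu> P)" unfolding u(3) by (simp add: SUP_le_iff)
  have "\<mu> B \<le> 0" if B: "B \<in> sets M" "B \<inter> P = {}" for B
  proof -
    obtain R where R: "positive_set M \<mu> R" "R \<subseteq> B" "\<mu> B \<le> \<mu> R"
      using ex_positive_subset[OF \<mu> B(1)] by blast
    have "positive_set M \<mu> (\<Union>n. binaryset P R n)"
      by (rule positive_set_UN[OF \<mu>]) (use P R signed_measure_empty[OF \<mu>] in
        \<open>auto simp: binaryset_def positive_set_def\<close>)
    then have "positive_set M \<mu> (P \<union> R)" by (simp add: UN_binaryset_eq)
    then have "ereal (\<mu> (P \<union> R)) \<le> Sup ?X" by (intro Sup_upper) blast
    from order_trans[OF this sup] have "\<mu> (P \<union> R) \<le> \<mu> P" by simp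
    moreover have "\<mu> (P \<union> R) = \<mu> P + \<mu> R"
      using P R B by (intro signed_measure_Un[OF \<mu>]) (auto simp: positive_set_def)
    ultimately show ?thesis using R(3) by simp
  qed
  then show ?thesis using P unfolding hahn_set_def by blast
qed

lemma hahn_set_sets: "hahn_set M \<mu> P \<Longrightarrow> P \<in> sets M"
  by (simp add: hahn_set_def positive_set_def)

lemma hahn_set_signs:
  assumes P: "hahn_set M \<mu> P" and A: "A \<in> sets M"
  shows "0 \<le> \<mu> (A \<inter> P)" "\<mu> (A - P) \<le> 0"
proof -
  have Ps: "P \<in> sets M" by (rule hahn_set_sets[OF P])
  have "A \<inter> P \<in> sets M" "A \<inter> P \<subseteq> P" "A - P \<in> sets M" "(A - P) \<inter> P = {}"
    using A Ps by auto
  with P show "0 \<le> \<mu> (A \<inter> P)" "\<mu> (A - P) \<le> 0"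
    unfolding hahn_set_def positive_set_def by blast+
qed

lemma signed_measure_uminus: "signed_measure M \<mu> \<Longrightarrow> signed_measure M (\<lambda>A. - \<mu> A)"
  by (auto simp: signed_measure_def intro!: sums_minus)

lemma signed_measure_restrict:
  assumes \<mu>: "signed_measure M \<mu>" and P: "P \<in> sets M"
  shows "signed_measure M (\<lambda>A. \<mu> (A \<inter> P))"
  unfolding signed_measure_def
proof (intro conjI allI impI)
  show "\<mu> ({} \<inter> P) = 0" using signed_measure_empty[OF \<mu>] by simp
  fix A :: "nat \<Rightarrow> 'a set" assume "range A \<subseteq> sets M" "disjoint_family A"
  then have "(\<lambda>n. \<mu> (A n \<inter> P)) sums \<mu> (\<Union>n. A n \<inter> P)"
    using P by (intro signed_measure_sums[OF \<mu>]) (auto simp: disjoint_family_on_def)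
  then show "(\<lambda>n. \<mu> (A n \<inter> P)) sums \<mu> ((\<Union>n. A n) \<inter> P)" by simp
qed

lemma nonneg_signed_measure_measure_of:
  assumes \<mu>: "signed_measure M \<mu>" and nn: "\<And>A. A \<in> sets M \<Longrightarrow> 0 \<le> \<mu> A"
    and m: "\<And>A. A \<in> sets M \<Longrightarrow> m A = ennreal (\<mu> A)" and A: "A \<in> sets M"
  shows "emeasure (measure_of (space M) (sets M) m) A = ennreal (\<mu> A)"
proof -
  have "countably_additive (sets M) m"
  proof (rule countably_additiveI)
    fix A :: "nat \<Rightarrow> 'a set"
    assume A: "range A \<subseteq> sets M" "disjoint_family A" "(\<Union>i. A i) \<in> sets M"
    have "(\<lambda>n. \<mu> (A n)) sums \<mu> (\<Union>n. A n)" using A by (intro signed_measure_sums[OF \<mu>]) auto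
    then have "(\<Sum>i. ennreal (\<mu> (A i))) = ennreal (\<mu> (\<Union>i. A i))"
      using A nn by (intro suminf_ennreal_eq) auto
    then show "(\<Sum>i. m (A i)) = m (\<Union>i. A i)" using A m by (simp add: image_subset_iff)
  qed
  moreover have "positive (sets M) m"
    using m[of "{}"] signed_measure_empty[OF \<mu>] by (simp add: positive_def)
  ultimately show ?thesis
    using m A by (subst emeasure_measure_of_sigma) (auto intro: sets.sigma_algebra_axioms)
qed

lemma pos_part_sets [simp, measurable_cong]: "sets (pos_part M \<mu>) = sets M"
  and pos_part_space [simp]: "space (pos_part M \<mu>) = space M"
  and neg_part_sets [simp, measurable_cong]: "sets (neg_part M \<mu>) = sets M"
  and neg_part_space [simp]: "space (neg_part M \<mu>) = space M"
  and total_variation_sets [simp, measurable_cong]: "sets (total_variation M \<mu>) = sets M"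
  and total_variation_space [simp]: "space (total_variation M \<mu>) = space M"
  by (simp_all add: pos_part_def neg_part_def total_variation_def)

context
  fixes M :: "'a measure" and \<mu> P
  assumes \<mu>: "signed_measure M \<mu>" and P: "hahn_set M \<mu> P"
begin

text \<open>
  The supremum in \<^const>\<open>pos_part\<close> is attained at the trace of the Hahn set, so the parts of the Jordan
  decomposition are restrictions of \<open>\<mu>\<close> and inherit countable additivity and finiteness.
\<close>

lemma hahn_set_Sup:
  assumes A: "A \<in> sets M"
  shows "(SUP B\<in>{B \<in> sets M. B \<subseteq> A}. ennreal (\<mu> B)) = ennreal (\<mu> (A \<inter> P))"
proof (rule antisym)
  have Ps: "P \<in> sets M" using P by (rule hahn_set_sets)
  show "ennreal (\<mu> (A \<inter> P)) \<le> (SUP B\<in>{B \<in> sets M. B \<subseteq> A}. ennreal (\<mu> B))"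
    using A Ps by (intro SUP_upper) auto
  have "\<mu> B \<le> \<mu> (A \<inter> P)" if B: "B \<in> sets M" "B \<subseteq> A" for B
  proof -
    have "\<mu> B = \<mu> (B \<inter> P) + \<mu> (B - P)" by (rule signed_measure_split[OF \<mu> B(1) Ps])
    moreover have "\<mu> (B - P) \<le> 0" by (rule hahn_set_signs(2)[OF P B(1)])
    moreover have "0 \<le> \<mu> ((A \<inter> P) - (B \<inter> P))"
    proof -
      have "(A \<inter> P) - (B \<inter> P) \<in> sets M" "(A \<inter> P) - (B \<inter> P) \<subseteq> P" using A B Ps by auto
      then show ?thesis using P unfolding hahn_set_def positive_set_def by blast
    qed
    moreover have "\<mu> ((A \<inter> P) - (B \<inter> P)) = \<mu> (A \<inter> P) - \<mu> (B \<inter> P)"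
      using A B Ps by (intro signed_measure_Diff[OF \<mu>]) auto
    ultimately show ?thesis by simp
  qed
  then show "(SUP B\<in>{B \<in> sets M. B \<subseteq> A}. ennreal (\<mu> B)) \<le> ennreal (\<mu> (A \<inter> P))"
    by (intro SUP_least) (auto intro: ennreal_leI)
qed

lemma emeasure_pos_part:
  assumes A: "A \<in> sets M"
  shows "emeasure (pos_part M \<mu>) A = ennreal (\<mu> (A \<inter> P))"
  unfolding pos_part_def
proof (rule nonneg_signed_measure_measure_of[OF signed_measure_restrict[OF \<mu>] _ hahn_set_Sup A])
  show P': "P \<in> sets M" using P by (rule hahn_set_sets)
  show "0 \<le> \<mu> (B \<inter> P)" if "B \<in> sets M" for B
    using that by (rule hahn_set_signs(1)[OF P])
qed

end

lemma hahn_set_uminus: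
  assumes "signed_measure M \<mu>" "hahn_set M \<mu> P"
  shows "hahn_set M (\<lambda>A. - \<mu> A) (space M - P)"
proof -
  have "0 \<le> - \<mu> B" if "B \<in> sets M" "B \<subseteq> space M - P" for B
    using assms that by (auto simp: hahn_set_def)
  moreover have "- \<mu> B \<le> 0" if B: "B \<in> sets M" "B \<inter> (space M - P) = {}" for B
  proof -
    have "B \<subseteq> P" using B sets.sets_into_space[OF B(1)] by blast
    then show ?thesis using assms B by (auto simp: hahn_set_def positive_set_def)
  qed
  ultimately show ?thesis using hahn_set_sets[OF assms(2)] by (auto simp: hahn_set_def positive_set_def)
qed

lemma emeasure_neg_part:
  assumes \<mu>: "signed_measure M \<mu>" and P: "hahn_set M \<mu> P" and A: "A \<in> sets M"
  shows "emeasure (neg_part M \<mu>) A = ennreal (- \<mu> (A - P))"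
proof -
  have "A \<inter> (space M - P) = A - P" using sets.sets_into_space[OF A] by auto
  then show ?thesis
    using emeasure_pos_part[OF signed_measure_uminus[OF \<mu>] hahn_set_uminus[OF \<mu> P] A]
    by (simp add: neg_part_def)
qed

lemma emeasure_total_variation:
  assumes \<mu>: "signed_measure M \<mu>" and A: "A \<in> sets M"
  shows "emeasure (total_variation M \<mu>) A = emeasure (pos_part M \<mu>) A + emeasure (neg_part M \<mu>) A"
  unfolding total_variation_def
proof (subst emeasure_measure_of_sigma[OF sets.sigma_algebra_axioms])
  show "countably_additive (sets M) (\<lambda>A. emeasure (pos_part M \<mu>) A + emeasure (neg_part M \<mu>) A)"
    by (rule countably_additiveI)
       (simp add: suminf_add[symmetric] suminf_emeasure image_subset_iff)
qed (auto simp: positive_def A)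

lemma finite_measure_parts:
  assumes \<mu>: "signed_measure M \<mu>"
  shows "finite_measure (pos_part M \<mu>)" "finite_measure (neg_part M \<mu>)"
    "finite_measure (total_variation M \<mu>)"
proof -
  obtain P where P: "hahn_set M \<mu> P" using ex_hahn_set[OF \<mu>] by blast
  show "finite_measure (pos_part M \<mu>)" "finite_measure (neg_part M \<mu>)"
    "finite_measure (total_variation M \<mu>)"
    by (auto intro!: finite_measureI simp: emeasure_pos_part[OF \<mu> P] emeasure_neg_part[OF \<mu> P]
      emeasure_total_variation[OF \<mu>] ennreal_plus[symmetric] simp del: ennreal_plus)
qed

lemma measure_pos_minus_neg:
  assumes \<mu>: "signed_measure M \<mu>" and A: "A \<in> sets M"
  shows "\<mu> A = measure (pos_part M \<mu>) A - measure (neg_part M \<mu>) A"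
proof -
  obtain P where P: "hahn_set M \<mu> P" using ex_hahn_set[OF \<mu>] by blast
  have Ps: "P \<in> sets M" using P by (rule hahn_set_sets)
  have "0 \<le> \<mu> (A \<inter> P)" "\<mu> (A - P) \<le> 0"
    by (rule hahn_set_signs[OF P A])+
  then show ?thesis using signed_measure_split[OF \<mu> A Ps]
    by (simp add: measure_def emeasure_pos_part[OF \<mu> P A] emeasure_neg_part[OF \<mu> P A])
qed

lemma simple_function_bochner_sum:
  fixes g :: "'a \<Rightarrow> 'b :: real_normed_vector"
  assumes "simple_function M g" "x \<in> space M"
  shows "g x = (\<Sum>y\<in>g ` space M. indicator (g -` {y} \<inter> space M) x *\<^sub>R y)"
proof -
  have "(\<Sum>y\<in>g ` space M. indicator (g -` {y} \<inter> space M) x *\<^sub>R y) =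
      (\<Sum>y\<in>g ` space M. if y = g x then y else 0)"
    using assms(2) by (intro sum.cong) (auto simp: indicator_def)
  then show ?thesis using assms by (simp add: simple_function_def)
qed

text \<open>
  The transformation formula for signed measures.  It is the common source of all representations of
  integrals below: against \<open>F\<^sub>A\<close> (projection to \<open>\<real>\<close>), against \<open>F\<^sub>f\<close> (the map \<open>(s, x) \<mapsto> f(s) x\<close>)
  and against \<open>F\<close> itself (identity).  As the Jordan parts of \<open>\<nu>\<close> need not be the images of the
  positive and negative part of \<open>k T\<close>, it is checked on indicators and extended to bounded functions by
  linearity and dominated convergence.
\<close>

lemma signed_integral_image_density:
  fixes g :: "'b \<Rightarrow> 'c :: {banach, second_countable_topology}" and k :: "'a \<Rightarrow> real"
  assumes \<nu>: "signed_measure N \<nu>" and k: "integrable T k" and \<phi>[measurable]: "\<phi> \<in> measurable T N"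
    and eq: "\<And>B. B \<in> sets N \<Longrightarrow> \<nu> B = (\<integral>z. k z * indicator B (\<phi> z) \<partial>T)"
    and g[measurable]: "g \<in> borel_measurable N" and bnd: "\<And>x. x \<in> space N \<Longrightarrow> norm (g x) \<le> c"
  shows "signed_integral N \<nu> g = (\<integral>z. k z *\<^sub>R g (\<phi> z) \<partial>T)"
proof -
  have k'[measurable]: "k \<in> borel_measurable T" using k by auto
  interpret pos: finite_measure "pos_part N \<nu>" by (rule finite_measure_parts[OF \<nu>])
  interpret neg: finite_measure "neg_part N \<nu>" by (rule finite_measure_parts[OF \<nu>])
  have simple: "signed_integral N \<nu> s = (\<integral>z. k z *\<^sub>R s (\<phi> z) \<partial>T)"
    if s: "simple_function N s" for s :: "'b \<Rightarrow> 'c"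
  proof -
    let ?Y = "s ` space N" and ?E = "\<lambda>y. s -` {y} \<inter> space N"
    have fin: "finite ?Y" and E[measurable]: "\<And>y. y \<in> ?Y \<Longrightarrow> ?E y \<in> sets N"
      using s by (auto simp: simple_function_def)
    have one: "(\<integral>x. s x \<partial>m) = (\<Sum>y\<in>?Y. measure m (?E y) *\<^sub>R y)"
      if m: "finite_measure m" "sets m = sets N" for m
    proof -
      interpret finite_measure m by fact
      have sp: "space m = space N" using m(2) by (rule sets_eq_imp_space_eq)
      have "(\<integral>x. s x \<partial>m) = (\<integral>x. (\<Sum>y\<in>?Y. indicator (?E y) x *\<^sub>R y) \<partial>m)"
        by (intro Bochner_Integration.integral_cong refl simple_function_bochner_sum[OF s]) (simp add: sp)
      also have "\<dots> = (\<Sum>y\<in>?Y. \<integral>x. indicator (?E y) x *\<^sub>R y \<partial>m)"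
        using E m(2) by (intro Bochner_Integration.integral_sum integrable_scaleR_left)
          (auto intro!: integrable_real_indicator simp: less_top[symmetric])
      also have "\<dots> = (\<Sum>y\<in>?Y. measure m (?E y) *\<^sub>R y)"
      proof (intro sum.cong refl)
        fix y assume "y \<in> ?Y"
        then have "?E y \<in> sets m" using E m(2) by simp
        then show "(\<integral>x. indicator (?E y) x *\<^sub>R y \<partial>m) = measure m (?E y) *\<^sub>R y"
          by (intro has_bochner_integral_integral_eq has_bochner_integral_indicator)
            (simp_all add: less_top[symmetric])
      qed
      finally show ?thesis .
    qed
    have kint: "integrable T (\<lambda>z. k z * indicator (?E y) (\<phi> z))" if "y \<in> ?Y" for y
    proof -
      have [measurable]: "?E y \<in> sets N" using that by (rule E)
      show ?thesis
      proof (rule Bochner_Integration.integrable_bound[OF k])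
        show "(\<lambda>z. k z * indicator (?E y) (\<phi> z)) \<in> borel_measurable T" by measurable
      qed (simp add: indicator_def)
    qed
    have "signed_integral N \<nu> s = (\<Sum>y\<in>?Y. \<nu> (?E y) *\<^sub>R y)"
      unfolding signed_integral_def
      by (simp add: one finite_measure_parts[OF \<nu>] sum_subtractf[symmetric]
          scaleR_diff_left[symmetric] measure_pos_minus_neg[OF \<nu> E] cong: sum.cong)
    also have "\<dots> = (\<Sum>y\<in>?Y. \<integral>z. (k z * indicator (?E y) (\<phi> z)) *\<^sub>R y \<partial>T)"
      using kint by (intro sum.cong refl) (simp add: eq E)
    also have "\<dots> = (\<integral>z. (\<Sum>y\<in>?Y. (k z * indicator (?E y) (\<phi> z)) *\<^sub>R y) \<partial>T)"
      using kint by (intro Bochner_Integration.integral_sum[symmetric] integrable_scaleR_left)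
    also have "\<dots> = (\<integral>z. k z *\<^sub>R s (\<phi> z) \<partial>T)"
    proof (rule Bochner_Integration.integral_cong[OF refl])
      fix z assume "z \<in> space T"
      then have z: "\<phi> z \<in> space N" using \<phi> by (rule measurable_space[rotated])
      show "(\<Sum>y\<in>?Y. (k z * indicator (?E y) (\<phi> z)) *\<^sub>R y) = k z *\<^sub>R s (\<phi> z)"
        by (subst simple_function_bochner_sum[OF s z])
          (simp only: scaleR_sum_right scaleR_scaleR)
    qed
    finally show ?thesis .
  qed
  obtain s where s: "\<And>i :: nat. simple_function N (s i)"
    and lim: "\<And>x. x \<in> space N \<Longrightarrow> (\<lambda>i. s i x) \<longlonglongrightarrow> g x"
    and le: "\<And>i x. x \<in> space N \<Longrightarrow> norm (s i x) \<le> 2 * norm (g x)"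
    using borel_measurable_implies_sequence_metric[OF g, of 0] unfolding dist_norm diff_zero by blast
  have s'[measurable]: "\<And>i. s i \<in> borel_measurable N" using s by (rule borel_measurable_simple_function)
  have le': "norm (s i x) \<le> 2 * c" if "x \<in> space N" for i x
    using le[OF that, of i] bnd[OF that] by simp
  have "(\<lambda>i. signed_integral N \<nu> (s i)) \<longlonglongrightarrow> signed_integral N \<nu> g"
    unfolding signed_integral_def
    by (intro tendsto_diff integral_dominated_convergence[where w="\<lambda>_. 2 * c"])
       (auto simp: lim le')
  moreover have "(\<lambda>i. signed_integral N \<nu> (s i)) \<longlonglongrightarrow> (\<integral>z. k z *\<^sub>R g (\<phi> z) \<partial>T)"
    unfolding simple[OF s]
  proof (intro integral_dominated_convergence[where w="\<lambda>z. norm (k z) * (2 * c)"] AE_I2)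
    show "integrable T (\<lambda>z. norm (k z) * (2 * c))" using k by auto
    fix z assume "z \<in> space T"
    then have z: "\<phi> z \<in> space N" using \<phi> by (rule measurable_space[rotated])
    show "(\<lambda>i. k z *\<^sub>R s i (\<phi> z)) \<longlonglongrightarrow> k z *\<^sub>R g (\<phi> z)" by (intro tendsto_intros lim z)
    show "norm (k z *\<^sub>R s i (\<phi> z)) \<le> norm (k z) * (2 * c)" for i
      using le'[OF z, of i] by (simp add: mult_left_mono)
  qed measurable
  ultimately show ?thesis by (rule LIMSEQ_unique)
qed

definition hahn_sign :: "'a set \<Rightarrow> 'a \<Rightarrow> real" where
  "hahn_sign P x = (if x \<in> P then 1 else - 1)"

lemma hahn_sign_measurable [measurable]:
  "P \<in> sets M \<Longrightarrow> hahn_sign P \<in> borel_measurable M"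
proof -
  assume [measurable]: "P \<in> sets M"
  have "hahn_sign P = (\<lambda>x. 2 * indicator P x - 1)"
    by (auto simp: hahn_sign_def indicator_def)
  then show ?thesis by simp
qed

text \<open>
  The sign function of a Hahn set is the density of \<open>\<mu>\<close> with respect to its total variation.  This
  replaces integrals against signed measures by integrals against a finite measure.
\<close>

lemma signed_measure_polar:
  assumes \<mu>: "signed_measure M \<mu>" and P: "hahn_set M \<mu> P" and A: "A \<in> sets M"
  shows "\<mu> A = (\<integral>x. hahn_sign P x * indicator A x \<partial>total_variation M \<mu>)"
proof -
  interpret finite_measure "total_variation M \<mu>" by (rule finite_measure_parts[OF \<mu>])
  have Ps: "P \<in> sets M" using P by (rule hahn_set_sets)
  have pn: "0 \<le> \<mu> (A \<inter> P)" "\<mu> (A - P) \<le> 0"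
    by (rule hahn_set_signs[OF P A])+
  have tv: "measure (total_variation M \<mu>) B = \<mu> (B \<inter> P) - \<mu> (B - P)" if "B \<in> sets M" for B
  proof -
    have "0 \<le> \<mu> (B \<inter> P)" "\<mu> (B - P) \<le> 0"
      by (rule hahn_set_signs[OF P that])+
    then show ?thesis
      by (simp add: measure_def emeasure_total_variation[OF \<mu> that] emeasure_pos_part[OF \<mu> P that]
        emeasure_neg_part[OF \<mu> P that] ennreal_plus[symmetric] del: ennreal_plus)
  qed
  have "(\<integral>x. hahn_sign P x * indicator A x \<partial>total_variation M \<mu>) =
      (\<integral>x. indicator (A \<inter> P) x - indicator (A - P) x \<partial>total_variation M \<mu>)"
    by (intro Bochner_Integration.integral_cong) (auto simp: hahn_sign_def indicator_def)
  also have "\<dots> = measure (total_variation M \<mu>) (A \<inter> P) - measure (total_variation M \<mu>) (A - P)"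
    using A Ps sets.sets_into_space[OF A]
    by (subst Bochner_Integration.integral_diff)
       (auto intro!: integrable_real_indicator simp: less_top[symmetric] Int_absorb2 Diff_Int_distrib2)
  also have "\<dots> = \<mu> A"
  proof -
    have *: "A \<inter> P \<inter> P = A \<inter> P" "A \<inter> P - P = {}" "(A - P) \<inter> P = {}" "A - P - P = A - P" by auto
    have "A \<inter> P \<in> sets M" "A - P \<in> sets M" using A Ps by auto
    from this[THEN tv] show ?thesis
      using signed_measure_split[OF \<mu> A Ps] signed_measure_empty[OF \<mu>] unfolding * by simp
  qed
  finally show ?thesis by simp
qed

lemma integrable_hahn_sign:
  assumes \<mu>: "signed_measure M \<mu>" and P: "hahn_set M \<mu> P"
  shows "integrable (total_variation M \<mu>) (hahn_sign P)"
proof -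
  interpret finite_measure "total_variation M \<mu>" by (rule finite_measure_parts[OF \<mu>])
  show ?thesis using hahn_set_sets[OF P]
    by (intro integrable_const_bound[where B=1]) (auto simp: hahn_sign_def)
qed

lemma signed_integral_polar:
  fixes g :: "'a \<Rightarrow> 'c :: {banach, second_countable_topology}"
  assumes \<mu>: "signed_measure M \<mu>" and P: "hahn_set M \<mu> P"
    and g: "g \<in> borel_measurable M" and bnd: "\<And>x. x \<in> space M \<Longrightarrow> norm (g x) \<le> c"
  shows "signed_integral M \<mu> g = (\<integral>x. hahn_sign P x *\<^sub>R g x \<partial>total_variation M \<mu>)"
  by (rule signed_integral_image_density[OF \<mu> integrable_hahn_sign[OF \<mu> P] _ _ g bnd])
     (auto simp: signed_measure_polar[OF \<mu> P])

section \<open>Quasi-Levy type measures that extend to signed measures\<close>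

lemma emeasure_pos_part_SUP:
  assumes "signed_measure M \<mu>" "A \<in> sets M"
  shows "emeasure (pos_part M \<mu>) A = (SUP B\<in>{B \<in> sets M. B \<subseteq> A}. ennreal (\<mu> B))"
  using ex_hahn_set[OF assms(1)] hahn_set_Sup emeasure_pos_part assms by metis

text \<open>
  Uniqueness of the glued measure: a Borel set without \<open>0\<close> is the increasing union of its parts
  outside of \<open>(-1/n, 1/n)\<close>, and the point \<open>0\<close> carries no mass.
\<close>

lemma glue_eqI:
  assumes m: "sets m = sets borel" "emeasure m {0} = 0"
    "\<And>r B. 0 < r \<Longrightarrow> B \<in> sets (away r) \<Longrightarrow> emeasure m B = emeasure (Q (away r) \<nu>) B"
  shows "glue Q \<nu> = m"
  unfolding glue_def
proof (rule the_equality)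
  show "sets m = sets borel \<and> emeasure m {0} = 0 \<and>
    (\<forall>r>0. \<forall>B\<in>sets (away r). emeasure m B = emeasure (Q (away r) \<nu>) B)" using m by blast
  fix m' assume m': "sets m' = sets borel \<and> emeasure m' {0} = 0 \<and>
    (\<forall>r>0. \<forall>B\<in>sets (away r). emeasure m' B = emeasure (Q (away r) \<nu>) B)"
  show "m' = m"
  proof (rule measure_eqI)
    show "sets m' = sets m" using m m' by simp
    fix B assume "B \<in> sets m'"
    then have B[measurable]: "B \<in> sets borel" using m' by simp
    define C where "C n = B \<inter> - {- inverse (real (Suc n))<..<inverse (real (Suc n))}" for n
    have C: "C n \<in> sets (away (inverse (real (Suc n))))" for n
      unfolding away_def by (subst sets_restrict_space_iff) (auto simp: C_def)
    have C_borel: "C n \<in> sets borel" for n unfolding C_def by measurable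
    have inc: "incseq C"
    proof (rule incseq_SucI)
      fix n
      have "inverse (real (Suc (Suc n))) \<le> inverse (real (Suc n))"
        by (rule le_imp_inverse_le) auto
      moreover have "B \<inter> - {- a<..<a} \<subseteq> B \<inter> - {- b<..<b}" if "b \<le> a" for a b :: real
        using that by auto
      ultimately show "C n \<subseteq> C (Suc n)" unfolding C_def by blast
    qed
    have UN: "(\<Union>n. C n) = B - {0}"
    proof (intro equalityI subsetI)
      fix x assume x: "x \<in> B - {0}"
      then obtain n where "inverse (real (Suc n)) < \<bar>x\<bar>" using reals_Archimedean[of "\<bar>x\<bar>"] by auto
      then have "x \<in> C n" using x by (auto simp: C_def simp del: of_nat_Suc)
      then show "x \<in> (\<Union>n. C n)" by blast
    next
      fix x assume "x \<in> (\<Union>n. C n)"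
      then show "x \<in> B - {0}" by (auto simp: C_def)
    qed
    have eq: "emeasure \<mu> B = (SUP n. emeasure \<mu> (C n))"
      if \<mu>: "sets \<mu> = sets borel" "emeasure \<mu> {0} = 0" for \<mu>
    proof -
      have "emeasure \<mu> B = emeasure \<mu> (B - {0})"
        using \<mu> by (subst emeasure_Diff_null_set) (auto simp: null_sets_def)
      also have "\<dots> = (SUP n. emeasure \<mu> (C n))"
        unfolding UN[symmetric] using C_borel inc \<mu>(1) by (intro SUP_emeasure_incseq[symmetric]) auto
      finally show ?thesis .
    qed
    have "emeasure m' (C n) = emeasure m (C n)" for n
      using m(3)[OF _ C[of n]] m' C[of n] by simp
    then show "emeasure m' B = emeasure m B" using eq[of m] eq[of m'] m m' by simp
  qed
qed

lemma away_sets: "B \<in> sets (away r) \<longleftrightarrow> B \<in> sets borel \<and> B \<inter> {-r<..<r} = {}"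
  unfolding away_def by (subst sets_restrict_space_iff) auto

lemma signed_measure_away:
  assumes "signed_measure borel \<nu>"
  shows "signed_measure (away r) \<nu>"
  using assms unfolding signed_measure_def by (auto simp: away_sets image_subset_iff)

lemma emeasure_pos_part_away:
  assumes \<nu>: "signed_measure borel \<nu>" and B: "B \<in> sets (away r)"
  shows "emeasure (pos_part borel \<nu>) B = emeasure (pos_part (away r) \<nu>) B"
proof -
  have "{C \<in> sets borel. C \<subseteq> B} = {C \<in> sets (away r). C \<subseteq> B}"
    using B by (auto simp: away_sets)
  then show ?thesis
    using B by (simp add: emeasure_pos_part_SUP[OF \<nu>] emeasure_pos_part_SUP[OF signed_measure_away[OF \<nu>] B] away_sets)
qed

lemma emeasure_pos_part_zero:
  assumes \<nu>: "signed_measure borel \<nu>" "\<nu> {0 :: real} = 0"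
  shows "emeasure (pos_part borel \<nu>) {0} = 0"
proof -
  have "\<nu> B = 0" if "B \<subseteq> {0}" for B :: "real set"
    using that \<nu>(2) signed_measure_empty[OF \<nu>(1)] by (auto simp: subset_singleton_iff)
  then have "(SUP B\<in>{B \<in> sets borel. B \<subseteq> {0}}. ennreal (\<nu> B)) \<le> 0"
    by (intro SUP_least) auto
  then show ?thesis by (simp add: emeasure_pos_part_SUP[OF \<nu>(1)])
qed

text \<open>
  For a signed measure on all Borel sets the glued parts are the ordinary Jordan parts: the suprema
  that define them only involve subsets, which for \<open>B \<in> sets (away r)\<close> are the same in both spaces.
\<close>

lemma levy_parts_extended:
  assumes "extended_to_signed_measure \<nu>"
  shows "levy_pos \<nu> = pos_part borel \<nu>" "levy_neg \<nu> = neg_part borel \<nu>"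
    "levy_var \<nu> = total_variation borel \<nu>"
proof -
  have \<nu>: "signed_measure borel \<nu>" "\<nu> {0} = 0"
    using assms by (auto simp: extended_to_signed_measure_def)
  have \<nu>': "signed_measure borel (\<lambda>B. - \<nu> B)" "- \<nu> {0} = 0"
    using \<nu> signed_measure_uminus by auto
  show "levy_pos \<nu> = pos_part borel \<nu>" unfolding levy_pos_def
    by (rule glue_eqI) (use \<nu> in \<open>simp_all add: emeasure_pos_part_zero emeasure_pos_part_away\<close>)
  show "levy_neg \<nu> = neg_part borel \<nu>" unfolding levy_neg_def
    by (rule glue_eqI) (use \<nu>' in \<open>simp_all add: neg_part_def emeasure_pos_part_zero emeasure_pos_part_away\<close>)
  show "levy_var \<nu> = total_variation borel \<nu>" unfolding levy_var_def
  proof (rule glue_eqI)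
    show "emeasure (total_variation borel \<nu>) {0} = 0"
      using emeasure_pos_part_zero[OF \<nu>] emeasure_pos_part_zero[OF \<nu>']
      by (simp add: emeasure_total_variation[OF \<nu>(1)] neg_part_def)
    fix r B assume "0 < r" and B: "B \<in> sets (away r)"
    then have "B \<in> sets borel" by (simp add: away_sets)
    then show "emeasure (total_variation borel \<nu>) B = emeasure (total_variation (away r) \<nu>) B"
      using emeasure_pos_part_away[OF \<nu>(1) B] emeasure_pos_part_away[OF \<nu>'(1) B]
      by (simp add: emeasure_total_variation[OF \<nu>(1)] B
        emeasure_total_variation[OF signed_measure_away[OF \<nu>(1)]] neg_part_def)
  qed simp
qed

lemma levy_integral_extended:
  "extended_to_signed_measure \<nu> \<Longrightarrow> levy_integral \<nu> g = signed_integral borel \<nu> g"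
  by (simp add: levy_integral_def signed_integral_def levy_parts_extended)

lemma levy_integral_diff:
  fixes g h :: "real \<Rightarrow> real"
  assumes \<nu>: "extended_to_signed_measure \<nu>"
    and [measurable]: "g \<in> borel_measurable borel" "h \<in> borel_measurable borel"
    and "\<And>x. \<bar>g x\<bar> \<le> c" "\<And>x. \<bar>h x\<bar> \<le> d"
  shows "levy_integral \<nu> (\<lambda>x. g x - h x) = levy_integral \<nu> g - levy_integral \<nu> h"
proof -
  have s: "signed_measure borel \<nu>" using \<nu> by (simp add: extended_to_signed_measure_def)
  interpret pos: finite_measure "pos_part borel \<nu>" by (rule finite_measure_parts[OF s])
  interpret neg: finite_measure "neg_part borel \<nu>" by (rule finite_measure_parts[OF s])
  have "integrable (pos_part borel \<nu>) g" "integrable (pos_part borel \<nu>) h"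
    "integrable (neg_part borel \<nu>) g" "integrable (neg_part borel \<nu>) h"
    by (intro pos.integrable_const_bound[where B=c] pos.integrable_const_bound[where B=d]
      neg.integrable_const_bound[where B=c] neg.integrable_const_bound[where B=d]; simp add: assms)+
  then show ?thesis by (simp add: levy_integral_extended[OF \<nu>] signed_integral_def)
qed

lemma levy_integral_mult:
  fixes g :: "real \<Rightarrow> real"
  shows "levy_integral \<nu> (\<lambda>x. c * g x) = c * levy_integral \<nu> g"
  by (simp add: levy_integral_def right_diff_distrib)

lemma levy_integral_indicator:
  assumes \<nu>: "extended_to_signed_measure \<nu>" and B: "B \<in> sets borel"
  shows "levy_integral \<nu> (indicator B) = \<nu> B"
proof -
  have s: "signed_measure borel \<nu>" using \<nu> by (simp add: extended_to_signed_measure_def)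
  show ?thesis
    by (simp add: levy_integral_extended[OF \<nu>] signed_integral_def measure_pos_minus_neg[OF s B])
qed

lemma tau_measurable [measurable]: "\<tau> \<in> borel_measurable borel"
  unfolding \<tau>_def[abs_def] by measurable

lemma abs_tau_le: "\<bar>\<tau> x\<bar> \<le> 1"
  by (simp add: \<tau>_def)

section \<open>Hahn sets are detected on a countable basis\<close>

lemma signed_measure_incseq:
  assumes \<mu>: "signed_measure M \<mu>" and A: "\<And>n. A n \<in> sets M" "incseq A"
  shows "(\<lambda>n. \<mu> (A n)) \<longlonglongrightarrow> \<mu> (\<Union>n. A n)"
proof -
  interpret pos: finite_measure "pos_part M \<mu>" by (rule finite_measure_parts[OF \<mu>])
  interpret neg: finite_measure "neg_part M \<mu>" by (rule finite_measure_parts[OF \<mu>])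
  have U: "(\<Union>n. A n) \<in> sets M" using A by auto
  show ?thesis
    unfolding measure_pos_minus_neg[OF \<mu> A(1)] measure_pos_minus_neg[OF \<mu> U] using A
    by (intro tendsto_diff pos.finite_Lim_measure_incseq neg.finite_Lim_measure_incseq) auto
qed

lemma abs_le_total_variation:
  assumes \<mu>: "signed_measure M \<mu>" and A: "A \<in> sets M"
  shows "\<bar>\<mu> A\<bar> \<le> measure (total_variation M \<mu>) A"
proof -
  interpret pos: finite_measure "pos_part M \<mu>" by (rule finite_measure_parts[OF \<mu>])
  interpret neg: finite_measure "neg_part M \<mu>" by (rule finite_measure_parts[OF \<mu>])
  have "measure (total_variation M \<mu>) A = measure (pos_part M \<mu>) A + measure (neg_part M \<mu>) A"
    by (simp add: measure_def emeasure_total_variation[OF \<mu> A] enn2real_plus less_top[symmetric])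
  then show ?thesis
    using measure_pos_minus_neg[OF \<mu> A] measure_nonneg[of "pos_part M \<mu>" A]
      measure_nonneg[of "neg_part M \<mu>" A] by linarith
qed

text \<open>
  Nonnegativity passes from finite unions of basic sets to open sets by continuity from below, and
  from open sets to Borel sets by outer regularity of the total variation.  Only countably many sets are
  tested, which makes the criterion usable for almost every member of a family of signed measures.
\<close>

lemma nonneg_signed_measure_from_basis:
  fixes \<nu> :: "real set \<Rightarrow> real"
  assumes \<nu>: "signed_measure borel \<nu>" and P[measurable]: "P \<in> sets borel"
    and \<B>: "topological_basis \<B>" "countable \<B>"
    and nn: "\<And>\<G>. finite \<G> \<Longrightarrow> \<G> \<subseteq> \<B> \<Longrightarrow> 0 \<le> \<nu> (\<Union>\<G> \<inter> P)"
    and B[measurable]: "B \<in> sets borel"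
  shows "0 \<le> \<nu> (B \<inter> P)"
proof -
  interpret tv: finite_measure "total_variation borel \<nu>" by (rule finite_measure_parts[OF \<nu>])
  have op: "0 \<le> \<nu> (G \<inter> P)" if G: "open G" for G
  proof -
    obtain \<U> where \<U>: "\<U> \<subseteq> \<B>" "\<Union>\<U> = G" using \<B>(1) G by (auto simp: topological_basis_def)
    have cU: "countable \<U>" using \<U>(1) \<B>(2) countable_subset by blast
    have open_elem: "open X" if "X \<in> \<U>" for X using \<U>(1) \<B>(1) that topological_basis_open by blast
    show ?thesis
    proof (cases "\<U> = {}")
      case True
      then show ?thesis using \<U> signed_measure_empty[OF \<nu>] by auto
    next
      case False
      let ?A = "\<lambda>n. \<Union> (from_nat_into \<U> ` {..<n :: nat}) \<inter> P"
      have "from_nat_into \<U> i \<in> \<U>" for i using False by (rule from_nat_into)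
      then have *: "from_nat_into \<U> ` {..<n} \<subseteq> \<U>" for n by auto
      have "(\<lambda>n. \<nu> (?A n)) \<longlonglongrightarrow> \<nu> (\<Union>n. ?A n)"
      proof (rule signed_measure_incseq[OF \<nu>])
        show "?A n \<in> sets borel" for n
          using * open_elem by (intro sets.Int P borel_open open_Union) auto
        show "incseq ?A" by (rule incseq_SucI) (auto simp: less_Suc_eq)
      qed
      moreover have "(\<Union>n. ?A n) = G \<inter> P"
      proof (intro equalityI subsetI)
        fix x assume x: "x \<in> G \<inter> P"
        then obtain X where X: "X \<in> \<U>" "x \<in> X" using \<U>(2) by auto
        then obtain i where "X = from_nat_into \<U> i" using range_from_nat_into[OF False cU] by blast
        then have "x \<in> ?A (Suc i)" using x X by auto
        then show "x \<in> (\<Union>n. ?A n)" by blast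
      next
        fix x assume "x \<in> (\<Union>n. ?A n)"
        then show "x \<in> G \<inter> P" using * \<U>(2) by auto
      qed
      moreover have "0 \<le> \<nu> (?A n)" for n using *[of n] \<U>(1) by (intro nn) auto
      ultimately show ?thesis by (auto intro: LIMSEQ_le_const)
    qed
  qed
  show ?thesis
  proof (rule field_le_epsilon)
    fix e :: real assume e: "0 < e"
    let ?T = "total_variation borel \<nu>"
    have "emeasure ?T B < emeasure ?T B + ennreal e"
      using e by (simp add: tv.emeasure_eq_measure ennreal_plus[symmetric] ennreal_less_iff del: ennreal_plus)
    then have "(INF U \<in> {U. B \<subseteq> U \<and> open U}. emeasure ?T U) < emeasure ?T B + ennreal e"
      using outer_regular[of ?T B] by (simp add: tv.emeasure_finite)
    then obtain U where U: "B \<subseteq> U" "open U" "emeasure ?T U < emeasure ?T B + ennreal e"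
      by (auto simp: INF_less_iff)
    have [measurable]: "U \<in> sets borel" using U(2) by simp
    have "measure ?T U < measure ?T B + e"
      using U(3) e by (simp add: tv.emeasure_eq_measure ennreal_plus[symmetric] ennreal_less_iff del: ennreal_plus)
    moreover have "measure ?T (U - B) = measure ?T U - measure ?T B"
      using U by (intro tv.finite_measure_Diff) auto
    moreover have "\<bar>\<nu> ((U - B) \<inter> P)\<bar> \<le> measure ?T ((U - B) \<inter> P)"
      by (intro abs_le_total_variation[OF \<nu>]) auto
    moreover have "measure ?T ((U - B) \<inter> P) \<le> measure ?T (U - B)"
      by (intro tv.finite_measure_mono) auto
    moreover have "\<nu> (U \<inter> P) = \<nu> ((B \<inter> P) \<union> ((U - B) \<inter> P))"
      using U(1) by (intro arg_cong[where f=\<nu>]) auto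
    moreover have "\<nu> ((B \<inter> P) \<union> ((U - B) \<inter> P)) = \<nu> (B \<inter> P) + \<nu> ((U - B) \<inter> P)"
      by (intro signed_measure_Un[OF \<nu>]) auto
    ultimately show "0 \<le> \<nu> (B \<inter> P) + e" using op[OF U(2)] by linarith
  qed
qed

lemma hahn_set_from_basis:
  fixes \<nu> :: "real set \<Rightarrow> real"
  assumes \<nu>: "signed_measure borel \<nu>" and P: "P \<in> sets borel"
    and \<B>: "topological_basis \<B>" "countable \<B>"
    and nn: "\<And>\<G>. finite \<G> \<Longrightarrow> \<G> \<subseteq> \<B> \<Longrightarrow> 0 \<le> \<nu> (\<Union>\<G> \<inter> P)"
    and np: "\<And>\<G>. finite \<G> \<Longrightarrow> \<G> \<subseteq> \<B> \<Longrightarrow> \<nu> (\<Union>\<G> \<inter> - P) \<le> 0"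
  shows "hahn_set borel \<nu> P"
proof -
  have 1: "0 \<le> \<nu> (B \<inter> P)" if "B \<in> sets borel" for B
    by (rule nonneg_signed_measure_from_basis[OF \<nu> P \<B> nn that])
  have 2: "0 \<le> - \<nu> (B \<inter> - P)" if "B \<in> sets borel" for B
  proof (rule nonneg_signed_measure_from_basis[OF signed_measure_uminus[OF \<nu>] _ \<B> _ that])
    show "- P \<in> sets borel" using P borel_comp by blast
  qed (use np in auto)
  have "0 \<le> \<nu> B" if "B \<in> sets borel" "B \<subseteq> P" for B using 1[OF that(1)] that(2) by (simp add: Int_absorb2)
  moreover have "\<nu> B \<le> 0" if "B \<in> sets borel" "B \<inter> P = {}" for B
  proof -
    have "B \<inter> - P = B" using that(2) by auto
    then show ?thesis using 2[OF that(1)] by simp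
  qed
  ultimately show ?thesis using P by (auto simp: hahn_set_def positive_set_def)
qed

text \<open>
  Writes the total mass as an integral against \<open>\<mu>\<close>, to which a disintegration can be applied.
\<close>

lemma emeasure_total_variation_space:
  assumes \<mu>: "signed_measure M \<mu>" and P: "hahn_set M \<mu> P"
  shows "emeasure (total_variation M \<mu>) (space M) = ennreal (signed_integral M \<mu> (hahn_sign P))"
proof -
  interpret tv: finite_measure "total_variation M \<mu>" by (rule finite_measure_parts[OF \<mu>])
  have "signed_integral M \<mu> (hahn_sign P) = (\<integral>x. hahn_sign P x *\<^sub>R hahn_sign P x \<partial>total_variation M \<mu>)"
    by (rule signed_integral_polar[OF \<mu> P, where c=1])
       (auto simp: hahn_sign_measurable[OF hahn_set_sets[OF P]], simp add: hahn_sign_def)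
  also have "\<dots> = (\<integral>x. 1 \<partial>total_variation M \<mu>)"
    by (intro Bochner_Integration.integral_cong) (auto simp: hahn_sign_def)
  finally show ?thesis by (simp add: tv.emeasure_eq_measure)
qed

text \<open>
  Test with the set on which \<open>g\<close> is negative.
\<close>

lemma AE_nonneg_of_set_integrals:
  fixes g :: "'a \<Rightarrow> real"
  assumes g: "integrable M g"
    and nn: "\<And>A. A \<in> sets M \<Longrightarrow> 0 \<le> (\<integral>x. indicator A x * g x \<partial>M)"
  shows "AE x in M. 0 \<le> g x"
proof -
  have [measurable]: "g \<in> borel_measurable M" using g by auto
  define A where "A = {x \<in> space M. g x < 0}"
  have A: "A \<in> sets M" unfolding A_def by measurable
  have int: "integrable M (\<lambda>x. - (indicator A x * g x))"
    using integrable_mult_indicator[OF A g] by simp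
  have nonneg: "AE x in M. 0 \<le> - (indicator A x * g x)"
    by (auto simp: A_def indicator_def)
  have "(\<integral>x. - (indicator A x * g x) \<partial>M) = 0"
    using nn[OF A] integral_nonneg_AE[OF nonneg] by simp
  then have "AE x in M. - (indicator A x * g x) = 0"
    using integral_nonneg_eq_0_iff_AE[OF int nonneg] by simp
  then show ?thesis
    using AE_space by eventually_elim (auto simp: A_def indicator_def split: if_splits)
qed

section \<open>Convergence in probability and characteristic functions\<close>

lemma norm_iexp_diff_le: "norm (iexp a - iexp b) \<le> \<bar>a - b\<bar>"
proof -
  have "iexp a - iexp b = iexp b * (iexp (a - b) - 1)"
    by (simp add: algebra_simps exp_add[symmetric])
  then have "norm (iexp a - iexp b) = norm (iexp (a - b) - 1)"
    by (simp add: norm_mult)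
  also have "\<dots> \<le> \<bar>a - b\<bar>" using iexp_approx1[of "a - b" 0] by simp
  finally show ?thesis .
qed

lemma norm_iexp_diff_le_2: "norm (iexp a - iexp b) \<le> 2"
  using norm_triangle_ineq4[of "iexp a" "iexp b"] by simp

lemma norm_iexp_minus_1_le: "norm (iexp x - 1) \<le> 2"
  using norm_iexp_diff_le_2[of x 0] by simp

text \<open>
  A two-index Cauchy condition follows from its instances along pairs of index sequences that tend to
  infinity.  Such pairs are preferred below because limit theorems for integrals are about sequences.
\<close>

lemma ex_cauchy_bound:
  fixes Q :: "nat \<Rightarrow> nat \<Rightarrow> real"
  assumes "\<And>p q. (\<And>N. N \<le> p N) \<Longrightarrow> (\<And>N. N \<le> q N) \<Longrightarrow> (\<lambda>N. Q (p N) (q N)) \<longlonglongrightarrow> 0"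
    and e: "0 < e"
  shows "\<exists>N. \<forall>n\<ge>N. \<forall>m\<ge>N. \<bar>Q n m\<bar> < e"
proof (rule ccontr)
  assume "\<not> ?thesis"
  then have "\<forall>N. \<exists>n m. N \<le> n \<and> N \<le> m \<and> e \<le> \<bar>Q n m\<bar>" by (meson not_less)
  then obtain p q where pq: "\<And>N. N \<le> p N" "\<And>N. N \<le> q N" "\<And>N. e \<le> \<bar>Q (p N) (q N)\<bar>" by metis
  have "eventually (\<lambda>N. \<bar>Q (p N) (q N)\<bar> < e) sequentially"
    using assms(1)[OF pq(1,2)] e by (auto simp: tendsto_iff dist_real_def)
  then show False using pq(3) by (auto simp: eventually_sequentially not_less[symmetric])
qed

lemma filterlim_ge_sequentially: "(\<And>N. N \<le> p N) \<Longrightarrow> filterlim p sequentially sequentially"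
  by (rule filterlim_at_top_mono[OF filterlim_ident]) simp

context prob_space
begin

lemma converges_in_prob_imp_char:
  assumes X[measurable]: "\<And>n. X n \<in> borel_measurable M" and conv: "converges_in_prob M X Y"
  shows "(\<lambda>n. \<integral>\<omega>. iexp (t * X n \<omega>) \<partial>M) \<longlonglongrightarrow> (\<integral>\<omega>. iexp (t * Y \<omega>) \<partial>M)"
proof -
  have Y[measurable]: "Y \<in> borel_measurable M" using conv by (simp add: converges_in_prob_def)
  let ?p = "\<lambda>d n. measure M {\<omega> \<in> space M. d < \<bar>X n \<omega> - Y \<omega>\<bar>}"
  have int: "integrable M (\<lambda>\<omega>. iexp (t * Z \<omega>))" if [measurable]: "Z \<in> borel_measurable M" for Z
    by (intro integrable_const_bound[where B=1]) auto
  have bound: "norm ((\<integral>\<omega>. iexp (t * X n \<omega>) \<partial>M) - (\<integral>\<omega>. iexp (t * Y \<omega>) \<partial>M)) \<le> \<bar>t\<bar> * d + 2 * ?p d n"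
    if d: "0 < d" for d n
  proof -
    have "(\<integral>\<omega>. iexp (t * X n \<omega>) \<partial>M) - (\<integral>\<omega>. iexp (t * Y \<omega>) \<partial>M) =
        (\<integral>\<omega>. iexp (t * X n \<omega>) - iexp (t * Y \<omega>) \<partial>M)"
      by (intro Bochner_Integration.integral_diff[symmetric] int) auto
    also have "norm \<dots> \<le> (\<integral>\<omega>. norm (iexp (t * X n \<omega>) - iexp (t * Y \<omega>)) \<partial>M)"
      by (rule integral_norm_bound)
    also have "\<dots> \<le> (\<integral>\<omega>. \<bar>t\<bar> * d + 2 * indicator {\<omega> \<in> space M. d < \<bar>X n \<omega> - Y \<omega>\<bar>} \<omega> \<partial>M)"
    proof (intro integral_mono integrable_norm Bochner_Integration.integrable_diff int X Y)
      show "integrable M (\<lambda>\<omega>. \<bar>t\<bar> * d + 2 * indicator {\<omega> \<in> space M. d < \<bar>X n \<omega> - Y \<omega>\<bar>} \<omega>)"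
        by (auto intro!: integrable_real_indicator simp: less_top[symmetric])
      fix \<omega> assume \<omega>: "\<omega> \<in> space M"
      have "norm (iexp (t * X n \<omega>) - iexp (t * Y \<omega>)) \<le> \<bar>t\<bar> * \<bar>X n \<omega> - Y \<omega>\<bar>"
        using norm_iexp_diff_le[of "t * X n \<omega>" "t * Y \<omega>"] by (simp add: right_diff_distrib[symmetric] abs_mult)
      moreover have "\<bar>t\<bar> * \<bar>X n \<omega> - Y \<omega>\<bar> \<le> \<bar>t\<bar> * d" if "\<bar>X n \<omega> - Y \<omega>\<bar> \<le> d"
        using that by (intro mult_left_mono) auto
      moreover have "0 \<le> \<bar>t\<bar> * d" using d by simp
      ultimately show "norm (iexp (t * X n \<omega>) - iexp (t * Y \<omega>)) \<le>
          \<bar>t\<bar> * d + 2 * indicator {\<omega> \<in> space M. d < \<bar>X n \<omega> - Y \<omega>\<bar>} \<omega>"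
        using \<omega> norm_iexp_diff_le_2[of "t * X n \<omega>" "t * Y \<omega>"]
        by (cases "d < \<bar>X n \<omega> - Y \<omega>\<bar>") auto
    qed
    also have "\<dots> = \<bar>t\<bar> * d + 2 * ?p d n"
      by (subst Bochner_Integration.integral_add)
        (auto intro!: integrable_real_indicator simp: less_top[symmetric] prob_space Int_absorb2)
    finally show ?thesis .
  qed
  show ?thesis
  proof (rule LIMSEQ_I)
    fix e :: real assume e: "0 < e"
    \<comment> \<open>the summand 1 covers t = 0\<close>
  define d where "d = e / (2 * (\<bar>t\<bar> + 1))"
    have d: "0 < d" using e by (simp add: d_def)
    have "\<bar>t\<bar> * d \<le> (\<bar>t\<bar> + 1) * d" using d by (intro mult_right_mono) auto
    also have "\<dots> = e / 2" by (simp add: d_def field_simps)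
    finally have td: "\<bar>t\<bar> * d \<le> e / 2" .
    have "?p d \<longlonglongrightarrow> 0" using conv d by (simp add: converges_in_prob_def)
    then have "eventually (\<lambda>n. ?p d n < e / 4) sequentially"
      using e by (intro order_tendstoD) auto
    then obtain N where "\<And>n. N \<le> n \<Longrightarrow> ?p d n < e / 4" by (auto simp: eventually_sequentially)
    then have "norm ((\<integral>\<omega>. iexp (t * X n \<omega>) \<partial>M) - (\<integral>\<omega>. iexp (t * Y \<omega>) \<partial>M)) < e" if "N \<le> n" for n
      using bound[OF d, of n] td that by fastforce
    then show "\<exists>N. \<forall>n\<ge>N. norm ((\<integral>\<omega>. iexp (t * X n \<omega>) \<partial>M) - (\<integral>\<omega>. iexp (t * Y \<omega>) \<partial>M)) < e" by blast
  qed
qed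

text \<open>
  By Levy's continuity theorem the laws converge weakly to the point mass at \<open>0\<close>; testing this with
  \<open>min 1 \<bar>x\<bar>\<close> and Markov's inequality gives convergence in probability.
\<close>

lemma char_tendsto_1_imp_converges_in_prob:
  assumes D[measurable]: "\<And>n. D n \<in> borel_measurable M"
    and char: "\<And>t. (\<lambda>n. \<integral>\<omega>. iexp (t * D n \<omega>) \<partial>M) \<longlonglongrightarrow> 1"
  shows "converges_in_prob M D (\<lambda>_. 0)"
  unfolding converges_in_prob_def
proof (intro conjI allI impI)
  fix e :: real assume e: "0 < e"
  have R: "real_distribution (return borel 0)"
    using prob_space_return[of 0 borel] by (simp add: real_distribution_def real_distribution_axioms_def)
  have RD: "real_distribution (distr M borel (D n))" for n
    by (rule real_distribution_distr) simp
  have "weak_conv_m (\<lambda>n. distr M borel (D n)) (return borel 0)"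
  proof (rule levy_continuity[OF RD R])
    fix t
    have "char (distr M borel (D n)) t = (\<integral>\<omega>. iexp (t * D n \<omega>) \<partial>M)" for n
      unfolding char_def by (subst integral_distr) auto
    moreover have "char (return borel 0) t = 1"
      unfolding char_def by (subst integral_return) auto
    ultimately show "(\<lambda>n. char (distr M borel (D n)) t) \<longlonglongrightarrow> char (return borel 0) t"
      using char by simp
  qed
  then have "(\<lambda>n. \<integral>x. min 1 \<bar>x\<bar> \<partial>distr M borel (D n)) \<longlonglongrightarrow> (\<integral>x. min 1 \<bar>x\<bar> \<partial>return borel 0)"
  proof (rule weak_conv_imp_integral_bdd_continuous_conv[OF RD R, where B=1])
    show "isCont (\<lambda>x :: real. min 1 \<bar>x\<bar>) x" for x by (intro continuous_intros)
  qed auto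
  moreover have "(\<integral>x. min 1 \<bar>x\<bar> \<partial>return borel (0::real)) = 0" by (subst integral_return) auto
  moreover have "(\<integral>x. min 1 \<bar>x\<bar> \<partial>distr M borel (D n)) = (\<integral>\<omega>. min 1 \<bar>D n \<omega>\<bar> \<partial>M)" for n
    by (subst integral_distr) auto
  ultimately have lim: "(\<lambda>n. (\<integral>\<omega>. min 1 \<bar>D n \<omega>\<bar> \<partial>M) / min 1 e) \<longlonglongrightarrow> 0"
    using e by (auto intro!: tendsto_divide_zero)
  have le: "measure M {\<omega> \<in> space M. e < \<bar>D n \<omega> - 0\<bar>} \<le> (\<integral>\<omega>. min 1 \<bar>D n \<omega>\<bar> \<partial>M) / min 1 e" for n
  proof -
    have "measure M {\<omega> \<in> space M. e < \<bar>D n \<omega> - 0\<bar>} \<le> measure M {\<omega> \<in> space M. min 1 \<bar>D n \<omega>\<bar> \<ge> min 1 e}"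
      by (intro finite_measure_mono) auto
    also have "\<dots> \<le> (\<integral>\<omega>. min 1 \<bar>D n \<omega>\<bar> \<partial>M) / min 1 e"
      using e by (intro integral_Markov_inequality_measure[where A="{}"] integrable_const_bound[where B=1]) auto
    finally show ?thesis .
  qed
  show "(\<lambda>n. measure M {\<omega> \<in> space M. e < \<bar>D n \<omega> - 0\<bar>}) \<longlonglongrightarrow> 0"
    by (rule tendsto_sandwich[OF _ _ tendsto_const lim]) (intro always_eventually allI le measure_nonneg)+
qed simp

text \<open>
  The previous lemma for constant random variables.
\<close>

lemma iexp_tendsto_1_imp_tendsto_0:
  assumes "\<And>t. (\<lambda>n. iexp (t * d n)) \<longlonglongrightarrow> 1"
  shows "d \<longlonglongrightarrow> 0"
proof -
  have conv: "converges_in_prob M (\<lambda>n _. d n) (\<lambda>_. 0)"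
    by (rule char_tendsto_1_imp_converges_in_prob) (use assms in \<open>simp_all add: prob_space\<close>)
  show ?thesis
  proof (rule LIMSEQ_I)
    fix e :: real assume e: "0 < e"
    then have "(\<lambda>n. measure M {\<omega> \<in> space M. e / 2 < \<bar>d n - 0\<bar>}) \<longlonglongrightarrow> 0"
      using conv[unfolded converges_in_prob_def] half_gt_zero by blast
    then have "eventually (\<lambda>n. measure M {\<omega> \<in> space M. e / 2 < \<bar>d n - 0\<bar>} < 1) sequentially"
      by (intro order_tendstoD) auto
    then obtain N where N: "\<And>n. N \<le> n \<Longrightarrow> measure M {\<omega> \<in> space M. e / 2 < \<bar>d n - 0\<bar>} < 1"
      by (auto simp: eventually_sequentially)
    have "norm (d n - 0) < e" if "N \<le> n" for n
    proof (rule ccontr)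
      assume "\<not> norm (d n - 0) < e"
      then have "{\<omega> \<in> space M. e / 2 < \<bar>d n - 0\<bar>} = space M" using e by auto
      then show False using N[OF that] by (simp add: prob_space)
    qed
    then show "\<exists>N. \<forall>n\<ge>N. norm (d n - 0) < e" by blast
  qed
qed

lemma prob_abs_diff_triangle:
  fixes X Y Z :: "'a \<Rightarrow> real"
  assumes [measurable]: "X \<in> borel_measurable M" "Y \<in> borel_measurable M" "Z \<in> borel_measurable M"
  shows "measure M {\<omega> \<in> space M. e < \<bar>X \<omega> - Z \<omega>\<bar>} \<le>
    measure M {\<omega> \<in> space M. e / 2 < \<bar>X \<omega> - Y \<omega>\<bar>} + measure M {\<omega> \<in> space M. e / 2 < \<bar>Z \<omega> - Y \<omega>\<bar>}"
proof -
  have "measure M {\<omega> \<in> space M. e < \<bar>X \<omega> - Z \<omega>\<bar>} \<le>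
    measure M ({\<omega> \<in> space M. e / 2 < \<bar>X \<omega> - Y \<omega>\<bar>} \<union> {\<omega> \<in> space M. e / 2 < \<bar>Z \<omega> - Y \<omega>\<bar>})"
  proof (intro finite_measure_mono)
    have "e / 2 < \<bar>x - y\<bar> \<or> e / 2 < \<bar>z - y\<bar>" if "e < \<bar>x - z\<bar>" for x y z :: real
      using that by linarith
    then show "{\<omega> \<in> space M. e < \<bar>X \<omega> - Z \<omega>\<bar>} \<subseteq>
      {\<omega> \<in> space M. e / 2 < \<bar>X \<omega> - Y \<omega>\<bar>} \<union> {\<omega> \<in> space M. e / 2 < \<bar>Z \<omega> - Y \<omega>\<bar>}" by blast
  qed measurable
  also have "\<dots> \<le> measure M {\<omega> \<in> space M. e / 2 < \<bar>X \<omega> - Y \<omega>\<bar>} + measure M {\<omega> \<in> space M. e / 2 < \<bar>Z \<omega> - Y \<omega>\<bar>}"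
    by (intro measure_Un_le) auto
  finally show ?thesis .
qed

lemma converges_in_prob_imp_cauchy:
  assumes X[measurable]: "\<And>n. X n \<in> borel_measurable M" and conv: "converges_in_prob M X Y"
    and pq: "\<And>N. N \<le> p N" "\<And>N. N \<le> q N"
  shows "converges_in_prob M (\<lambda>N \<omega>. X (p N) \<omega> - X (q N) \<omega>) (\<lambda>_. 0)"
  unfolding converges_in_prob_def
proof (intro conjI allI impI)
  have Y[measurable]: "Y \<in> borel_measurable M" using conv by (simp add: converges_in_prob_def)
  fix e :: real assume e: "0 < e"
  let ?p = "\<lambda>n. measure M {\<omega> \<in> space M. e / 2 < \<bar>X n \<omega> - Y \<omega>\<bar>}"
  have "?p \<longlonglongrightarrow> 0" using conv e half_gt_zero unfolding converges_in_prob_def by blast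
  then have "(\<lambda>N. ?p (p N)) \<longlonglongrightarrow> 0" "(\<lambda>N. ?p (q N)) \<longlonglongrightarrow> 0"
    by (rule filterlim_compose, intro filterlim_ge_sequentially pq)+
  from tendsto_add[OF this] have lim: "(\<lambda>N. ?p (p N) + ?p (q N)) \<longlonglongrightarrow> 0" by simp
  show "(\<lambda>N. measure M {\<omega> \<in> space M. e < \<bar>X (p N) \<omega> - X (q N) \<omega> - 0\<bar>}) \<longlonglongrightarrow> 0"
    unfolding diff_0_right
    by (rule tendsto_sandwich[OF _ _ tendsto_const lim])
      (intro always_eventually allI prob_abs_diff_triangle measure_nonneg X Y)+
qed simp

text \<open>
  Along a fast subsequence the increments are summable almost surely by the Borel-Cantelli lemma; its
  pointwise limit is the limit in probability of the whole sequence.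
\<close>

lemma cauchy_imp_converges_in_prob:
  assumes X[measurable]: "\<And>n. X n \<in> borel_measurable M"
    and cauchy: "\<And>p q. (\<And>N. N \<le> p N) \<Longrightarrow> (\<And>N. N \<le> q N) \<Longrightarrow>
      converges_in_prob M (\<lambda>N \<omega>. X (p N) \<omega> - X (q N) \<omega>) (\<lambda>_. 0)"
  shows "\<exists>Y. converges_in_prob M X Y"
proof -
  let ?p = "\<lambda>e n m. measure M {\<omega> \<in> space M. e < \<bar>X n \<omega> - X m \<omega>\<bar>}"
  have C: "\<exists>N. \<forall>n\<ge>N. \<forall>m\<ge>N. \<bar>?p e n m\<bar> < d" if "0 < e" "0 < d" for e d
    using cauchy that by (intro ex_cauchy_bound) (simp_all add: converges_in_prob_def)
  have "\<exists>r. \<forall>k :: nat. (\<forall>n\<ge>r k. \<forall>m\<ge>r k. \<bar>?p ((1/2)^k) n m\<bar> < (1/2)^k) \<and> r k < r (Suc k)"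
  proof (rule dependent_nat_choice)
    show "\<exists>N. \<forall>n\<ge>N. \<forall>m\<ge>N. \<bar>?p ((1/2)^0) n m\<bar> < (1/2)^0" using C[of 1 1] by simp
    fix N k
    obtain N' where "\<forall>n\<ge>N'. \<forall>m\<ge>N'. \<bar>?p ((1/2)^Suc k) n m\<bar> < (1/2)^Suc k"
      using C[of "(1/2)^Suc k" "(1/2)^Suc k"] by auto
    then show "\<exists>N'. (\<forall>n\<ge>N'. \<forall>m\<ge>N'. \<bar>?p ((1/2)^Suc k) n m\<bar> < (1/2)^Suc k) \<and> N < N'"
      by (intro exI[of _ "max N' (Suc N)"]) auto
  qed
  then obtain r where
    "\<forall>k. (\<forall>n\<ge>r k. \<forall>m\<ge>r k. \<bar>?p ((1/2)^k) n m\<bar> < (1/2)^k) \<and> r k < r (Suc k)" by (rule exE)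
  then have r: "\<And>k n m. r k \<le> n \<Longrightarrow> r k \<le> m \<Longrightarrow> \<bar>?p ((1/2)^k) n m\<bar> < (1/2)^k"
    "\<And>k. r k < r (Suc k)" by blast+
  then have r_le: "k \<le> r k" for k
    by (intro strict_mono_imp_increasing) (simp add: strict_mono_Suc_iff)
  let ?A = "\<lambda>k. {\<omega> \<in> space M. (1/2)^k < \<bar>X (r k) \<omega> - X (r (Suc k)) \<omega>\<bar>}"
  have "AE \<omega> in M. eventually (\<lambda>k. \<omega> \<in> space M - ?A k) sequentially"
  proof (rule borel_cantelli_AE1)
    have "summable (\<lambda>k. measure M (?A k))"
    proof (rule summable_comparison_test)
      show "summable (\<lambda>k. (1/2 :: real)^k)" by simp
      have "norm (measure M (?A k)) \<le> (1/2)^k" for k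
        using r(1)[of k "r k" "r (Suc k)"] less_imp_le[OF r(2)[of k]] by simp
      then show "\<exists>N. \<forall>k\<ge>N. norm (measure M (?A k)) \<le> (1/2)^k" by blast
    qed
    then show "summable (\<lambda>k. measure M (?A k))" .
  qed (auto simp: less_top[symmetric])
  then have ae: "AE \<omega> in M. convergent (\<lambda>k. X (r k) \<omega>)"
  proof eventually_elim
    case (elim \<omega>)
    then obtain N where N: "\<And>k. N \<le> k \<Longrightarrow> \<bar>X (r k) \<omega> - X (r (Suc k)) \<omega>\<bar> \<le> (1/2)^k"
      by (auto simp: eventually_sequentially not_less)
    have "summable (\<lambda>k. X (r (Suc k)) \<omega> - X (r k) \<omega>)"
    proof (rule summable_comparison_test)
      show "summable (\<lambda>k. (1/2 :: real)^k)" by simp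
      show "\<exists>N. \<forall>k\<ge>N. norm (X (r (Suc k)) \<omega> - X (r k) \<omega>) \<le> (1/2)^k"
        using N by (auto simp: abs_minus_commute)
    qed
    then have "convergent (\<lambda>n. \<Sum>k<n. X (r (Suc k)) \<omega> - X (r k) \<omega>)" by (simp add: summable_iff_convergent)
    then have "convergent (\<lambda>n. (\<Sum>k<n. X (r (Suc k)) \<omega> - X (r k) \<omega>) + X (r 0) \<omega>)"
      by (intro convergent_add convergent_const)
    then show ?case using sum_lessThan_telescope[of "\<lambda>k. X (r k) \<omega>"] by simp
  qed
  define Y where "Y \<omega> = lim (\<lambda>k. X (r k) \<omega>)" for \<omega>
  have Y[measurable]: "Y \<in> borel_measurable M"
    unfolding Y_def by (rule borel_measurable_lim_metric) simp
  have tail: "(\<lambda>k. measure M {\<omega> \<in> space M. e < \<bar>Y \<omega> - X (r k) \<omega>\<bar>}) \<longlonglongrightarrow> 0" if e: "0 < e" for e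
  proof -
    let ?E = "\<lambda>k. {\<omega> \<in> space M. e < \<bar>Y \<omega> - X (r k) \<omega>\<bar>}"
    have "(\<lambda>k. \<integral>\<omega>. indicator (?E k) \<omega> \<partial>M) \<longlonglongrightarrow> (\<integral>\<omega>. (0 :: real) \<partial>M)"
    proof (rule integral_dominated_convergence[where w="\<lambda>_. 1"])
      show "AE \<omega> in M. (\<lambda>k. indicator (?E k) \<omega>) \<longlonglongrightarrow> (0 :: real)"
        using ae
      proof eventually_elim
        case (elim \<omega>)
        then have "(\<lambda>k. X (r k) \<omega>) \<longlonglongrightarrow> Y \<omega>" unfolding Y_def by (rule convergent_LIMSEQ_iff[THEN iffD1])
        then have "eventually (\<lambda>k. dist (X (r k) \<omega>) (Y \<omega>) < e) sequentially" using e by (rule tendstoD)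
        then have "eventually (\<lambda>k. indicator (?E k) \<omega> = (0 :: real)) sequentially"
          by eventually_elim (auto simp: dist_real_def indicator_def)
        then show ?case by (rule tendsto_eventually)
      qed
    qed (auto simp: indicator_def)
    then show ?thesis by (simp add: Int_absorb2)
  qed
  have "converges_in_prob M X Y"
    unfolding converges_in_prob_def
  proof (intro conjI allI impI Y)
    fix e :: real assume e: "0 < e"
    show "(\<lambda>n. measure M {\<omega> \<in> space M. e < \<bar>X n \<omega> - Y \<omega>\<bar>}) \<longlonglongrightarrow> 0"
    proof (rule LIMSEQ_I)
      fix d :: real assume d: "0 < d"
      obtain N where N: "\<And>n m. N \<le> n \<Longrightarrow> N \<le> m \<Longrightarrow> \<bar>?p (e/2) n m\<bar> < d / 2"
        using C[of "e/2" "d/2"] e d by auto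
      have "eventually (\<lambda>k. measure M {\<omega> \<in> space M. e / 2 < \<bar>Y \<omega> - X (r k) \<omega>\<bar>} < d / 2) sequentially"
        using tail[of "e/2"] e d by (intro order_tendstoD) auto
      then obtain K where K: "\<And>k. K \<le> k \<Longrightarrow> measure M {\<omega> \<in> space M. e / 2 < \<bar>Y \<omega> - X (r k) \<omega>\<bar>} < d / 2"
        by (auto simp: eventually_sequentially)
      have "norm (measure M {\<omega> \<in> space M. e < \<bar>X n \<omega> - Y \<omega>\<bar>} - 0) < d" if "N \<le> n" for n
      proof -
        let ?k = "max K N"
        have "N \<le> r ?k" using r_le[of ?k] by simp
        then show ?thesis
          using prob_abs_diff_triangle[OF X[of n] X[of "r ?k"] Y, of e] N[OF that, of "r ?k"] K[of ?k]
          by simp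
      qed
      then show "\<exists>N. \<forall>n\<ge>N. norm (measure M {\<omega> \<in> space M. e < \<bar>X n \<omega> - Y \<omega>\<bar>} - 0) < d" by blast
    qed
  qed
  then show ?thesis by blast
qed

end

section \<open>Limits of Cauchy sequences of integrands\<close>

text \<open>
  The core of the Vitali-Hahn-Saks theorem.  If the \<open>L\<^sup>1\<close> norms do not tend to \<open>0\<close>, choose indices
  \<open>k n\<close> and disjoint sets \<open>R n\<close> such that \<open>d (k n)\<close> has most of its large \<open>L\<^sup>1\<close> mass on \<open>R n\<close>.
  Collecting over all \<open>n\<close> the part of \<open>R n\<close> where \<open>d (k n)\<close> is nonnegative, and the part where it is
  negative, yields two sets on which the integrals of the \<open>d (k n)\<close> cannot both tend to \<open>0\<close>.
  The sets \<open>B j\<close>, on which the functions are uniformly bounded from index \<open>j\<close> on, take the place of the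
  exceptional sets in Egorov's theorem.
\<close>

lemma (in finite_measure) gliding_hump_L1:
  fixes d :: "nat \<Rightarrow> 'a \<Rightarrow> real"
  assumes d: "\<And>n. integrable M (d n)"
    and ae: "AE x in M. (\<lambda>n. d n x) \<longlonglongrightarrow> 0"
    and setwise: "\<And>A. A \<in> sets M \<Longrightarrow> (\<lambda>n. \<integral>x. indicator A x * d n x \<partial>M) \<longlonglongrightarrow> 0"
  shows "(\<lambda>n. \<integral>x. \<bar>d n x\<bar> \<partial>M) \<longlonglongrightarrow> 0"
proof (rule ccontr)
  assume "\<not> ?thesis"
  then obtain e where e: "0 < e" and inf: "\<And>N. \<exists>n\<ge>N. e \<le> (\<integral>x. \<bar>d n x\<bar> \<partial>M)"
    unfolding LIMSEQ_def dist_real_def by (auto simp: not_less)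
  have [measurable]: "d n \<in> borel_measurable M" for n using d by auto
  have int_ind: "integrable M (\<lambda>x. indicator A x * d n x)" "integrable M (\<lambda>x. indicator A x * \<bar>d n x\<bar>)"
    if "A \<in> sets M" for A n
    using integrable_mult_indicator[OF that d[of n]]
      integrable_mult_indicator[OF that integrable_abs[OF d[of n]]] by simp_all
  define B where "B j = {x \<in> space M. \<forall>k\<ge>j. \<bar>d k x\<bar> \<le> 1}" for j
  have B[measurable]: "B j \<in> sets M" for j unfolding B_def by measurable
  have B_mono: "B i \<subseteq> B j" if "i \<le> j" for i j using that by (auto simp: B_def)
  have inside: "(\<lambda>k. \<integral>x. indicator (B j) x * \<bar>d k x\<bar> \<partial>M) \<longlonglongrightarrow> 0" for j
  proof (rule LIMSEQ_offset)
    have "(\<lambda>k. \<integral>x. indicator (B j) x * \<bar>d (k + j) x\<bar> \<partial>M) \<longlonglongrightarrow> (\<integral>x. 0 \<partial>M)"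
    proof (rule integral_dominated_convergence[where w="\<lambda>_. 1"])
      show "AE x in M. (\<lambda>k. indicator (B j) x * \<bar>d (k + j) x\<bar>) \<longlonglongrightarrow> 0"
        using ae
      proof eventually_elim
        case (elim x)
        then show ?case
          by (intro tendsto_mult_right_zero tendsto_rabs_zero LIMSEQ_ignore_initial_segment)
      qed
      show "AE x in M. norm (indicator (B j) x * \<bar>d (k + j) x\<bar>) \<le> 1" for k
        by (auto simp: indicator_def B_def)
    qed auto
    then show "(\<lambda>k. \<integral>x. indicator (B j) x * \<bar>d (k + j) x\<bar> \<partial>M) \<longlonglongrightarrow> 0" by simp
  qed
  have outside: "(\<lambda>j. \<integral>x. indicator (space M - B j) x * \<bar>d k x\<bar> \<partial>M) \<longlonglongrightarrow> 0" for k
  proof -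
    have "(\<lambda>j. \<integral>x. indicator (space M - B j) x * \<bar>d k x\<bar> \<partial>M) \<longlonglongrightarrow> (\<integral>x. 0 \<partial>M)"
    proof (rule integral_dominated_convergence[where w="\<lambda>x. \<bar>d k x\<bar>"])
      show "AE x in M. (\<lambda>j. indicator (space M - B j) x * \<bar>d k x\<bar>) \<longlonglongrightarrow> 0"
        using ae AE_space
      proof eventually_elim
        case (elim x)
        then have "eventually (\<lambda>n. \<bar>d n x\<bar> < 1) sequentially"
          by (auto simp: tendsto_iff dist_real_def)
        then obtain N where "\<And>n. N \<le> n \<Longrightarrow> \<bar>d n x\<bar> < 1" by (auto simp: eventually_sequentially)
        then have "\<bar>d k x\<bar> \<le> 1" if "N \<le> j" "j \<le> k" for j k
          using that by (meson le_trans less_imp_le)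
        then have "x \<in> B j" if "N \<le> j" for j using elim that by (auto simp: B_def)
        then have "eventually (\<lambda>j. indicator (space M - B j) x * \<bar>d k x\<bar> = 0) sequentially"
          by (auto simp: eventually_sequentially intro!: exI[of _ N])
        then show ?case by (rule tendsto_eventually)
      qed
    qed (auto simp: d indicator_def)
    then show ?thesis by simp
  qed
  let ?P = "\<lambda>(k, j). e \<le> (\<integral>x. \<bar>d k x\<bar> \<partial>M) \<and> (\<integral>x. indicator (space M - B j) x * \<bar>d k x\<bar> \<partial>M) < e / 8"
  let ?Q = "\<lambda>(k, j) (k', j'). k < k' \<and> j \<le> j' \<and> (\<integral>x. indicator (B j) x * \<bar>d k' x\<bar> \<partial>M) < e / 8"
  have step: "\<exists>y. ?P y \<and> ?Q (k, j) y" for k j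
  proof -
    have "eventually (\<lambda>k. (\<integral>x. indicator (B j) x * \<bar>d k x\<bar> \<partial>M) < e / 8) sequentially"
      using inside[of j] e by (intro order_tendstoD) auto
    then obtain N where N: "\<And>k. N \<le> k \<Longrightarrow> (\<integral>x. indicator (B j) x * \<bar>d k x\<bar> \<partial>M) < e / 8"
      by (auto simp: eventually_sequentially)
    obtain k' where k': "max N (Suc k) \<le> k'" "e \<le> (\<integral>x. \<bar>d k' x\<bar> \<partial>M)" using inf by blast
    have "eventually (\<lambda>j. (\<integral>x. indicator (space M - B j) x * \<bar>d k' x\<bar> \<partial>M) < e / 8) sequentially"
      using outside[of k'] e by (intro order_tendstoD) auto
    then obtain J where J: "\<And>j. J \<le> j \<Longrightarrow> (\<integral>x. indicator (space M - B j) x * \<bar>d k' x\<bar> \<partial>M) < e / 8"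
      by (auto simp: eventually_sequentially)
    show ?thesis
      using k' N[of k'] J[of "max J j"] by (intro exI[of _ "(k', max J j)"]) auto
  qed
  have "\<exists>z. \<forall>n :: nat. ?P (z n) \<and> ?Q (z n) (z (Suc n))"
  proof (rule dependent_nat_choice)
    show "\<exists>y. ?P y" using step by blast
    show "\<exists>y. ?P y \<and> ?Q x y" for x :: "nat \<times> nat" and n :: nat using step[of "fst x" "snd x"] by simp
  qed
  then obtain z where z: "\<forall>n :: nat. ?P (z n) \<and> ?Q (z n) (z (Suc n))" by (rule exE)
  define k where "k n = fst (z (Suc n))" for n
  define j where "j n = snd (z n)" for n
  have big: "e \<le> (\<integral>x. \<bar>d (k n) x\<bar> \<partial>M)"
    and out: "(\<integral>x. indicator (space M - B (j (Suc n))) x * \<bar>d (k n) x\<bar> \<partial>M) < e / 8"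
    and ins: "(\<integral>x. indicator (B (j n)) x * \<bar>d (k n) x\<bar> \<partial>M) < e / 8"
    and k_less: "k n < k (Suc n)" and j_le: "j n \<le> j (Suc n)" for n
    using spec[OF z, of n] spec[OF z, of "Suc n"] unfolding k_def j_def case_prod_beta by blast+
  have j_mono: "j m \<le> j n" if "m \<le> n" for m n using that j_le by (rule lift_Suc_mono_le[rotated])
  \<comment> \<open>the disjoint sets carrying the humps\<close>
  define R where "R n = B (j (Suc n)) - B (j n)" for n
  have R_unique: "m = n" if "x \<in> R m" "x \<in> R n" for x m n
  proof (rule ccontr)
    assume "m \<noteq> n"
    then consider "Suc m \<le> n" | "Suc n \<le> m" by linarith
    then show False
    proof cases
      case 1
      then have "B (j (Suc m)) \<subseteq> B (j n)" by (intro B_mono j_mono)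
      then show ?thesis using that by (auto simp: R_def)
    next
      case 2
      then have "B (j (Suc n)) \<subseteq> B (j m)" by (intro B_mono j_mono)
      then show ?thesis using that by (auto simp: R_def)
    qed
  qed
  define A where "A = (\<Union>n. R n \<inter> {x \<in> space M. 0 \<le> d (k n) x})"
  define A' where "A' = (\<Union>n. R n \<inter> {x \<in> space M. d (k n) x < 0})"
  have [measurable]: "A \<in> sets M" "A' \<in> sets M" unfolding A_def A'_def R_def by measurable
  have "e / 2 \<le> (\<integral>x. indicator A x * d (k n) x \<partial>M) - (\<integral>x. indicator A' x * d (k n) x \<partial>M)" for n
  proof -
    have "\<bar>d (k n) x\<bar> - 2 * (indicator (B (j n)) x * \<bar>d (k n) x\<bar>)
        - 2 * (indicator (space M - B (j (Suc n))) x * \<bar>d (k n) x\<bar>)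
      \<le> indicator A x * d (k n) x - indicator A' x * d (k n) x" (is "?l x \<le> ?r x") if x: "x \<in> space M" for x
    \<comment> \<open>on R n the two sets reproduce the sign of the hump; elsewhere each error counts twice\<close>
    proof (cases "x \<in> R n")
      case True
      have R_iff: "x \<in> R m \<longleftrightarrow> m = n" for m using True R_unique by blast
      have "x \<in> A \<longleftrightarrow> 0 \<le> d (k n) x" "x \<in> A' \<longleftrightarrow> d (k n) x < 0"
        by (simp_all add: A_def A'_def R_iff x)
      moreover have "x \<notin> B (j n)" "x \<in> B (j (Suc n))" using True by (auto simp: R_def)
      ultimately show ?thesis by (auto simp: indicator_def)
    next
      case False
      then have "x \<in> B (j n) \<or> x \<in> space M - B (j (Suc n))" using x by (auto simp: R_def)
      then have "?l x \<le> - \<bar>d (k n) x\<bar>" by (auto simp: indicator_def)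
      also have "- \<bar>d (k n) x\<bar> \<le> ?r x"
      proof -
        have "\<not> (x \<in> A \<and> x \<in> A')"
        proof
          assume "x \<in> A \<and> x \<in> A'"
          then obtain m m' where "x \<in> R m" "0 \<le> d (k m) x" "x \<in> R m'" "d (k m') x < 0"
            unfolding A_def A'_def by blast
          then show False using R_unique[of x m m'] by simp
        qed
        then show ?thesis by (auto simp: indicator_def)
      qed
      finally show ?thesis .
    qed
    then have "(\<integral>x. ?l x \<partial>M) \<le> (\<integral>x. ?r x \<partial>M)"
      by (intro integral_mono) (auto intro!: Bochner_Integration.integrable_diff integrable_mult_right int_ind d)
    moreover have "(\<integral>x. ?l x \<partial>M) = (\<integral>x. \<bar>d (k n) x\<bar> \<partial>M) - 2 * (\<integral>x. indicator (B (j n)) x * \<bar>d (k n) x\<bar> \<partial>M)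
        - 2 * (\<integral>x. indicator (space M - B (j (Suc n))) x * \<bar>d (k n) x\<bar> \<partial>M)"
      by (simp add: int_ind d)
    moreover have "(\<integral>x. ?r x \<partial>M) = (\<integral>x. indicator A x * d (k n) x \<partial>M) - (\<integral>x. indicator A' x * d (k n) x \<partial>M)"
      by (simp add: int_ind)
    ultimately show ?thesis using big[of n] ins[of n] out[of n] by linarith
  qed
  moreover have "(\<lambda>n. (\<integral>x. indicator A x * d (k n) x \<partial>M) - (\<integral>x. indicator A' x * d (k n) x \<partial>M)) \<longlonglongrightarrow> 0 - 0"
  proof (rule tendsto_diff)
    have "strict_mono k" using k_less by (simp add: strict_mono_Suc_iff)
    then have "filterlim k sequentially sequentially" by (rule filterlim_subseq)
    then show "(\<lambda>n. \<integral>x. indicator A x * d (k n) x \<partial>M) \<longlonglongrightarrow> 0" "(\<lambda>n. \<integral>x. indicator A' x * d (k n) x \<partial>M) \<longlonglongrightarrow> 0"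
      using setwise[of A] setwise[of A'] by (auto intro: filterlim_compose[where f=k])
  qed
  ultimately have "e / 2 \<le> 0 - 0" by (intro LIMSEQ_le_const) auto
  then show False using e by simp
qed

text \<open>
  Used with \<open>\<phi>\<close> the absolute value and the square: fix \<open>n\<close>, let \<open>m\<close> tend to infinity and apply
  Fatou's lemma.
\<close>

lemma Fatou_cauchy_AE_limit:
  fixes g :: "nat \<Rightarrow> 'a \<Rightarrow> real"
  assumes [measurable]: "\<And>n. g n \<in> borel_measurable M" "g0 \<in> borel_measurable M"
    and ae: "AE x in M. (\<lambda>n. g n x) \<longlonglongrightarrow> g0 x"
    and \<phi>: "continuous_on UNIV \<phi>" "\<And>y. 0 \<le> \<phi> y"
    and int: "\<And>n m. integrable M (\<lambda>x. \<phi> (g n x - g m x))"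
    and cauchy: "\<And>e. 0 < e \<Longrightarrow> \<exists>N. \<forall>n\<ge>N. \<forall>m\<ge>N. (\<integral>x. \<phi> (g n x - g m x) \<partial>M) < e"
    and e: "0 < e"
  shows "\<exists>N. \<forall>n\<ge>N. integrable M (\<lambda>x. \<phi> (g n x - g0 x)) \<and> (\<integral>x. \<phi> (g n x - g0 x) \<partial>M) \<le> (e :: real)"
proof -
  have [measurable]: "\<phi> \<in> borel_measurable borel" using \<phi>(1) by (rule borel_measurable_continuous_onI)
  obtain N where N: "\<And>n m. N \<le> n \<Longrightarrow> N \<le> m \<Longrightarrow> (\<integral>x. \<phi> (g n x - g m x) \<partial>M) < e"
    using cauchy[OF e] by blast
  have "integrable M (\<lambda>x. \<phi> (g n x - g0 x)) \<and> (\<integral>x. \<phi> (g n x - g0 x) \<partial>M) \<le> e" if n: "N \<le> n" for n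
  proof -
    have "(\<integral>\<^sup>+x. ennreal (\<phi> (g n x - g0 x)) \<partial>M) = (\<integral>\<^sup>+x. liminf (\<lambda>m. ennreal (\<phi> (g n x - g m x))) \<partial>M)"
    proof (rule nn_integral_cong_AE)
      show "AE x in M. ennreal (\<phi> (g n x - g0 x)) = liminf (\<lambda>m. ennreal (\<phi> (g n x - g m x)))"
        using ae
      proof eventually_elim
        case (elim x)
        have "(\<lambda>m. ennreal (\<phi> (g n x - g m x))) \<longlonglongrightarrow> ennreal (\<phi> (g n x - g0 x))"
          by (intro tendsto_ennrealI continuous_on_tendsto_compose[OF \<phi>(1)] tendsto_diff tendsto_const elim) auto
        from lim_imp_Liminf[OF trivial_limit_sequentially this] show ?case by (rule sym)
      qed
    qed
    also have "\<dots> \<le> liminf (\<lambda>m. \<integral>\<^sup>+x. ennreal (\<phi> (g n x - g m x)) \<partial>M)"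
      by (rule nn_integral_liminf) simp
    also have "\<dots> \<le> limsup (\<lambda>m. \<integral>\<^sup>+x. ennreal (\<phi> (g n x - g m x)) \<partial>M)"
      by (rule Liminf_le_Limsup) simp
    also have "\<dots> \<le> ennreal e"
    proof (rule Limsup_bounded)
      show "eventually (\<lambda>m. (\<integral>\<^sup>+x. ennreal (\<phi> (g n x - g m x)) \<partial>M) \<le> ennreal e) sequentially"
        unfolding eventually_sequentially
      proof (intro exI allI impI)
        fix m assume "N \<le> m"
        then show "(\<integral>\<^sup>+x. ennreal (\<phi> (g n x - g m x)) \<partial>M) \<le> ennreal e"
          using N[OF n, of m] int by (subst nn_integral_eq_integral) (auto intro!: ennreal_leI simp: \<phi>)
      qed
    qed
    finally have le: "(\<integral>\<^sup>+x. ennreal (\<phi> (g n x - g0 x)) \<partial>M) \<le> ennreal e" .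
    have i: "integrable M (\<lambda>x. \<phi> (g n x - g0 x))"
      using le_less_trans[OF le ennreal_less_top] by (intro integrableI_bounded) (auto simp: \<phi>)
    have "ennreal (\<integral>x. \<phi> (g n x - g0 x) \<partial>M) \<le> ennreal e"
      using le by (subst nn_integral_eq_integral[symmetric]) (auto simp: i \<phi>)
    then show ?thesis using e i by (subst (asm) ennreal_le_iff) auto
  qed
  then show ?thesis by blast
qed

lemma L1_cauchy_AE_limit:
  fixes g :: "nat \<Rightarrow> 'a \<Rightarrow> real"
  assumes g: "\<And>n. integrable M (g n)" and g0[measurable]: "g0 \<in> borel_measurable M"
    and ae: "AE x in M. (\<lambda>n. g n x) \<longlonglongrightarrow> g0 x"
    and cauchy: "\<And>e. 0 < e \<Longrightarrow> \<exists>N. \<forall>n\<ge>N. \<forall>m\<ge>N. (\<integral>x. \<bar>g n x - g m x\<bar> \<partial>M) < e"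
  shows "integrable M g0" "(\<lambda>n. \<integral>x. g n x \<partial>M) \<longlonglongrightarrow> (\<integral>x. g0 x \<partial>M)"
proof -
  have [measurable]: "g n \<in> borel_measurable M" for n using g by auto
  have small: "\<exists>N. \<forall>n\<ge>N. integrable M (\<lambda>x. \<bar>g n x - g0 x\<bar>) \<and> (\<integral>x. \<bar>g n x - g0 x\<bar> \<partial>M) \<le> e"
    if e: "0 < e" for e
    by (rule Fatou_cauchy_AE_limit[OF _ g0 ae _ _ _ cauchy e]) (auto intro!: continuous_intros simp: g)
  obtain N where "integrable M (\<lambda>x. \<bar>g N x - g0 x\<bar>)" using small[of 1] by auto
  then have "integrable M (\<lambda>x. g N x - g0 x)" by (subst (asm) integrable_abs_iff) auto
  from Bochner_Integration.integrable_diff[OF g[of N] this] show g0_int: "integrable M g0" by simp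
  show "(\<lambda>n. \<integral>x. g n x \<partial>M) \<longlonglongrightarrow> (\<integral>x. g0 x \<partial>M)"
  proof (rule LIMSEQ_I)
    fix e :: real assume e: "0 < e"
    obtain N where N: "\<And>n. N \<le> n \<Longrightarrow> (\<integral>x. \<bar>g n x - g0 x\<bar> \<partial>M) \<le> e / 2"
      using small[of "e / 2"] e by auto
    have "norm ((\<integral>x. g n x \<partial>M) - (\<integral>x. g0 x \<partial>M)) < e" if "N \<le> n" for n
    proof -
      have "(\<integral>x. g n x \<partial>M) - (\<integral>x. g0 x \<partial>M) = (\<integral>x. g n x - g0 x \<partial>M)" by (simp add: g g0_int)
      then have "norm ((\<integral>x. g n x \<partial>M) - (\<integral>x. g0 x \<partial>M)) \<le> e / 2"
        using order_trans[OF integral_abs_bound N[OF that]] by simp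
      then show ?thesis using e by linarith
    qed
    then show "\<exists>N. \<forall>n\<ge>N. norm ((\<integral>x. g n x \<partial>M) - (\<integral>x. g0 x \<partial>M)) < e" by blast
  qed
qed

lemma L2_cauchy_AE_limit:
  fixes g :: "nat \<Rightarrow> 'a \<Rightarrow> real"
  assumes [measurable]: "\<And>n. g n \<in> borel_measurable M" and g0[measurable]: "g0 \<in> borel_measurable M"
    and g: "\<And>n. integrable M (\<lambda>x. (g n x)\<^sup>2)"
    and int: "\<And>n m. integrable M (\<lambda>x. (g n x - g m x)\<^sup>2)"
    and ae: "AE x in M. (\<lambda>n. g n x) \<longlonglongrightarrow> g0 x"
    and cauchy: "\<And>e. 0 < e \<Longrightarrow> \<exists>N. \<forall>n\<ge>N. \<forall>m\<ge>N. (\<integral>x. (g n x - g m x)\<^sup>2 \<partial>M) < e"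
  shows "integrable M (\<lambda>x. (g0 x)\<^sup>2)" "(\<lambda>n. \<integral>x. (g n x)\<^sup>2 \<partial>M) \<longlonglongrightarrow> (\<integral>x. (g0 x)\<^sup>2 \<partial>M)"
proof -
  have small: "\<exists>N. \<forall>n\<ge>N. integrable M (\<lambda>x. (g n x - g0 x)\<^sup>2) \<and> (\<integral>x. (g n x - g0 x)\<^sup>2 \<partial>M) \<le> e"
    if e: "0 < e" for e
    by (rule Fatou_cauchy_AE_limit[OF _ g0 ae _ _ _ cauchy e]) (auto intro!: continuous_intros simp: int)
  obtain N where "integrable M (\<lambda>x. (g N x - g0 x)\<^sup>2)" using small[of 1] by auto
  then have "integrable M (\<lambda>x. 2 * (g N x)\<^sup>2 + 2 * (g N x - g0 x)\<^sup>2)" using g by auto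
  then show g0_int: "integrable M (\<lambda>x. (g0 x)\<^sup>2)"
  proof (rule Bochner_Integration.integrable_bound)
    have "v\<^sup>2 \<le> 2 * u\<^sup>2 + 2 * (u - v)\<^sup>2" for u v :: real
      using zero_le_power2[of "2 * u - v"] by (simp add: power2_eq_square algebra_simps)
    then show "AE x in M. norm ((g0 x)\<^sup>2) \<le> norm (2 * (g N x)\<^sup>2 + 2 * (g N x - g0 x)\<^sup>2)"
      by (auto intro: order_trans)
  qed simp
  define I where "I = (\<integral>x. (g0 x)\<^sup>2 \<partial>M)"
  have I: "0 \<le> I" unfolding I_def by simp
  show "(\<lambda>n. \<integral>x. (g n x)\<^sup>2 \<partial>M) \<longlonglongrightarrow> (\<integral>x. (g0 x)\<^sup>2 \<partial>M)"
  proof (rule LIMSEQ_I)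
    fix e :: real assume e: "0 < e"
    define r where "r = e / (2 * (I + 1))"
    have r: "0 < r" using e I by (simp add: r_def)
    have rI: "r * I \<le> e / 2"
    proof -
      have "r * I \<le> r * (I + 1)" using r by simp
      also have "\<dots> = e / 2" using I by (simp add: r_def field_simps)
      finally show ?thesis .
    qed
    define c where "c = 1 + 1 / r"
    have c: "0 < c" using r by (simp add: c_def add_pos_pos)
    obtain N where N: "\<And>n. N \<le> n \<Longrightarrow> integrable M (\<lambda>x. (g n x - g0 x)\<^sup>2)"
      "\<And>n. N \<le> n \<Longrightarrow> (\<integral>x. (g n x - g0 x)\<^sup>2 \<partial>M) \<le> e / (4 * c)"
      using small[of "e / (4 * c)"] e c by auto
    have "norm ((\<integral>x. (g n x)\<^sup>2 \<partial>M) - (\<integral>x. (g0 x)\<^sup>2 \<partial>M)) < e" if n: "N \<le> n" for n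
    proof -
      \<comment> \<open>Young's inequality with weight r, small against the norm of the limit\<close>
      have young: "\<bar>u\<^sup>2 - v\<^sup>2\<bar> \<le> r * v\<^sup>2 + c * (u - v)\<^sup>2" for u v :: real
      proof -
        have "2 * \<bar>v * (u - v)\<bar> \<le> r * v\<^sup>2 + (u - v)\<^sup>2 / r"
        proof -
          have "(r * x - y)\<^sup>2 / r = r * x\<^sup>2 - 2 * (x * y) + y\<^sup>2 / r" for x y :: real
            using r by (simp add: power2_eq_square field_simps)
          from this[of "\<bar>v\<bar>" "\<bar>u - v\<bar>"]
          have "r * v\<^sup>2 - 2 * \<bar>v * (u - v)\<bar> + (u - v)\<^sup>2 / r = (r * \<bar>v\<bar> - \<bar>u - v\<bar>)\<^sup>2 / r"
            by (simp add: abs_mult)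
          moreover have "0 \<le> (r * \<bar>v\<bar> - \<bar>u - v\<bar>)\<^sup>2 / r" using r by simp
          ultimately show ?thesis by linarith
        qed
        moreover have "u\<^sup>2 - v\<^sup>2 = 2 * (v * (u - v)) + (u - v)\<^sup>2"
          by (simp add: power2_eq_square algebra_simps)
        then have "\<bar>u\<^sup>2 - v\<^sup>2\<bar> \<le> 2 * \<bar>v * (u - v)\<bar> + (u - v)\<^sup>2"
          using abs_triangle_ineq[of "2 * (v * (u - v))" "(u - v)\<^sup>2"] by (simp add: abs_mult)
        ultimately show ?thesis by (simp add: c_def algebra_simps)
      qed
      have "(\<integral>x. (g n x)\<^sup>2 \<partial>M) - (\<integral>x. (g0 x)\<^sup>2 \<partial>M) = (\<integral>x. (g n x)\<^sup>2 - (g0 x)\<^sup>2 \<partial>M)"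
        by (simp add: g g0_int)
      also have "\<bar>\<dots>\<bar> \<le> (\<integral>x. \<bar>(g n x)\<^sup>2 - (g0 x)\<^sup>2\<bar> \<partial>M)" by (rule integral_abs_bound)
      also have "\<dots> \<le> (\<integral>x. r * (g0 x)\<^sup>2 + c * (g n x - g0 x)\<^sup>2 \<partial>M)"
        by (rule integral_mono) (auto simp: g g0_int N(1)[OF n] young)
      also have "\<dots> = r * I + c * (\<integral>x. (g n x - g0 x)\<^sup>2 \<partial>M)"
        by (simp add: g0_int N(1)[OF n] I_def)
      also have "\<dots> \<le> e / 2 + c * (e / (4 * c))"
        using rI N(2)[OF n] c by (intro add_mono mult_left_mono) auto
      also have "\<dots> < e" using c e by simp
      finally show ?thesis by simp
    qed
    then show "\<exists>N. \<forall>n\<ge>N. norm ((\<integral>x. (g n x)\<^sup>2 \<partial>M) - (\<integral>x. (g0 x)\<^sup>2 \<partial>M)) < e" by blast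
  qed
qed

text \<open>
  The form in which the gliding hump enters: weak information about all sets \<open>A\<close> together with an
  almost everywhere limit gives integrability of that limit.
\<close>

lemma (in finite_measure) setwise_cauchy_AE_limit:
  fixes g :: "nat \<Rightarrow> 'a \<Rightarrow> real"
  assumes g: "\<And>n. integrable M (g n)" and g0: "g0 \<in> borel_measurable M"
    and ae: "AE x in M. (\<lambda>n. g n x) \<longlonglongrightarrow> g0 x"
    and cauchy: "\<And>A p q. A \<in> sets M \<Longrightarrow> (\<And>N. N \<le> p N) \<Longrightarrow> (\<And>N. N \<le> q N) \<Longrightarrow>
      (\<lambda>N. \<integral>x. indicator A x * (g (p N) x - g (q N) x) \<partial>M) \<longlonglongrightarrow> 0"
  shows "integrable M g0" "(\<lambda>n. \<integral>x. g n x \<partial>M) \<longlonglongrightarrow> (\<integral>x. g0 x \<partial>M)"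
proof -
  have "(\<lambda>N. \<integral>x. \<bar>g (p N) x - g (q N) x\<bar> \<partial>M) \<longlonglongrightarrow> 0" if pq: "\<And>N. N \<le> p N" "\<And>N. N \<le> q N" for p q
  proof (rule gliding_hump_L1)
    show "AE x in M. (\<lambda>N. g (p N) x - g (q N) x) \<longlonglongrightarrow> 0"
      using ae
    proof eventually_elim
      case (elim x)
      have "(\<lambda>N. g (p N) x - g (q N) x) \<longlonglongrightarrow> g0 x - g0 x"
        by (intro tendsto_diff filterlim_compose[OF elim] filterlim_ge_sequentially pq)
      then show ?case by simp
    qed
  qed (use g cauchy pq in auto)
  from ex_cauchy_bound[where Q="\<lambda>n m. \<integral>x. \<bar>g n x - g m x\<bar> \<partial>M", OF this]
  have "\<exists>N. \<forall>n\<ge>N. \<forall>m\<ge>N. (\<integral>x. \<bar>g n x - g m x\<bar> \<partial>M) < e" if "0 < e" for e using that by simp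
  note lim = L1_cauchy_AE_limit[OF g g0 ae this]
  show "integrable M g0" "(\<lambda>n. \<integral>x. g n x \<partial>M) \<longlonglongrightarrow> (\<integral>x. g0 x \<partial>M)"
    by (rule lim, assumption)+
qed

section \<open>The signed measure on the product space and its disintegration\<close>

text \<open>
  The random measure with its control measure and disintegration, fixed for all integrands.
\<close>

locale bounded_qid_setting =
  fixes P :: "'w measure" and S :: "'s measure" and \<Lambda> :: "'s set \<Rightarrow> 'w \<Rightarrow> real"
    and \<nu>0 :: "'s set \<Rightarrow> real" and \<nu>1 :: "'s measure" and FA :: "'s set \<Rightarrow> real set \<Rightarrow> real"
    and F :: "('s \<times> real) set \<Rightarrow> real" and lam :: "'s measure" and a \<sigma>2 :: "'s \<Rightarrow> real"
    and \<rho> :: "'s \<Rightarrow> real set \<Rightarrow> real"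
  assumes prob: "prob_space P"
    and L: "qid_random_measure P S \<Lambda>"
    and \<nu>0: "signed_measure S \<nu>0"
    and \<nu>1: "sets \<nu>1 = sets S" "finite_measure \<nu>1"
    and bimeasure: "signed_bimeasure S FA"
    and triplet: "\<And>A. A \<in> sets S \<Longrightarrow> has_triplet (distr P borel (\<Lambda> A)) (\<nu>0 A) (measure \<nu>1 A) (FA A)"
    and bounded: "bimeasure_variation S FA (space S) < \<infinity>"
    and lam: "lam = control_measure S \<nu>0 \<nu>1 FA"
    and a: "is_RN_deriv lam \<nu>0 a"
    and \<sigma>2: "is_RN_deriv lam (measure \<nu>1) \<sigma>2"
    and F: "signed_measure (S \<Otimes>\<^sub>M borel) F"
    and F_rect: "\<And>A B. A \<in> sets S \<Longrightarrow> B \<in> sets borel \<Longrightarrow> F (A \<times> B) = FA A B"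
    and disint: "disintegration S lam F \<rho>"
begin

lemma lam_sets [simp, measurable_cong]: "sets lam = sets S"
  and lam_space [simp]: "space lam = space S"
  by (simp_all add: lam control_measure_def)

text \<open>
  Evaluated on the whole space, the set function defining the control measure is finite by the
  finiteness of total variations and the bound on the bimeasure.  The measure construction yields either
  this value or \<open>0\<close>, so finiteness follows before countable additivity is known.
\<close>

lemma lam_finite: "finite_measure lam"
proof (rule finite_measureI)
  interpret \<nu>1: finite_measure \<nu>1 by (rule \<nu>1)
  interpret tv: finite_measure "total_variation S \<nu>0" by (rule finite_measure_parts[OF \<nu>0])
  have "emeasure lam (space S) \<le> emeasure (total_variation S \<nu>0) (space S) + emeasure \<nu>1 (space S)
      + bimeasure_variation S FA (space S)"
    unfolding lam control_measure_def
    by (subst emeasure_measure_of_conv) auto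
  also have "\<dots> < \<infinity>" using bounded by (simp add: less_top[symmetric])
  finally show "emeasure lam (space lam) \<noteq> \<infinity>" by simp
qed

sublocale lam: finite_measure lam by (rule lam_finite)

sublocale P: prob_space P by (rule prob)

definition hahnF :: "('s \<times> real) set" where
  "hahnF = (SOME Q. hahn_set (S \<Otimes>\<^sub>M borel) F Q)"

lemma hahnF: "hahn_set (S \<Otimes>\<^sub>M borel) F hahnF"
  unfolding hahnF_def using ex_hahn_set[OF F] by (rule someI_ex)

lemma hahnF_sets [measurable]: "hahnF \<in> sets (S \<Otimes>\<^sub>M borel)"
  using hahnF by (rule hahn_set_sets)

abbreviation sgnF :: "'s \<times> real \<Rightarrow> real" where
  "sgnF \<equiv> hahn_sign hahnF"

definition varF :: "('s \<times> real) measure" where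
  "varF = total_variation (S \<Otimes>\<^sub>M borel) F"

lemma varF_sets [simp, measurable_cong]: "sets varF = sets (S \<Otimes>\<^sub>M borel)"
  and varF_space: "space varF = space S \<times> UNIV"
  by (simp_all add: varF_def space_pair_measure)

sublocale varF: finite_measure varF
  unfolding varF_def by (rule finite_measure_parts[OF F])

lemma sgnF_measurable [measurable]: "sgnF \<in> borel_measurable (S \<Otimes>\<^sub>M borel)"
  by simp

lemma sgnF_square: "sgnF z * sgnF z = 1" and abs_sgnF: "\<bar>sgnF z\<bar> = 1"
  by (auto simp: hahn_sign_def)

lemma varF_integrable_bounded:
  fixes h :: "_ \<Rightarrow> 'c :: {banach, second_countable_topology}"
  assumes "h \<in> borel_measurable (S \<Otimes>\<^sub>M borel)" "\<And>z. z \<in> space S \<times> UNIV \<Longrightarrow> norm (h z) \<le> c"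
  shows "integrable varF h"
  using assms by (intro varF.integrable_const_bound[where B=c]) (auto simp: varF_space)

lemma F_polar: "A \<in> sets (S \<Otimes>\<^sub>M borel) \<Longrightarrow> F A = (\<integral>z. sgnF z * indicator A z \<partial>varF)"
  unfolding varF_def by (rule signed_measure_polar[OF F hahnF])

lemma FA_extended: "A \<in> sets S \<Longrightarrow> extended_to_signed_measure (FA A)"
  using bimeasure by (simp add: signed_bimeasure_def)

lemma levy_integral_FA:
  fixes g :: "real \<Rightarrow> 'c :: {banach, second_countable_topology}"
  assumes A[measurable]: "A \<in> sets S" and g: "g \<in> borel_measurable borel" and bnd: "\<And>x. norm (g x) \<le> c"
  shows "levy_integral (FA A) g = (\<integral>z. (indicator A (fst z) * sgnF z) *\<^sub>R g (snd z) \<partial>varF)"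
  unfolding levy_integral_extended[OF FA_extended[OF A]]
proof (rule signed_integral_image_density[OF _ _ _ _ g bnd])
  show "signed_measure borel (FA A)"
    using FA_extended[OF A] by (simp add: extended_to_signed_measure_def)
  show "integrable varF (\<lambda>z. indicator A (fst z) * sgnF z)"
    by (rule varF_integrable_bounded[where c=1]) (auto simp: indicator_def abs_sgnF)
  show "snd \<in> measurable varF borel" by measurable
  fix B :: "real set" assume B: "B \<in> sets borel"
  have "FA A B = (\<integral>z. sgnF z * indicator (A \<times> B) z \<partial>varF)"
    using B by (simp add: F_rect[OF A, symmetric] F_polar)
  also have "\<dots> = (\<integral>z. indicator A (fst z) * sgnF z * indicator B (snd z) \<partial>varF)"
    by (intro Bochner_Integration.integral_cong) (auto simp: indicator_def)
  finally show "FA A B = \<dots>" .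
qed

lemma rho_extended: "s \<in> space S \<Longrightarrow> extended_to_signed_measure (\<rho> s)"
  using disint by (simp add: disintegration_def)

lemma disintegrate:
  fixes h :: "'s \<times> real \<Rightarrow> real"
  assumes h: "h \<in> borel_measurable (S \<Otimes>\<^sub>M borel)" and bnd: "\<And>z. z \<in> space S \<times> UNIV \<Longrightarrow> \<bar>h z\<bar> \<le> c"
  shows "integrable lam (\<lambda>s. levy_integral (\<rho> s) (\<lambda>x. h (s, x)))"
    and "(\<integral>z. sgnF z * h z \<partial>varF) = (\<integral>s. levy_integral (\<rho> s) (\<lambda>x. h (s, x)) \<partial>lam)"
proof -
  have int: "integrable (total_variation (S \<Otimes>\<^sub>M borel) F) h"
    using varF_integrable_bounded[OF h, of c] bnd by (simp add: varF_def)
  then show "integrable lam (\<lambda>s. levy_integral (\<rho> s) (\<lambda>x. h (s, x)))"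
    using disint unfolding disintegration_def by blast
  have "signed_integral (S \<Otimes>\<^sub>M borel) F h = (\<integral>z. sgnF z * h z \<partial>varF)"
    using signed_integral_polar[OF F hahnF h, of c] bnd by (simp add: varF_def space_pair_measure)
  then show "(\<integral>z. sgnF z * h z \<partial>varF) = (\<integral>s. levy_integral (\<rho> s) (\<lambda>x. h (s, x)) \<partial>lam)"
    using disint int unfolding disintegration_def by metis
qed

text \<open>
  The iterated integrals over all \<open>A \<in> sets S\<close> determine the inner integral \<open>\<lambda>\<close>-almost everywhere.
\<close>

lemma disintegrate_indicator:
  fixes h :: "'s \<times> real \<Rightarrow> real"
  assumes h[measurable]: "h \<in> borel_measurable (S \<Otimes>\<^sub>M borel)"
    and bnd: "\<And>z. z \<in> space S \<times> UNIV \<Longrightarrow> \<bar>h z\<bar> \<le> c" and A[measurable]: "A \<in> sets S"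
  shows "(\<integral>s. indicator A s * levy_integral (\<rho> s) (\<lambda>x. h (s, x)) \<partial>lam)
    = (\<integral>z. sgnF z * (indicator A (fst z) * h z) \<partial>varF)"
proof -
  have "\<bar>indicator A (fst z) * h z\<bar> \<le> c" if "z \<in> space S \<times> UNIV" for z
    using bnd[OF that] by (auto simp: indicator_def)
  from disintegrate(2)[OF _ this]
  have "(\<integral>z. sgnF z * (indicator A (fst z) * h z) \<partial>varF)
      = (\<integral>s. levy_integral (\<rho> s) (\<lambda>x. indicator A s * h (s, x)) \<partial>lam)"
    by simp
  then show ?thesis by (simp add: levy_integral_mult)
qed

text \<open>
  Absolute continuity of \<open>|F|(\<cdot> \<times> \<real>)\<close> with respect to \<open>\<lambda>\<close>: disintegrating the sign of \<open>F\<close> over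
  \<open>N \<times> \<real>\<close> gives the mass of this set under \<open>|F|\<close>.
\<close>

lemma AE_lam_imp_AE_varF:
  assumes "AE s in lam. R s"
  shows "AE z in varF. R (fst z)"
proof -
  obtain N where N: "{s \<in> space lam. \<not> R s} \<subseteq> N" "emeasure lam N = 0" "N \<in> sets lam"
    using AE_E[OF assms] by blast
  have [measurable]: "N \<in> sets S" using N(3) by simp
  have "measure varF (N \<times> UNIV) = (\<integral>z. indicator (N \<times> UNIV) z \<partial>varF)"
    by simp
  also have "\<dots> = (\<integral>z. sgnF z * (indicator N (fst z) * sgnF z) \<partial>varF)"
    by (intro Bochner_Integration.integral_cong) (auto simp: indicator_def sgnF_square)
  also have "\<dots> = (\<integral>s. indicator N s * levy_integral (\<rho> s) (\<lambda>x. sgnF (s, x)) \<partial>lam)"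
    by (rule disintegrate_indicator[where c=1, symmetric]) (auto simp: abs_sgnF)
  also have "\<dots> = 0"
  proof (rule integral_eq_zero_AE)
    have "AE s in lam. s \<notin> N" using N(2,3) by (intro AE_not_in) (simp add: null_sets_def)
    then show "AE s in lam. indicator N s * levy_integral (\<rho> s) (\<lambda>x. sgnF (s, x)) = 0"
      by eventually_elim simp
  qed
  finally have "N \<times> UNIV \<in> null_sets varF" by (simp add: null_sets_def varF.emeasure_eq_measure)
  then show ?thesis by (rule AE_I') (use N(1) in \<open>auto simp: varF_space\<close>)
qed

text \<open>
  For each finite union \<open>G\<close> of basic sets, \<open>s \<mapsto> \<rho>(s, G \<inter> hahnF\<^sub>s)\<close> has integral
  \<open>F((A \<times> G) \<inter> hahnF) \<ge> 0\<close> over every \<open>A\<close>, hence is nonnegative almost everywhere; similarly on the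
  complement.  There are only countably many such \<open>G\<close>, and they suffice by \<open>hahn_set_from_basis\<close>.
\<close>

lemma AE_hahn_sections: "AE s in lam. hahn_set borel (\<rho> s) {x. (s, x) \<in> hahnF}"
proof -
  obtain \<B> :: "real set set" where \<B>: "countable \<B>" "topological_basis \<B>"
    using ex_countable_basis by blast
  let ?\<F> = "{\<G>. finite \<G> \<and> \<G> \<subseteq> \<B>}"
  have slice: "{x. (s, x) \<in> hahnF} \<in> sets borel" for s
    using sets_Pair1[OF hahnF_sets, of s] by (simp add: vimage_def)
  have "AE s in lam. \<forall>\<G>\<in>?\<F>. 0 \<le> \<rho> s (\<Union>\<G> \<inter> {x. (s, x) \<in> hahnF}) \<and>
      \<rho> s (\<Union>\<G> \<inter> - {x. (s, x) \<in> hahnF}) \<le> 0"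
  proof (rule AE_ball_countable')
    show "countable ?\<F>" using \<B>(1) by (rule countable_Collect_finite_subset)
    fix \<G> assume \<G>: "\<G> \<in> ?\<F>"
    then have "open X" if "X \<in> \<G>" for X using that \<B>(2) topological_basis_open by blast
    then have G[measurable]: "\<Union>\<G> \<in> sets borel" by (intro borel_open open_Union) auto
    \<comment> \<open>used with c = 1 on the Hahn set and with c = -1 on its complement\<close>
    have main: "AE s in lam. 0 \<le> c * \<rho> s (\<Union>\<G> \<inter> {x. (s, x) \<in> Q})"
      if Q[measurable]: "Q \<in> sets (S \<Otimes>\<^sub>M borel)"
        and pos: "\<And>B. B \<in> sets (S \<Otimes>\<^sub>M borel) \<Longrightarrow> 0 \<le> c * F (B \<inter> Q)" for Q c
    proof -
      let ?h = "\<lambda>z. c * indicator ((space S \<times> \<Union>\<G>) \<inter> Q) z"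
      have h[measurable]: "?h \<in> borel_measurable (S \<Otimes>\<^sub>M borel)" by measurable
      have bnd: "\<bar>?h z\<bar> \<le> \<bar>c\<bar>" for z by (auto simp: indicator_def)
      have eq: "levy_integral (\<rho> s) (\<lambda>x. ?h (s, x)) = c * \<rho> s (\<Union>\<G> \<inter> {x. (s, x) \<in> Q})"
        if s: "s \<in> space S" for s
      proof -
        have B: "\<Union>\<G> \<inter> {x. (s, x) \<in> Q} \<in> sets borel"
          using sets_Pair1[OF Q, of s] G by (simp add: vimage_def)
        have "(\<lambda>x. ?h (s, x)) = (\<lambda>x. c * indicator (\<Union>\<G> \<inter> {x. (s, x) \<in> Q}) x)"
          using s by (auto simp: indicator_def)
        then show ?thesis
          using levy_integral_indicator[OF rho_extended[OF s] B] by (simp add: levy_integral_mult)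
      qed
      have "AE s in lam. 0 \<le> levy_integral (\<rho> s) (\<lambda>x. ?h (s, x))"
      proof (rule AE_nonneg_of_set_integrals)
        show "integrable lam (\<lambda>s. levy_integral (\<rho> s) (\<lambda>x. ?h (s, x)))"
          by (rule disintegrate[OF h bnd])
        fix A assume "A \<in> sets lam"
        then have A[measurable]: "A \<in> sets S" by simp
        have "(\<integral>s. indicator A s * levy_integral (\<rho> s) (\<lambda>x. ?h (s, x)) \<partial>lam)
            = (\<integral>z. sgnF z * (indicator A (fst z) * ?h z) \<partial>varF)"
          by (rule disintegrate_indicator[OF h bnd A])
        also have "\<dots> = (\<integral>z. c * (sgnF z * indicator ((A \<times> \<Union>\<G>) \<inter> Q) z) \<partial>varF)"
          using sets.sets_into_space[OF A]
          by (intro Bochner_Integration.integral_cong) (auto simp: indicator_def)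
        also have "\<dots> = c * F ((A \<times> \<Union>\<G>) \<inter> Q)" by (simp add: F_polar)
        finally show "0 \<le> (\<integral>s. indicator A s * levy_integral (\<rho> s) (\<lambda>x. ?h (s, x)) \<partial>lam)"
          using pos[of "A \<times> \<Union>\<G>"] by simp
      qed
      then show ?thesis
        using AE_space by eventually_elim (simp only: eq lam_space)
    qed
    have "AE s in lam. 0 \<le> 1 * \<rho> s (\<Union>\<G> \<inter> {x. (s, x) \<in> hahnF})"
      using hahn_set_signs(1)[OF hahnF] by (intro main) auto
    moreover have "AE s in lam. 0 \<le> (-1) * \<rho> s (\<Union>\<G> \<inter> {x. (s, x) \<in> space (S \<Otimes>\<^sub>M borel) - hahnF})"
    proof (intro main)
      fix B assume B: "B \<in> sets (S \<Otimes>\<^sub>M (borel :: real measure))"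
      have "B \<inter> (space (S \<Otimes>\<^sub>M borel) - hahnF) = B - hahnF" using sets.sets_into_space[OF B] by auto
      then show "0 \<le> -1 * F (B \<inter> (space (S \<Otimes>\<^sub>M borel) - hahnF))"
        using hahn_set_signs(2)[OF hahnF B] by simp
    qed auto
    ultimately show "AE s in lam. 0 \<le> \<rho> s (\<Union>\<G> \<inter> {x. (s, x) \<in> hahnF}) \<and>
      \<rho> s (\<Union>\<G> \<inter> - {x. (s, x) \<in> hahnF}) \<le> 0"
      using AE_space
    proof eventually_elim
      case (elim s)
      then have "{x. (s, x) \<in> space (S \<Otimes>\<^sub>M borel) - hahnF} = - {x. (s, x) \<in> hahnF}"
        by (auto simp: space_pair_measure)
      then show ?case using elim by simp
    qed
  qed
  then show ?thesis
    using AE_space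
  proof eventually_elim
    case (elim s)
    then have "signed_measure borel (\<rho> s)"
      using rho_extended[of s] by (simp add: extended_to_signed_measure_def)
    then show ?case
      using elim slice by (intro hahn_set_from_basis[OF _ _ \<B>(2,1)]) auto
  qed
qed

text \<open>
  Condition (iii): the integrand is at most \<open>|\<rho>|(s, \<real>)\<close>, which integrates to \<open>|F|(S \<times> \<real>)\<close>.
\<close>

lemma V0_integral_finite: "(\<integral>\<^sup>+s. V0 \<rho> (f s) s \<partial>lam) < \<infinity>"
proof -
  let ?k = "\<lambda>s. levy_integral (\<rho> s) (\<lambda>x. sgnF (s, x))"
  have int: "integrable lam ?k"
    by (rule disintegrate[where c=1]) (auto simp: abs_sgnF)
  have "(\<integral>\<^sup>+s. V0 \<rho> (f s) s \<partial>lam) \<le> (\<integral>\<^sup>+s. ennreal (?k s) \<partial>lam)"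
  proof (rule nn_integral_mono_AE)
    show "AE s in lam. V0 \<rho> (f s) s \<le> ennreal (?k s)"
      using AE_hahn_sections AE_space
    proof eventually_elim
      case (elim s)
      then have s: "extended_to_signed_measure (\<rho> s)" using rho_extended by simp
      then have sm: "signed_measure borel (\<rho> s)" by (simp add: extended_to_signed_measure_def)
      have "V0 \<rho> (f s) s \<le> (\<integral>\<^sup>+x. 1 \<partial>levy_var (\<rho> s))"
        unfolding V0_def by (intro nn_integral_mono) (auto simp: ennreal_1[symmetric] simp del: ennreal_1 intro!: ennreal_leI)
      also have "\<dots> = emeasure (total_variation borel (\<rho> s)) (space borel)"
        by (simp add: levy_parts_extended[OF s])
      also have "\<dots> = ennreal (signed_integral borel (\<rho> s) (hahn_sign {x. (s, x) \<in> hahnF}))"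
        by (rule emeasure_total_variation_space[OF sm elim(1)])
      also have "\<dots> = ennreal (?k s)"
        unfolding levy_integral_extended[OF s] by (simp add: hahn_sign_def[abs_def])
      finally show ?case .
    qed
  qed
  also have "\<dots> \<le> (\<integral>\<^sup>+s. ennreal (norm (?k s)) \<partial>lam)" by (intro nn_integral_mono ennreal_leI) simp
  also have "\<dots> < \<infinity>" using int by (simp add: integrable_iff_bounded)
  finally show ?thesis .
qed

section \<open>The three conditions\<close>

text \<open>
  The drift density of the representation in which jumps are not compensated by \<open>\<tau>\<close>.
\<close>

definition pure_drift :: "'s \<Rightarrow> real" where
  "pure_drift s = a s - levy_integral (\<rho> s) \<tau>"

lemma a_integrable: "integrable lam a" and \<sigma>2_integrable: "integrable lam \<sigma>2"
  using a \<sigma>2 by (auto simp: is_RN_deriv_def)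

lemma \<nu>0_eq: "A \<in> sets S \<Longrightarrow> \<nu>0 A = (\<integral>s. indicator A s * a s \<partial>lam)"
  and \<nu>1_eq: "A \<in> sets S \<Longrightarrow> measure \<nu>1 A = (\<integral>s. indicator A s * \<sigma>2 s \<partial>lam)"
  using a \<sigma>2 by (auto simp: is_RN_deriv_def set_lebesgue_integral_def)

lemma \<sigma>2_nonneg: "AE s in lam. 0 \<le> \<sigma>2 s"
  by (rule AE_nonneg_of_set_integrals[OF \<sigma>2_integrable]) (auto simp: \<nu>1_eq[symmetric])

lemma tau_integral_integrable: "integrable lam (\<lambda>s. levy_integral (\<rho> s) \<tau>)"
  using disintegrate(1)[of "\<lambda>z. \<tau> (snd z)" 1] by (simp add: abs_tau_le)

lemma pure_drift_integrable: "integrable lam pure_drift"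
  unfolding pure_drift_def[abs_def] using a_integrable tau_integral_integrable by auto

lemma U_eq: "s \<in> space S \<Longrightarrow> U a \<rho> u s = u * pure_drift s + levy_integral (\<rho> s) (\<lambda>x. \<tau> (x * u))"
proof -
  assume s: "s \<in> space S"
  have "levy_integral (\<rho> s) (\<lambda>x. \<tau> (x * u) - u * \<tau> x) =
      levy_integral (\<rho> s) (\<lambda>x. \<tau> (x * u)) - levy_integral (\<rho> s) (\<lambda>x. u * \<tau> x)"
  proof (rule levy_integral_diff[OF rho_extended[OF s]])
    show "\<bar>u * \<tau> x\<bar> \<le> \<bar>u\<bar> * 1" for x unfolding abs_mult by (intro mult_left_mono abs_tau_le) simp
    show "\<bar>\<tau> (x * u)\<bar> \<le> 1" for x by (rule abs_tau_le)
  qed auto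
  then show ?thesis by (simp add: U_def pure_drift_def levy_integral_mult algebra_simps)
qed

context
  fixes f :: "'s \<Rightarrow> real"
  assumes f[measurable]: "f \<in> borel_measurable S"
begin

lemma tau_image_integrable: "integrable lam (\<lambda>s. levy_integral (\<rho> s) (\<lambda>x. \<tau> (x * f s)))"
  and tau_image_integral: "(\<integral>s. levy_integral (\<rho> s) (\<lambda>x. \<tau> (x * f s)) \<partial>lam) =
    (\<integral>z. sgnF z * \<tau> (f (fst z) * snd z) \<partial>varF)"
  using disintegrate[of "\<lambda>z. \<tau> (snd z * f (fst z))" 1] by (simp_all add: abs_tau_le mult.commute)

text \<open>
  Condition (i): \<open>\<tau>\<close> is bounded and \<open>|F|\<close> is finite, so only the drift part of \<open>U\<close> can fail to be
  integrable.
\<close>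

lemma U_integrable_iff:
  "(\<integral>\<^sup>+s. ennreal \<bar>U a \<rho> (f s) s\<bar> \<partial>lam) < \<infinity> \<longleftrightarrow> integrable lam (\<lambda>s. f s * pure_drift s)"
proof -
  let ?w = "\<lambda>s. levy_integral (\<rho> s) (\<lambda>x. \<tau> (x * f s))"
  have [measurable]: "pure_drift \<in> borel_measurable lam" using pure_drift_integrable by auto
  have [measurable]: "?w \<in> borel_measurable lam" using tau_image_integrable by auto
  have "(\<integral>\<^sup>+s. ennreal \<bar>U a \<rho> (f s) s\<bar> \<partial>lam) = (\<integral>\<^sup>+s. ennreal (norm (f s * pure_drift s + ?w s)) \<partial>lam)"
    by (intro nn_integral_cong) (simp add: U_eq)
  moreover have "(\<integral>\<^sup>+s. ennreal (norm (f s * pure_drift s + ?w s)) \<partial>lam) < \<infinity> \<longleftrightarrow> integrable lam (\<lambda>s. f s * pure_drift s + ?w s)"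
    by (simp add: integrable_iff_bounded)
  moreover have "integrable lam (\<lambda>s. f s * pure_drift s + ?w s) \<longleftrightarrow> integrable lam (\<lambda>s. f s * pure_drift s)"
    using tau_image_integrable Bochner_Integration.integrable_diff[of lam "\<lambda>s. f s * pure_drift s + ?w s" ?w] by auto
  ultimately show ?thesis by simp
qed

lemma U_integral:
  assumes "integrable lam (\<lambda>s. f s * pure_drift s)"
  shows "(\<integral>s. U a \<rho> (f s) s \<partial>lam) = (\<integral>s. f s * pure_drift s \<partial>lam) + (\<integral>z. sgnF z * \<tau> (f (fst z) * snd z) \<partial>varF)"
proof -
  have "(\<integral>s. U a \<rho> (f s) s \<partial>lam) = (\<integral>s. f s * pure_drift s + levy_integral (\<rho> s) (\<lambda>x. \<tau> (x * f s)) \<partial>lam)"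
    by (intro Bochner_Integration.integral_cong) (simp_all add: U_eq)
  then show ?thesis using assms tau_image_integrable by (simp add: tau_image_integral)
qed

lemma variance_integrable_iff:
  "(\<integral>\<^sup>+s. ennreal (\<bar>f s\<bar>\<^sup>2 * \<sigma>2 s) \<partial>lam) < \<infinity> \<longleftrightarrow> integrable lam (\<lambda>s. (f s)\<^sup>2 * \<sigma>2 s)"
proof -
  have [measurable]: "\<sigma>2 \<in> borel_measurable lam" using \<sigma>2_integrable by auto
  have "(\<integral>\<^sup>+s. ennreal (\<bar>f s\<bar>\<^sup>2 * \<sigma>2 s) \<partial>lam) = (\<integral>\<^sup>+s. ennreal (norm ((f s)\<^sup>2 * \<sigma>2 s)) \<partial>lam)"
    by (rule nn_integral_cong_AE, rule AE_mp[OF \<sigma>2_nonneg]) (simp add: abs_mult)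
  then show ?thesis by (simp add: integrable_iff_bounded)
qed

text \<open>
  Integrals against \<open>F\<^sub>f\<close>.  Jumps of size \<open>0\<close>, which are removed from \<open>F\<^sub>f\<close>, are harmless for integrands
  that vanish at \<open>0\<close>.
\<close>

lemma levy_integral_image:
  fixes g :: "real \<Rightarrow> 'c :: {banach, second_countable_topology}"
  assumes g: "g \<in> borel_measurable borel" and bnd: "\<And>x. norm (g x) \<le> c" and g0: "g 0 = 0"
  shows "levy_integral (\<lambda>B. F {(s, x) \<in> space S \<times> UNIV. f s * x \<in> B - {0}}) g =
    (\<integral>z. sgnF z *\<^sub>R g (f (fst z) * snd z) \<partial>varF)"
proof -
  let ?\<nu> = "\<lambda>B. F {(s, x) \<in> space S \<times> UNIV. f s * x \<in> B - {0}}"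
  let ?E = "\<lambda>B. {(s, x) \<in> space S \<times> UNIV. f s * x \<in> B - {0}}"
  have E: "?E B \<in> sets (S \<Otimes>\<^sub>M borel)" if [measurable]: "B \<in> sets borel" for B
  proof -
    have "?E B = {z \<in> space (S \<Otimes>\<^sub>M borel). f (fst z) * snd z \<in> B - {0}}"
      by (auto simp: space_pair_measure)
    also have "\<dots> \<in> sets (S \<Otimes>\<^sub>M borel)" by measurable
    finally show ?thesis .
  qed
  have sm: "signed_measure borel ?\<nu>"
    unfolding signed_measure_def
  proof (intro conjI allI impI)
    show "?\<nu> {} = 0" using signed_measure_empty[OF F] by simp
    fix B :: "nat \<Rightarrow> real set" assume B: "range B \<subseteq> sets borel" "disjoint_family B"
    have "(\<lambda>n. F (?E (B n))) sums F (\<Union>n. ?E (B n))"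
      using B by (intro signed_measure_sums[OF F] E) (auto simp: disjoint_family_on_def)
    moreover have "(\<Union>n. ?E (B n)) = ?E (\<Union>n. B n)" by auto
    ultimately show "(\<lambda>n. ?\<nu> (B n)) sums ?\<nu> (\<Union>n. B n)" by simp
  qed
  moreover have "?E {0} = {}" by auto
  ultimately have ext: "extended_to_signed_measure ?\<nu>"
    using signed_measure_empty[OF F] unfolding extended_to_signed_measure_def by metis
  let ?k = "\<lambda>z. sgnF z * indicator (- {0}) (f (fst z) * snd z)"
  have "signed_integral borel ?\<nu> g = (\<integral>z. ?k z *\<^sub>R g (f (fst z) * snd z) \<partial>varF)"
  proof (rule signed_integral_image_density[OF sm _ _ _ g bnd])
    show "integrable varF ?k"
      by (rule varF_integrable_bounded[where c=1]) (auto simp: indicator_def abs_sgnF)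
    show "(\<lambda>z. f (fst z) * snd z) \<in> borel_measurable varF" by measurable
    fix B :: "real set" assume B: "B \<in> sets borel"
    have "?\<nu> B = (\<integral>z. sgnF z * indicator (?E B) z \<partial>varF)" by (rule F_polar[OF E[OF B]])
    also have "\<dots> = (\<integral>z. ?k z * indicator B (f (fst z) * snd z) \<partial>varF)"
      by (intro Bochner_Integration.integral_cong) (auto simp: indicator_def varF_space)
    finally show "?\<nu> B = \<dots>" .
  qed
  also have "\<dots> = (\<integral>z. sgnF z *\<^sub>R g (f (fst z) * snd z) \<partial>varF)"
    using g0 by (intro Bochner_Integration.integral_cong) (auto simp: indicator_def)
  finally show ?thesis unfolding levy_integral_extended[OF ext] .
qed

end

section \<open>Characteristic functions of simple integrals\<close>

lemma integrable_indicator_mult: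
  fixes g :: "'s \<Rightarrow> real"
  assumes "integrable lam g" "A \<in> sets S"
  shows "integrable lam (\<lambda>s. indicator A s * g s)"
  using integrable_mult_indicator[of A lam g] assms by simp

definition jump :: "'s set \<Rightarrow> ('s \<Rightarrow> real) \<Rightarrow> real \<Rightarrow> complex" where
  "jump A f t = (\<integral>z. (indicator A (fst z) * sgnF z) *\<^sub>R (iexp (t * (f (fst z) * snd z)) - 1) \<partial>varF)"

text \<open>
  The exponent of the characteristic function of \<open>\<integral>\<^sub>A f d\<Lambda>\<close> at \<open>t\<close>, in uncompensated form.
\<close>

definition char_exponent :: "'s set \<Rightarrow> ('s \<Rightarrow> real) \<Rightarrow> real \<Rightarrow> complex" where
  "char_exponent A f t = \<i> * of_real (t * (\<integral>s. indicator A s * (f s * pure_drift s) \<partial>lam))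
     - of_real (t\<^sup>2 / 2 * (\<integral>s. indicator A s * ((f s)\<^sup>2 * \<sigma>2 s) \<partial>lam)) + jump A f t"

lemma jump_integrable:
  assumes [measurable]: "A \<in> sets S" "f \<in> borel_measurable S"
  shows "integrable varF (\<lambda>z. (indicator A (fst z) * sgnF z) *\<^sub>R (iexp (t * (f (fst z) * snd z)) - 1))"
proof (rule varF_integrable_bounded[where c=2])
  fix z :: "'s \<times> real"
  show "norm ((indicator A (fst z) * sgnF z) *\<^sub>R (iexp (t * (f (fst z) * snd z)) - 1)) \<le> 2"
    using norm_iexp_minus_1_le[of "t * (f (fst z) * snd z)"]
    by (simp add: abs_mult abs_sgnF indicator_def)
qed measurable

lemma levy_kernel_bound: "norm (exp (\<i> * of_real (t * x)) - 1 - \<i> * of_real (t * \<tau> x)) \<le> 2 + \<bar>t\<bar>"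
proof -
  have "norm (\<i> * complex_of_real (t * \<tau> x)) \<le> \<bar>t\<bar>"
    using mult_left_mono[OF abs_tau_le[of x], of "\<bar>t\<bar>"] by (simp add: norm_mult abs_mult)
  then show ?thesis
    using norm_triangle_ineq4[of "iexp (t * x) - 1" "\<i> * of_real (t * \<tau> x)"]
      norm_iexp_minus_1_le[of "t * x"] by linarith
qed

lemma levy_kernel_measurable:
  "(\<lambda>x. exp (\<i> * of_real (t * x)) - 1 - \<i> * of_real (t * \<tau> x)) \<in> borel_measurable borel"
  by measurable

text \<open>
  The compensator may be split off because \<open>\<tau>\<close> is bounded and \<open>|F|\<close> is finite; its integral is what
  separates \<open>a\<close> from \<open>pure_drift\<close>.
\<close>

lemma split_compensator:
  assumes A[measurable]: "A \<in> sets S" and f[measurable]: "f \<in> borel_measurable S"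
  shows "(\<integral>z. (indicator A (fst z) * sgnF z) *\<^sub>R
      (exp (\<i> * of_real (t * (f (fst z) * snd z))) - 1 - \<i> * of_real (t * \<tau> (f (fst z) * snd z))) \<partial>varF)
    = jump A f t - \<i> * of_real (t * (\<integral>z. sgnF z * (indicator A (fst z) * \<tau> (f (fst z) * snd z)) \<partial>varF))"
proof -
  let ?c = "\<lambda>z. sgnF z * (indicator A (fst z) * \<tau> (f (fst z) * snd z))"
  have c: "integrable varF ?c"
    by (rule varF_integrable_bounded[where c=1]) (auto simp: abs_mult abs_sgnF abs_tau_le indicator_def)
  have c': "integrable varF (\<lambda>z. \<i> * complex_of_real (t * ?c z))"
    using c by (intro integrable_mult_right integrable_of_real)
  have "(\<integral>z. (indicator A (fst z) * sgnF z) *\<^sub>R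
      (exp (\<i> * of_real (t * (f (fst z) * snd z))) - 1 - \<i> * of_real (t * \<tau> (f (fst z) * snd z))) \<partial>varF)
    = (\<integral>z. (indicator A (fst z) * sgnF z) *\<^sub>R (iexp (t * (f (fst z) * snd z)) - 1)
        - \<i> * complex_of_real (t * ?c z) \<partial>varF)"
    by (intro Bochner_Integration.integral_cong refl) (simp add: scaleR_conv_of_real algebra_simps)
  also have "\<dots> = jump A f t - (\<integral>z. \<i> * complex_of_real (t * ?c z) \<partial>varF)"
    unfolding jump_def by (rule Bochner_Integration.integral_diff[OF jump_integrable[OF A f] c'])
  also have "(\<integral>z. \<i> * complex_of_real (t * ?c z) \<partial>varF) = \<i> * (\<integral>z. complex_of_real (t * ?c z) \<partial>varF)"
    by (rule integral_mult_right_zero)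
  also have "(\<integral>z. complex_of_real (t * ?c z) \<partial>varF) = of_real (\<integral>z. t * ?c z \<partial>varF)"
    by (rule integral_complex_of_real)
  also have "(\<integral>z. t * ?c z \<partial>varF) = t * (\<integral>z. ?c z \<partial>varF)" by (rule integral_mult_right_zero)
  finally show ?thesis .
qed

lemma qid_char_eq_exp_char_exponent:
  assumes A[measurable]: "A \<in> sets S"
  shows "qid_char (\<nu>0 A) (measure \<nu>1 A) (FA A) (t * y) = exp (char_exponent A (\<lambda>_. y) t)"
proof -
  let ?c = "\<integral>z. sgnF z * (indicator A (fst z) * \<tau> (snd z)) \<partial>varF"
  have c: "?c = (\<integral>s. indicator A s * levy_integral (\<rho> s) \<tau> \<partial>lam)"
    using disintegrate_indicator[of "\<lambda>z. \<tau> (snd z)" 1 A] by (simp add: abs_tau_le)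
  have "levy_integral (FA A) (\<lambda>x. exp (\<i> * of_real ((t * y) * x)) - 1 - \<i> * of_real ((t * y) * \<tau> x))
      = (\<integral>z. (indicator A (fst z) * sgnF z) *\<^sub>R
          (exp (\<i> * of_real ((t * y) * snd z)) - 1 - \<i> * of_real ((t * y) * \<tau> (snd z))) \<partial>varF)"
    by (rule levy_integral_FA[OF A levy_kernel_measurable levy_kernel_bound])
  also have "\<dots> = jump A (\<lambda>_. 1) (t * y) - \<i> * of_real ((t * y) * ?c)"
    using split_compensator[OF A, of "\<lambda>_. 1" "t * y"] by simp
  also have "jump A (\<lambda>_. 1) (t * y) = jump A (\<lambda>_. y) t"
    by (simp add: jump_def mult.assoc)
  finally have levy: "levy_integral (FA A) (\<lambda>x. exp (\<i> * of_real ((t * y) * x)) - 1 - \<i> * of_real ((t * y) * \<tau> x))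
    = jump A (\<lambda>_. y) t - \<i> * of_real ((t * y) * ?c)" .
  have "(\<integral>s. indicator A s * (y * pure_drift s) \<partial>lam)
      = (\<integral>s. y * (indicator A s * a s - indicator A s * levy_integral (\<rho> s) \<tau>) \<partial>lam)"
    by (intro Bochner_Integration.integral_cong refl) (simp add: pure_drift_def algebra_simps)
  also have "\<dots> = y * (\<nu>0 A - ?c)"
    unfolding c \<nu>0_eq[OF A]
    by (simp add: integrable_indicator_mult[OF a_integrable A] integrable_indicator_mult[OF tau_integral_integrable A])
  finally have drift: "(\<integral>s. indicator A s * (y * pure_drift s) \<partial>lam) = y * (\<nu>0 A - ?c)" .
  have "(\<integral>s. indicator A s * (y\<^sup>2 * \<sigma>2 s) \<partial>lam) = (\<integral>s. y\<^sup>2 * (indicator A s * \<sigma>2 s) \<partial>lam)"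
    by (intro Bochner_Integration.integral_cong refl) simp
  then have var: "(\<integral>s. indicator A s * (y\<^sup>2 * \<sigma>2 s) \<partial>lam) = y\<^sup>2 * measure \<nu>1 A"
    by (simp add: \<nu>1_eq[OF A])
  show ?thesis
    unfolding qid_char_def char_exponent_def levy drift var
    by (rule arg_cong[where f=exp]) (simp add: algebra_simps power_mult_distrib)
qed

lemma integral_split_simple:
  fixes H :: "real \<Rightarrow> 'm \<Rightarrow> 'c :: {banach, second_countable_topology}"
  assumes f: "simple_function S f" and \<pi>: "\<And>z. z \<in> space M \<Longrightarrow> \<pi> z \<in> space S"
    and H: "\<And>y. y \<in> f ` space S \<Longrightarrow> integrable M (\<lambda>z. indicator (A \<inter> (f -` {y} \<inter> space S)) (\<pi> z) *\<^sub>R H y z)"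
  shows "(\<integral>z. indicator A (\<pi> z) *\<^sub>R H (f (\<pi> z)) z \<partial>M) =
    (\<Sum>y\<in>f ` space S. \<integral>z. indicator (A \<inter> (f -` {y} \<inter> space S)) (\<pi> z) *\<^sub>R H y z \<partial>M)"
proof -
  have "(\<integral>z. indicator A (\<pi> z) *\<^sub>R H (f (\<pi> z)) z \<partial>M)
      = (\<integral>z. (\<Sum>y\<in>f ` space S. indicator (A \<inter> (f -` {y} \<inter> space S)) (\<pi> z) *\<^sub>R H y z) \<partial>M)"
  proof (intro Bochner_Integration.integral_cong refl)
    fix z assume "z \<in> space M"
    then have z: "\<pi> z \<in> space S" by (rule \<pi>)
    have "(\<Sum>y\<in>f ` space S. indicator (A \<inter> (f -` {y} \<inter> space S)) (\<pi> z) *\<^sub>R H y z)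
        = (\<Sum>y\<in>f ` space S. if y = f (\<pi> z) then indicator A (\<pi> z) *\<^sub>R H y z else 0)"
      using z by (intro sum.cong) (auto simp: indicator_def)
    then show "indicator A (\<pi> z) *\<^sub>R H (f (\<pi> z)) z
        = (\<Sum>y\<in>f ` space S. indicator (A \<inter> (f -` {y} \<inter> space S)) (\<pi> z) *\<^sub>R H y z)"
      using z f by (simp add: simple_function_def)
  qed
  also have "\<dots> = (\<Sum>y\<in>f ` space S. \<integral>z. indicator (A \<inter> (f -` {y} \<inter> space S)) (\<pi> z) *\<^sub>R H y z \<partial>M)"
    using H by (rule Bochner_Integration.integral_sum)
  finally show ?thesis .
qed

lemma char_exponent_simple:
  assumes f: "simple_function S f" and A[measurable]: "A \<in> sets S"
  shows "char_exponent A f t = (\<Sum>y\<in>f ` space S. char_exponent (A \<inter> (f -` {y} \<inter> space S)) (\<lambda>_. y) t)"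
proof -
  let ?E = "\<lambda>y. A \<inter> (f -` {y} \<inter> space S)"
  have [measurable]: "f \<in> borel_measurable S" using f by (rule borel_measurable_simple_function)
  have E: "?E y \<in> sets S" for y by measurable
  have drift: "(\<integral>s. indicator A s * (f s * pure_drift s) \<partial>lam) = (\<Sum>y\<in>f ` space S. \<integral>s. indicator (?E y) s * (y * pure_drift s) \<partial>lam)"
    by (rule integral_split_simple[OF f, where M=lam and \<pi>="\<lambda>s. s" and H="\<lambda>y s. y * pure_drift s", unfolded real_scaleR_def])
      (auto intro!: integrable_indicator_mult integrable_mult_right pure_drift_integrable E)
  have var: "(\<integral>s. indicator A s * ((f s)\<^sup>2 * \<sigma>2 s) \<partial>lam) = (\<Sum>y\<in>f ` space S. \<integral>s. indicator (?E y) s * (y\<^sup>2 * \<sigma>2 s) \<partial>lam)"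
    by (rule integral_split_simple[OF f, where M=lam and \<pi>="\<lambda>s. s" and H="\<lambda>y s. y\<^sup>2 * \<sigma>2 s", unfolded real_scaleR_def])
      (auto intro!: integrable_indicator_mult integrable_mult_right \<sigma>2_integrable E)
  have jump: "jump A f t = (\<Sum>y\<in>f ` space S. jump (?E y) (\<lambda>_. y) t)"
    unfolding jump_def scaleR_scaleR[symmetric]
    by (rule integral_split_simple[OF f, where M=varF and \<pi>=fst and H="\<lambda>y z. sgnF z *\<^sub>R (iexp (t * (y * snd z)) - 1)"])
      (use jump_integrable[OF E, of "\<lambda>_. _"] in \<open>auto simp: varF_space\<close>)
  show ?thesis
    unfolding char_exponent_def drift var jump
    by (simp add: sum.distrib sum_subtractf sum_distrib_left)
qed

lemma simple_stoch_integral_measurable [measurable]: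
  assumes f: "simple_function S f" and A: "A \<in> sets S"
  shows "simple_stoch_integral S \<Lambda> A f \<in> borel_measurable P"
proof -
  have "f \<in> borel_measurable S" using f by (rule borel_measurable_simple_function)
  then have "A \<inter> (f -` {y} \<inter> space S) \<in> sets S" for y using A by (intro sets.Int measurable_sets[of f S borel]) auto
  then have "\<Lambda> (A \<inter> (f -` {y} \<inter> space S)) \<in> borel_measurable P" for y
    using L by (simp add: qid_random_measure_def)
  then show ?thesis
    unfolding simple_stoch_integral_def[abs_def] by (intro borel_measurable_sum borel_measurable_times) auto
qed

text \<open>
  The summands of a simple integral are independent because the level sets are disjoint.
\<close>

lemma char_simple_stoch_integral:
  assumes f: "simple_function S f" and A[measurable]: "A \<in> sets S"
  shows "(\<integral>\<omega>. iexp (t * simple_stoch_integral S \<Lambda> A f \<omega>) \<partial>P) = exp (char_exponent A f t)"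
proof -
  let ?E = "\<lambda>y. A \<inter> (f -` {y} \<inter> space S)"
  have fm[measurable]: "f \<in> borel_measurable S" using f by (rule borel_measurable_simple_function)
  have E: "?E y \<in> sets S" for y by measurable
  have "finite (f ` space S)" using f by (simp add: simple_function_def)
  then obtain n :: nat and e where e: "f ` space S = e ` {i. i < n}" "inj_on e {i. i < n}"
    using finite_imp_nat_seg_image_inj_on[of "f ` space S"] by auto
  \<comment> \<open>independence is available for sequences of sets, hence the padding by empty sets\<close>
  define G where "G i = (if i < n then ?E (e i) else {})" for i
  have "range G \<subseteq> sets S" using E by (auto simp: G_def)
  moreover have "disjoint_family G"
    using e(2) by (auto simp: G_def disjoint_family_on_def inj_on_def)
  ultimately have "P.indep_vars (\<lambda>_. borel) (\<lambda>i. \<Lambda> (G i)) UNIV"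
    using L unfolding qid_random_measure_def by blast
  then have "P.indep_vars (\<lambda>_. borel) (\<lambda>i. \<Lambda> (G i)) {i. i < n}"
    by (rule P.indep_vars_subset) simp
  then have indep: "P.indep_vars (\<lambda>_. borel) (\<lambda>i \<omega>. e i * \<Lambda> (G i) \<omega>) {i. i < n}"
    by (rule P.indep_vars_compose2[where Y="\<lambda>i x. e i * x"]) simp
  have \<Lambda>G[measurable]: "\<Lambda> (G i) \<in> borel_measurable P" for i
    using L E by (simp add: qid_random_measure_def G_def)
  have eq: "simple_stoch_integral S \<Lambda> A f = (\<lambda>\<omega>. \<Sum>i\<in>{i. i < n}. e i * \<Lambda> (G i) \<omega>)"
    unfolding simple_stoch_integral_def[abs_def] e(1) sum.reindex[OF e(2)]
    by (intro ext sum.cong) (auto simp: G_def)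
  have meas[measurable]: "simple_stoch_integral S \<Lambda> A f \<in> borel_measurable P"
    using f A by (rule simple_stoch_integral_measurable)
  have one: "char (distr P borel (\<lambda>\<omega>. e i * \<Lambda> (G i) \<omega>)) t = exp (char_exponent (?E (e i)) (\<lambda>_. e i) t)"
    if i: "i < n" for i
  proof -
    have "char (distr P borel (\<lambda>\<omega>. e i * \<Lambda> (G i) \<omega>)) t = (\<integral>\<omega>. iexp (t * (e i * \<Lambda> (G i) \<omega>)) \<partial>P)"
      unfolding char_def by (subst integral_distr) auto
    also have "\<dots> = (\<integral>\<omega>. iexp ((t * e i) * \<Lambda> (G i) \<omega>) \<partial>P)" by (simp add: mult.assoc)
    also have "\<dots> = char (distr P borel (\<Lambda> (G i))) (t * e i)"
      unfolding char_def by (subst integral_distr) auto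
    also have "\<dots> = qid_char (\<nu>0 (?E (e i))) (measure \<nu>1 (?E (e i))) (FA (?E (e i))) (t * e i)"
      using triplet[OF E, of "e i"] i unfolding has_triplet_def by (simp add: G_def)
    also have "\<dots> = exp (char_exponent (?E (e i)) (\<lambda>_. e i) t)" by (rule qid_char_eq_exp_char_exponent[OF E])
    finally show ?thesis .
  qed
  have "(\<integral>\<omega>. iexp (t * simple_stoch_integral S \<Lambda> A f \<omega>) \<partial>P) = char (distr P borel (simple_stoch_integral S \<Lambda> A f)) t"
    unfolding char_def by (subst integral_distr) auto
  also have "\<dots> = (\<Prod>i\<in>{i. i < n}. char (distr P borel (\<lambda>\<omega>. e i * \<Lambda> (G i) \<omega>)) t)"
    unfolding eq by (rule P.char_distr_sum[OF indep])
  also have "\<dots> = (\<Prod>i\<in>{i. i < n}. exp (char_exponent (?E (e i)) (\<lambda>_. e i) t))"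
    by (intro prod.cong refl one) simp
  also have "\<dots> = exp (\<Sum>i\<in>{i. i < n}. char_exponent (?E (e i)) (\<lambda>_. e i) t)"
    by (simp add: exp_sum)
  also have "(\<Sum>i\<in>{i. i < n}. char_exponent (?E (e i)) (\<lambda>_. e i) t) = char_exponent A f t"
    unfolding char_exponent_simple[OF f A] e(1) sum.reindex[OF e(2)] by simp
  finally show ?thesis .
qed

text \<open>
  Both functions are written over the partition into the level sets of \<open>s \<mapsto> (f s, g s)\<close>.
\<close>

lemma simple_stoch_integral_diff:
  assumes f: "simple_function S f" and g: "simple_function S g" and A: "A \<in> sets S"
  shows "AE \<omega> in P. simple_stoch_integral S \<Lambda> A f \<omega> - simple_stoch_integral S \<Lambda> A g \<omega>
    = simple_stoch_integral S \<Lambda> A (\<lambda>s. f s - g s) \<omega>"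
proof -
  have [measurable]: "f \<in> borel_measurable S" "g \<in> borel_measurable S"
    using f g by (auto intro: borel_measurable_simple_function)
  let ?V = "(\<lambda>s. (f s, g s)) ` space S"
  have "?V \<subseteq> f ` space S \<times> g ` space S" by auto
  moreover have "finite (f ` space S \<times> g ` space S)" using f g by (simp add: simple_function_def)
  ultimately have "finite ?V" by (rule finite_subset)
  then obtain n :: nat and e where e: "?V = e ` {i. i < n}" "inj_on e {i. i < n}"
    using finite_imp_nat_seg_image_inj_on[of ?V] by auto
  define E where "E j = {s \<in> space S. f s = fst (e j) \<and> g s = snd (e j)}" for j
  have E: "E j \<in> sets S" for j unfolding E_def by measurable
  have mem: "s \<in> E j \<longleftrightarrow> s \<in> space S \<and> (f s, g s) = e j" for s j
    by (auto simp: E_def prod_eq_iff)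
  have disj: "disjoint_family_on E {..<n}"
    using e(2) unfolding disjoint_family_on_def inj_on_def by (auto simp: mem)
  have rep: "\<phi> (f s, g s) = (\<Sum>j<n. \<phi> (e j) * indicator (E j) s)" if s: "s \<in> space S"
    for s and \<phi> :: "real \<times> real \<Rightarrow> real"
  proof -
    have "(f s, g s) \<in> e ` {i. i < n}" using s e(1) by auto
    then obtain i where i: "i < n" "(f s, g s) = e i" by auto
    have "(\<Sum>j<n. \<phi> (e j) * indicator (E j) s) = (\<Sum>j<n. if j = i then \<phi> (e i) else 0)"
    proof (intro sum.cong refl)
      fix j assume "j \<in> {..<n}"
      then have "e i = e j \<longleftrightarrow> j = i" using inj_on_eq_iff[OF e(2), of i j] i by auto
      then show "\<phi> (e j) * indicator (E j) s = (if j = i then \<phi> (e i) else 0)"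
        using s i by (auto simp: indicator_def mem)
    qed
    then show ?thesis using i by simp
  qed
  note int = simple_stoch_integral_representation[OF L A E disj]
  have "AE \<omega> in P. simple_stoch_integral S \<Lambda> A f \<omega> = (\<Sum>j<n. fst (e j) * \<Lambda> (A \<inter> E j) \<omega>)"
    by (rule int) (use rep[of _ fst] in simp)
  moreover have "AE \<omega> in P. simple_stoch_integral S \<Lambda> A g \<omega> = (\<Sum>j<n. snd (e j) * \<Lambda> (A \<inter> E j) \<omega>)"
    by (rule int) (use rep[of _ snd] in simp)
  moreover have "AE \<omega> in P. simple_stoch_integral S \<Lambda> A (\<lambda>s. f s - g s) \<omega>
      = (\<Sum>j<n. (fst (e j) - snd (e j)) * \<Lambda> (A \<inter> E j) \<omega>)"
    by (rule int) (use rep[of _ "\<lambda>p. fst p - snd p"] in simp)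
  ultimately show ?thesis
    by eventually_elim (simp add: sum_subtractf left_diff_distrib)
qed

lemma char_simple_stoch_integral_diff:
  assumes f: "simple_function S f" and g: "simple_function S g" and A: "A \<in> sets S"
  shows "(\<integral>\<omega>. iexp (t * (simple_stoch_integral S \<Lambda> A f \<omega> - simple_stoch_integral S \<Lambda> A g \<omega>)) \<partial>P)
    = exp (char_exponent A (\<lambda>s. f s - g s) t)"
proof -
  have fg: "simple_function S (\<lambda>s. f s - g s)" using f g by (rule simple_function_diff)
  note [measurable] = simple_stoch_integral_measurable[OF f A] simple_stoch_integral_measurable[OF g A]
    simple_stoch_integral_measurable[OF fg A]
  have "(\<integral>\<omega>. iexp (t * (simple_stoch_integral S \<Lambda> A f \<omega> - simple_stoch_integral S \<Lambda> A g \<omega>)) \<partial>P)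
    = (\<integral>\<omega>. iexp (t * simple_stoch_integral S \<Lambda> A (\<lambda>s. f s - g s) \<omega>) \<partial>P)"
    by (rule integral_cong_AE) (measurable, measurable, rule AE_mp[OF simple_stoch_integral_diff[OF f g A]], simp)
  then show ?thesis unfolding char_simple_stoch_integral[OF fg A] .
qed

text \<open>
  The integrand is bounded by 2 and \<open>|F|\<close> is finite, which is the domination for any sequence \<open>fs\<close>.
\<close>

lemma jump_tendsto:
  assumes A[measurable]: "A \<in> sets S"
    and [measurable]: "\<And>n. fs n \<in> borel_measurable S" "f \<in> borel_measurable S"
    and lim: "AE s in lam. (\<lambda>n. fs n s) \<longlonglongrightarrow> f s"
  shows "(\<lambda>n. jump A (fs n) t) \<longlonglongrightarrow> jump A f t"
  unfolding jump_def
proof (rule integral_dominated_convergence[where w="\<lambda>_. 2"])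
  show "AE z in varF. (\<lambda>n. (indicator A (fst z) * sgnF z) *\<^sub>R (iexp (t * (fs n (fst z) * snd z)) - 1))
      \<longlonglongrightarrow> (indicator A (fst z) * sgnF z) *\<^sub>R (iexp (t * (f (fst z) * snd z)) - 1)"
    using AE_lam_imp_AE_varF[OF lim]
    by eventually_elim (intro tendsto_intros)
  show "AE z in varF. norm ((indicator A (fst z) * sgnF z) *\<^sub>R (iexp (t * (fs n (fst z) * snd z)) - 1)) \<le> 2" for n
  proof (rule AE_I2)
    fix z
    show "norm ((indicator A (fst z) * sgnF z) *\<^sub>R (iexp (t * (fs n (fst z) * snd z)) - 1)) \<le> 2"
      using norm_iexp_minus_1_le[of "t * (fs n (fst z) * snd z)"]
      by (simp add: abs_mult abs_sgnF indicator_def)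
  qed
qed measurable

lemma jump_zero: "jump A (\<lambda>_. 0) t = 0"
  by (simp add: jump_def)

section \<open>Integrability and the limit of the characteristic functions\<close>

lemma simple_mult_integrable:
  fixes g :: "'s \<Rightarrow> real"
  assumes u: "simple_function S u" and g: "integrable lam g"
  shows "integrable lam (\<lambda>s. u s * g s)"
proof -
  have [measurable]: "u \<in> borel_measurable S" using u by (rule borel_measurable_simple_function)
  have [measurable]: "g \<in> borel_measurable lam" using g by auto
  have "bounded (u ` space S)" using u by (intro finite_imp_bounded) (simp add: simple_function_def)
  then obtain c where c: "\<And>s. s \<in> space S \<Longrightarrow> \<bar>u s\<bar> \<le> c" unfolding bounded_iff by auto
  show ?thesis
  proof (rule Bochner_Integration.integrable_bound)
    show "integrable lam (\<lambda>s. c * g s)" using g by simp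
    show "AE s in lam. norm (u s * g s) \<le> norm (c * g s)"
    proof (rule AE_I2)
      fix s assume "s \<in> space lam"
      then have "\<bar>u s\<bar> \<le> \<bar>c\<bar>" using c[of s] by simp
      then show "norm (u s * g s) \<le> norm (c * g s)" by (simp add: abs_mult mult_right_mono)
    qed
  qed measurable
qed

lemma AE_diff_tendsto_0:
  assumes "AE s in lam. (\<lambda>n. fs n s) \<longlonglongrightarrow> f s" "\<And>N. N \<le> p N" "\<And>N. N \<le> q N"
  shows "AE s in lam. (\<lambda>N. fs (p N) s - fs (q N) s) \<longlonglongrightarrow> (0 :: real)"
  using assms(1)
proof eventually_elim
  case (elim s)
  have "(\<lambda>N. fs (p N) s - fs (q N) s) \<longlonglongrightarrow> f s - f s"
    by (intro tendsto_diff filterlim_compose[OF elim] filterlim_ge_sequentially assms)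
  then show ?case by simp
qed

text \<open>
  Divide the characteristic function of \<open>\<integral>\<^sub>A (fs (p N) - fs (q N)) d\<Lambda>\<close>, which tends to 1, by its jump
  factor, which tends to 1 as well.  The remaining Gaussian characteristic function tends to 1; its modulus
  controls the variance and, after this, its phase controls the mean.
\<close>

lemma defining_sequence_cauchy:
  assumes ds: "defining_sequence P S \<Lambda> lam f fs" and A[measurable]: "A \<in> sets S"
    and pq: "\<And>N. N \<le> p N" "\<And>N. N \<le> q N"
  shows "(\<lambda>N. \<integral>s. indicator A s * ((fs (p N) s - fs (q N) s) * pure_drift s) \<partial>lam) \<longlonglongrightarrow> 0" (is "?m \<longlonglongrightarrow> 0")
    and "(\<lambda>N. \<integral>s. indicator A s * ((fs (p N) s - fs (q N) s)\<^sup>2 * \<sigma>2 s) \<partial>lam) \<longlonglongrightarrow> 0" (is "?v \<longlonglongrightarrow> 0")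
proof -
  have fs: "simple_function S (fs n)" for n using ds by (simp add: defining_sequence_def)
  then have [measurable]: "fs n \<in> borel_measurable S" for n by (rule borel_measurable_simple_function)
  have lim: "AE s in lam. (\<lambda>n. fs n s) \<longlonglongrightarrow> f s" using ds by (simp add: defining_sequence_def)
  let ?I = "\<lambda>n. simple_stoch_integral S \<Lambda> A (fs n)"
  obtain X where "converges_in_prob P ?I X" using ds A unfolding defining_sequence_def by blast
  then have "converges_in_prob P (\<lambda>N \<omega>. ?I (p N) \<omega> - ?I (q N) \<omega>) (\<lambda>_. 0)"
    by (intro P.converges_in_prob_imp_cauchy pq simple_stoch_integral_measurable fs A)
  then have "(\<lambda>N. \<integral>\<omega>. iexp (t * (?I (p N) \<omega> - ?I (q N) \<omega>)) \<partial>P) \<longlonglongrightarrow> (\<integral>\<omega>. iexp (t * 0) \<partial>P)" for t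
    using simple_stoch_integral_measurable[OF fs A]
    by (intro P.converges_in_prob_imp_char borel_measurable_diff)
  then have char: "(\<lambda>N. exp (char_exponent A (\<lambda>s. fs (p N) s - fs (q N) s) t)) \<longlonglongrightarrow> 1" for t
    unfolding char_simple_stoch_integral_diff[OF fs fs A] by (simp add: P.prob_space)
  have jump: "(\<lambda>N. jump A (\<lambda>s. fs (p N) s - fs (q N) s) t) \<longlonglongrightarrow> 0" for t
    using jump_tendsto[OF A _ _ AE_diff_tendsto_0[OF lim pq], of t] by (simp add: jump_zero)
  have gauss: "(\<lambda>N. exp (\<i> * of_real (t * ?m N) - of_real (t\<^sup>2 / 2 * ?v N))) \<longlonglongrightarrow> 1" for t
  proof -
    have "(\<lambda>N. exp (char_exponent A (\<lambda>s. fs (p N) s - fs (q N) s) t) * exp (- jump A (\<lambda>s. fs (p N) s - fs (q N) s) t))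
        \<longlonglongrightarrow> 1 * exp (- 0)"
      by (intro tendsto_intros char jump)
    then show ?thesis by (simp add: char_exponent_def exp_add[symmetric])
  qed
  show v: "?v \<longlonglongrightarrow> 0"
  proof -
    have "(\<lambda>N. norm (exp (\<i> * of_real (1 * ?m N) - of_real (1\<^sup>2 / 2 * ?v N)))) \<longlonglongrightarrow> norm (1 :: complex)"
      by (intro tendsto_norm gauss)
    then have "(\<lambda>N. exp (- (?v N / 2))) \<longlonglongrightarrow> 1" by (simp add: norm_exp_eq_Re)
    from tendsto_ln[OF this] have "(\<lambda>N. - 2 * (- (?v N / 2))) \<longlonglongrightarrow> - 2 * 0"
      by (intro tendsto_mult tendsto_const) simp
    then show ?thesis by simp
  qed
  show "?m \<longlonglongrightarrow> 0"
  proof (rule P.iexp_tendsto_1_imp_tendsto_0)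
    fix t
    have "(\<lambda>N. exp (\<i> * of_real (t * ?m N) - of_real (t\<^sup>2 / 2 * ?v N)) * exp (complex_of_real (t\<^sup>2 / 2 * ?v N)))
        \<longlonglongrightarrow> 1 * exp (complex_of_real (t\<^sup>2 / 2 * 0))"
      by (intro tendsto_mult gauss tendsto_exp tendsto_of_real tendsto_const v)
    then show "(\<lambda>N. iexp (t * ?m N)) \<longlonglongrightarrow> 1" by (simp add: exp_add[symmetric])
  qed
qed

text \<open>
  The density \<open>\<sigma>2\<close> is nonnegative almost everywhere only, whence the absolute value; absorbing
  its square root into the functions turns the weighted \<open>L\<^sup>2\<close> convergence into an unweighted one.
\<close>

lemma square_weight:
  fixes u :: "'s \<Rightarrow> real"
  assumes u[measurable]: "u \<in> borel_measurable S"
  shows "integrable lam (\<lambda>s. (u s * sqrt \<bar>\<sigma>2 s\<bar>)\<^sup>2) \<longleftrightarrow> integrable lam (\<lambda>s. (u s)\<^sup>2 * \<sigma>2 s)"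
    and "(\<integral>s. (u s * sqrt \<bar>\<sigma>2 s\<bar>)\<^sup>2 \<partial>lam) = (\<integral>s. (u s)\<^sup>2 * \<sigma>2 s \<partial>lam)"
proof -
  have [measurable]: "\<sigma>2 \<in> borel_measurable lam" using \<sigma>2_integrable by auto
  have ae: "AE s in lam. (u s * sqrt \<bar>\<sigma>2 s\<bar>)\<^sup>2 = (u s)\<^sup>2 * \<sigma>2 s"
    by (rule AE_mp[OF \<sigma>2_nonneg]) (simp add: power_mult_distrib)
  show "integrable lam (\<lambda>s. (u s * sqrt \<bar>\<sigma>2 s\<bar>)\<^sup>2) \<longleftrightarrow> integrable lam (\<lambda>s. (u s)\<^sup>2 * \<sigma>2 s)"
    by (rule integrable_cong_AE[OF _ _ ae]) measurable
  show "(\<integral>s. (u s * sqrt \<bar>\<sigma>2 s\<bar>)\<^sup>2 \<partial>lam) = (\<integral>s. (u s)\<^sup>2 * \<sigma>2 s \<partial>lam)"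
    by (rule integral_cong_AE[OF _ _ ae]) measurable
qed

text \<open>
  Necessity of the first two conditions, together with the convergence of the first two terms of the
  exponent along an arbitrary defining sequence.
\<close>

lemma defining_sequence_limits:
  assumes ds: "defining_sequence P S \<Lambda> lam f fs" and f[measurable]: "f \<in> borel_measurable S"
  shows "integrable lam (\<lambda>s. f s * pure_drift s)"
    and "(\<lambda>n. \<integral>s. fs n s * pure_drift s \<partial>lam) \<longlonglongrightarrow> (\<integral>s. f s * pure_drift s \<partial>lam)"
    and "integrable lam (\<lambda>s. (f s)\<^sup>2 * \<sigma>2 s)"
    and "(\<lambda>n. \<integral>s. (fs n s)\<^sup>2 * \<sigma>2 s \<partial>lam) \<longlonglongrightarrow> (\<integral>s. (f s)\<^sup>2 * \<sigma>2 s \<partial>lam)"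
proof -
  have fs: "simple_function S (fs n)" for n using ds by (simp add: defining_sequence_def)
  then have [measurable]: "fs n \<in> borel_measurable S" for n by (rule borel_measurable_simple_function)
  have lim: "AE s in lam. (\<lambda>n. fs n s) \<longlonglongrightarrow> f s" using ds by (simp add: defining_sequence_def)
  have [measurable]: "pure_drift \<in> borel_measurable lam" "\<sigma>2 \<in> borel_measurable lam"
    using pure_drift_integrable \<sigma>2_integrable by auto
  have drift_int: "integrable lam (\<lambda>s. fs n s * pure_drift s)" for n
    by (rule simple_mult_integrable[OF fs pure_drift_integrable])
  have drift_lim: "AE s in lam. (\<lambda>n. fs n s * pure_drift s) \<longlonglongrightarrow> f s * pure_drift s"
    using lim by eventually_elim (intro tendsto_intros)
  have drift_cauchy: "(\<lambda>N. \<integral>s. indicator A s * (fs (p N) s * pure_drift s - fs (q N) s * pure_drift s) \<partial>lam) \<longlonglongrightarrow> 0"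
    if A: "A \<in> sets lam" and pq: "\<And>N. N \<le> p N" "\<And>N. N \<le> q N" for A and p q :: "nat \<Rightarrow> nat"
    using defining_sequence_cauchy(1)[OF ds _ pq, of A] A by (simp add: left_diff_distrib)
  have fb: "(\<lambda>s. f s * pure_drift s) \<in> borel_measurable lam" by measurable
  show "integrable lam (\<lambda>s. f s * pure_drift s)"
    by (rule lam.setwise_cauchy_AE_limit(1)[OF drift_int fb drift_lim drift_cauchy])
  show "(\<lambda>n. \<integral>s. fs n s * pure_drift s \<partial>lam) \<longlonglongrightarrow> (\<integral>s. f s * pure_drift s \<partial>lam)"
    by (rule lam.setwise_cauchy_AE_limit(2)[OF drift_int fb drift_lim drift_cauchy])
  let ?r = "\<lambda>s. sqrt \<bar>\<sigma>2 s\<bar>"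
  have sq: "integrable lam (\<lambda>s. (u s * ?r s)\<^sup>2)" if u: "simple_function S u" for u
  proof -
    have "simple_function S (\<lambda>s. (u s)\<^sup>2)" using u by (rule simple_function_compose1)
    then show ?thesis
      using simple_mult_integrable[OF _ \<sigma>2_integrable] square_weight(1) borel_measurable_simple_function[OF u] by blast
  qed
  have diff: "fs n s * ?r s - fs m s * ?r s = (fs n s - fs m s) * ?r s" for n m s
    by (simp add: left_diff_distrib)
  have sq_diff: "integrable lam (\<lambda>s. (fs n s * ?r s - fs m s * ?r s)\<^sup>2)" for n m
    unfolding diff by (rule sq) (rule simple_function_diff[OF fs fs])
  have sq_lim: "AE s in lam. (\<lambda>n. fs n s * ?r s) \<longlonglongrightarrow> f s * ?r s"
    using lim by eventually_elim (intro tendsto_intros)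
  have sq_cauchy: "\<exists>N. \<forall>n\<ge>N. \<forall>m\<ge>N. (\<integral>s. (fs n s * ?r s - fs m s * ?r s)\<^sup>2 \<partial>lam) < e"
    if e: "0 < e" for e
  proof -
    have "\<exists>N. \<forall>n\<ge>N. \<forall>m\<ge>N. \<bar>\<integral>s. (fs n s - fs m s)\<^sup>2 * \<sigma>2 s \<partial>lam\<bar> < e"
    proof (rule ex_cauchy_bound[OF _ e])
      fix p q :: "nat \<Rightarrow> nat" assume "\<And>N. N \<le> p N" "\<And>N. N \<le> q N"
      from defining_sequence_cauchy(2)[OF ds sets.top this]
      have "(\<lambda>N. \<integral>s. indicator (space S) s * ((fs (p N) s - fs (q N) s)\<^sup>2 * \<sigma>2 s) \<partial>lam) \<longlonglongrightarrow> 0" .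
      moreover have "(\<integral>s. indicator (space S) s * ((fs (p N) s - fs (q N) s)\<^sup>2 * \<sigma>2 s) \<partial>lam)
          = (\<integral>s. (fs (p N) s - fs (q N) s)\<^sup>2 * \<sigma>2 s \<partial>lam)" for N
        by (intro Bochner_Integration.integral_cong) auto
      ultimately show "(\<lambda>N. \<integral>s. (fs (p N) s - fs (q N) s)\<^sup>2 * \<sigma>2 s \<partial>lam) \<longlonglongrightarrow> 0" by simp
    qed
    then show ?thesis
      unfolding diff by (simp add: square_weight(2)) (meson abs_ge_self le_less_trans)
  qed
  have fr: "(\<lambda>s. fs n s * ?r s) \<in> borel_measurable lam" "(\<lambda>s. f s * ?r s) \<in> borel_measurable lam" for n
    by measurable
  note L2 = L2_cauchy_AE_limit[OF fr sq[OF fs] sq_diff sq_lim sq_cauchy]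
  show "integrable lam (\<lambda>s. (f s)\<^sup>2 * \<sigma>2 s)"
    using L2(1) by (simp add: square_weight)
  show "(\<lambda>n. \<integral>s. (fs n s)\<^sup>2 * \<sigma>2 s \<partial>lam) \<longlonglongrightarrow> (\<integral>s. (f s)\<^sup>2 * \<sigma>2 s \<partial>lam)"
    using L2(2) by (simp add: square_weight)
qed

text \<open>
  Sufficiency.  The bound by twice \<open>\<bar>f\<bar>\<close> comes from the approximation by simple functions; differences of two
  approximants are therefore dominated by four times \<open>\<bar>f\<bar>\<close>.
\<close>

lemma integrable_imp_stoch_integrable:
  assumes f[measurable]: "f \<in> borel_measurable S"
    and drift: "integrable lam (\<lambda>s. f s * pure_drift s)" and var: "integrable lam (\<lambda>s. (f s)\<^sup>2 * \<sigma>2 s)"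
  shows "stoch_integrable P S \<Lambda> lam f"
proof -
  have [measurable]: "pure_drift \<in> borel_measurable lam" "\<sigma>2 \<in> borel_measurable lam"
    using pure_drift_integrable \<sigma>2_integrable by auto
  obtain fs where fs: "\<And>n :: nat. simple_function S (fs n)"
    and lim: "\<And>s. s \<in> space S \<Longrightarrow> (\<lambda>n. fs n s) \<longlonglongrightarrow> f s"
    and le: "\<And>n s. s \<in> space S \<Longrightarrow> \<bar>fs n s\<bar> \<le> 2 * \<bar>f s\<bar>"
    using borel_measurable_implies_sequence_metric[OF f, of 0] unfolding dist_norm diff_zero real_norm_def by blast
  have [measurable]: "fs n \<in> borel_measurable S" for n using fs by (rule borel_measurable_simple_function)
  have ae: "AE s in lam. (\<lambda>n. fs n s) \<longlonglongrightarrow> f s" using lim by (intro AE_I2) simp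
  have "\<exists>X. converges_in_prob P (\<lambda>n. simple_stoch_integral S \<Lambda> A (fs n)) X" if A[measurable]: "A \<in> sets S" for A
  proof (rule P.cauchy_imp_converges_in_prob)
    show "simple_stoch_integral S \<Lambda> A (fs n) \<in> borel_measurable P" for n
      by (rule simple_stoch_integral_measurable[OF fs A])
    fix p q :: "nat \<Rightarrow> nat" assume pq: "\<And>N. N \<le> p N" "\<And>N. N \<le> q N"
    let ?d = "\<lambda>N s. fs (p N) s - fs (q N) s"
    have d: "AE s in lam. (\<lambda>N. ?d N s) \<longlonglongrightarrow> 0" by (rule AE_diff_tendsto_0[OF ae pq])
    have d_le: "\<bar>?d N s\<bar> \<le> 4 * \<bar>f s\<bar>" if "s \<in> space S" for N s
      using le[OF that, of "p N"] le[OF that, of "q N"] by simp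
    have m: "(\<lambda>N. \<integral>s. indicator A s * (?d N s * pure_drift s) \<partial>lam) \<longlonglongrightarrow> (\<integral>s. 0 \<partial>lam)"
    proof (rule integral_dominated_convergence[where w="\<lambda>s. 4 * \<bar>f s * pure_drift s\<bar>"])
      show "AE s in lam. (\<lambda>N. indicator A s * (?d N s * pure_drift s)) \<longlonglongrightarrow> 0"
        using d by eventually_elim (intro tendsto_mult_right_zero tendsto_mult_left_zero)
      show "AE s in lam. norm (indicator A s * (?d N s * pure_drift s)) \<le> 4 * \<bar>f s * pure_drift s\<bar>" for N
      proof (rule AE_I2)
        fix s assume "s \<in> space lam"
        then have "\<bar>?d N s\<bar> * \<bar>pure_drift s\<bar> \<le> (4 * \<bar>f s\<bar>) * \<bar>pure_drift s\<bar>" by (intro mult_right_mono d_le) auto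
        then show "norm (indicator A s * (?d N s * pure_drift s)) \<le> 4 * \<bar>f s * pure_drift s\<bar>"
          by (auto simp: indicator_def abs_mult)
      qed
    qed (use drift in auto)
    have v: "(\<lambda>N. \<integral>s. indicator A s * ((?d N s)\<^sup>2 * \<sigma>2 s) \<partial>lam) \<longlonglongrightarrow> (\<integral>s. 0 \<partial>lam)"
    proof (rule integral_dominated_convergence[where w="\<lambda>s. 16 * \<bar>(f s)\<^sup>2 * \<sigma>2 s\<bar>"])
      show "AE s in lam. (\<lambda>N. indicator A s * ((?d N s)\<^sup>2 * \<sigma>2 s)) \<longlonglongrightarrow> 0"
        using d
      proof eventually_elim
        case (elim s)
        have "(\<lambda>N. indicator A s * ((?d N s)\<^sup>2 * \<sigma>2 s)) \<longlonglongrightarrow> indicator A s * (0\<^sup>2 * \<sigma>2 s)"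
          by (intro tendsto_intros elim)
        then show ?case by simp
      qed
      show "AE s in lam. norm (indicator A s * ((?d N s)\<^sup>2 * \<sigma>2 s)) \<le> 16 * \<bar>(f s)\<^sup>2 * \<sigma>2 s\<bar>" for N
      proof (rule AE_I2)
        fix s assume "s \<in> space lam"
        then have "\<bar>?d N s\<bar>\<^sup>2 * \<bar>\<sigma>2 s\<bar> \<le> (4 * \<bar>f s\<bar>)\<^sup>2 * \<bar>\<sigma>2 s\<bar>"
          by (intro mult_right_mono power_mono d_le) auto
        then show "norm (indicator A s * ((?d N s)\<^sup>2 * \<sigma>2 s)) \<le> 16 * \<bar>(f s)\<^sup>2 * \<sigma>2 s\<bar>"
          by (auto simp: indicator_def abs_mult power_mult_distrib)
      qed
    qed (use var in auto)
    have j: "(\<lambda>N. jump A (?d N) t) \<longlonglongrightarrow> jump A (\<lambda>_. 0) t" for t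
      by (rule jump_tendsto[OF A _ _ d]) measurable
    have "(\<lambda>N. exp (char_exponent A (?d N) t)) \<longlonglongrightarrow>
        exp (\<i> * of_real (t * (\<integral>s. 0 \<partial>lam)) - of_real (t\<^sup>2 / 2 * (\<integral>s. 0 \<partial>lam)) + jump A (\<lambda>_. 0) t)" for t
      unfolding char_exponent_def
      by (intro tendsto_exp tendsto_add tendsto_diff tendsto_mult tendsto_of_real tendsto_const m v j)
    then have char: "(\<lambda>N. \<integral>\<omega>. iexp (t * (simple_stoch_integral S \<Lambda> A (fs (p N)) \<omega>
        - simple_stoch_integral S \<Lambda> A (fs (q N)) \<omega>)) \<partial>P) \<longlonglongrightarrow> 1" for t
      unfolding char_simple_stoch_integral_diff[OF fs fs A] by (simp add: jump_zero)
    show "converges_in_prob P (\<lambda>N \<omega>. simple_stoch_integral S \<Lambda> A (fs (p N)) \<omega>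
        - simple_stoch_integral S \<Lambda> A (fs (q N)) \<omega>) (\<lambda>_. 0)"
      by (intro P.char_tendsto_1_imp_converges_in_prob[OF _ char] borel_measurable_diff
        simple_stoch_integral_measurable fs A)
  qed
  then have "defining_sequence P S \<Lambda> lam f fs" using fs ae by (simp add: defining_sequence_def)
  then show ?thesis using f unfolding stoch_integrable_def by blast
qed

lemma char_stoch_integral:
  assumes f[measurable]: "f \<in> borel_measurable S"
    and X: "is_stoch_integral P S \<Lambda> lam (space S) f X"
  shows "(\<integral>\<omega>. iexp (t * X \<omega>) \<partial>P) = exp (char_exponent (space S) f t)"
proof -
  obtain fs where ds: "defining_sequence P S \<Lambda> lam f fs"
    and conv: "converges_in_prob P (\<lambda>n. simple_stoch_integral S \<Lambda> (space S) (fs n)) X"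
    using X unfolding is_stoch_integral_def by blast
  have fs: "simple_function S (fs n)" for n using ds by (simp add: defining_sequence_def)
  then have [measurable]: "fs n \<in> borel_measurable S" for n by (rule borel_measurable_simple_function)
  have lim: "AE s in lam. (\<lambda>n. fs n s) \<longlonglongrightarrow> f s" using ds by (simp add: defining_sequence_def)
  have whole: "(\<integral>s. indicator (space S) s * g s \<partial>lam) = (\<integral>s. g s \<partial>lam)" for g :: "'s \<Rightarrow> real"
    by (intro Bochner_Integration.integral_cong) auto
  have "(\<lambda>n. \<integral>\<omega>. iexp (t * simple_stoch_integral S \<Lambda> (space S) (fs n) \<omega>) \<partial>P) \<longlonglongrightarrow> (\<integral>\<omega>. iexp (t * X \<omega>) \<partial>P)"
    by (intro P.converges_in_prob_imp_char conv simple_stoch_integral_measurable fs) simp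
  then have "(\<lambda>n. exp (char_exponent (space S) (fs n) t)) \<longlonglongrightarrow> (\<integral>\<omega>. iexp (t * X \<omega>) \<partial>P)"
    by (simp only: char_simple_stoch_integral[OF fs sets.top])
  moreover have "(\<lambda>n. exp (char_exponent (space S) (fs n) t)) \<longlonglongrightarrow> exp (char_exponent (space S) f t)"
    unfolding char_exponent_def whole
    by (intro tendsto_exp tendsto_add tendsto_diff tendsto_mult tendsto_of_real tendsto_const
      defining_sequence_limits[OF ds f] jump_tendsto lim) measurable
  ultimately show ?thesis by (rule LIMSEQ_unique)
qed

text \<open>
  Putting the compensator \<open>\<integral>\<tau>(f(s)x) dF\<close> back moves it from the jump term into the drift, where it
  completes \<open>\<integral>f \<beta> d\<lambda>\<close> to \<open>\<integral>U(f(s),s) d\<lambda>\<close>, with \<open>\<beta>\<close> standing for \<open>pure_drift\<close>.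
\<close>

lemma exp_char_exponent_eq_qid_char:
  assumes f[measurable]: "f \<in> borel_measurable S" and drift: "integrable lam (\<lambda>s. f s * pure_drift s)"
  shows "exp (char_exponent (space S) f t) =
    qid_char (\<integral>s. U a \<rho> (f s) s \<partial>lam) (\<integral>s. \<bar>f s\<bar>\<^sup>2 * \<sigma>2 s \<partial>lam)
      (\<lambda>B. F {(s, x) \<in> space S \<times> UNIV. f s * x \<in> B - {0}}) t"
proof -
  have whole: "(\<integral>s. indicator (space S) s * g s \<partial>lam) = (\<integral>s. g s \<partial>lam)" for g :: "'s \<Rightarrow> real"
    by (intro Bochner_Integration.integral_cong) auto
  let ?c = "\<integral>z. sgnF z * \<tau> (f (fst z) * snd z) \<partial>varF"
  have c: "(\<integral>z. sgnF z * (indicator (space S) (fst z) * \<tau> (f (fst z) * snd z)) \<partial>varF) = ?c"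
    by (intro Bochner_Integration.integral_cong) (auto simp: varF_space)
  have "levy_integral (\<lambda>B. F {(s, x) \<in> space S \<times> UNIV. f s * x \<in> B - {0}})
      (\<lambda>x. exp (\<i> * of_real (t * x)) - 1 - \<i> * of_real (t * \<tau> x))
    = (\<integral>z. sgnF z *\<^sub>R (exp (\<i> * of_real (t * (f (fst z) * snd z))) - 1
        - \<i> * of_real (t * \<tau> (f (fst z) * snd z))) \<partial>varF)"
    by (rule levy_integral_image[OF f levy_kernel_measurable levy_kernel_bound]) (simp add: \<tau>_def)
  also have "\<dots> = (\<integral>z. (indicator (space S) (fst z) * sgnF z) *\<^sub>R
      (exp (\<i> * of_real (t * (f (fst z) * snd z))) - 1 - \<i> * of_real (t * \<tau> (f (fst z) * snd z))) \<partial>varF)"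
    by (intro Bochner_Integration.integral_cong) (auto simp: varF_space)
  also have "\<dots> = jump (space S) f t - \<i> * of_real (t * ?c)"
    using split_compensator[OF sets.top f, of t] unfolding c .
  finally show ?thesis
    unfolding qid_char_def char_exponent_def whole U_integral[OF f drift]
    by (intro arg_cong[where f=exp]) (simp add: algebra_simps)
qed

end

theorem theorem5p23:
  fixes P :: "'w measure" and S :: "'s measure" and \<Lambda> :: "'s set \<Rightarrow> 'w \<Rightarrow> real"
    and \<nu>0 :: "'s set \<Rightarrow> real" and \<nu>1 :: "'s measure" and FA :: "'s set \<Rightarrow> real set \<Rightarrow> real"
    and F :: "('s \<times> real) set \<Rightarrow> real" and lam :: "'s measure" and a \<sigma>2 :: "'s \<Rightarrow> real"
    and \<rho> :: "'s \<Rightarrow> real set \<Rightarrow> real" and f :: "'s \<Rightarrow> real"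
  assumes "prob_space P" and "space S \<noteq> {}"
    and "qid_random_measure P S \<Lambda>"
    and "signed_measure S \<nu>0"
    and "sets \<nu>1 = sets S" and "finite_measure \<nu>1"
    and "signed_bimeasure S FA"
    and "\<And>A. A \<in> sets S \<Longrightarrow> has_triplet (distr P borel (\<Lambda> A)) (\<nu>0 A) (measure \<nu>1 A) (FA A)"
    and "bimeasure_variation S FA (space S) < \<infinity>"
    and lam: "lam = control_measure S \<nu>0 \<nu>1 FA"
    and "is_RN_deriv lam \<nu>0 a"
    and "is_RN_deriv lam (measure \<nu>1) \<sigma>2"
    and "signed_measure (S \<Otimes>\<^sub>M borel) F"
    and "\<And>A B. A \<in> sets S \<Longrightarrow> B \<in> sets borel \<Longrightarrow> F (A \<times> B) = FA A B"
    and "disintegration S lam F \<rho>"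
    and "f \<in> borel_measurable S"
  shows "(stoch_integrable P S \<Lambda> lam f \<longleftrightarrow>
            (\<integral>\<^sup>+s. ennreal \<bar>U a \<rho> (f s) s\<bar> \<partial>lam) < \<infinity> \<and>
            (\<integral>\<^sup>+s. ennreal (\<bar>f s\<bar>\<^sup>2 * \<sigma>2 s) \<partial>lam) < \<infinity> \<and>
            (\<integral>\<^sup>+s. V0 \<rho> (f s) s \<partial>lam) < \<infinity>) \<and>
         (stoch_integrable P S \<Lambda> lam f \<longrightarrow>
            (\<forall>X \<theta>. is_stoch_integral P S \<Lambda> lam (space S) f X \<longrightarrow>
              (\<integral>\<omega>. exp (\<i> * of_real (\<theta> * X \<omega>)) \<partial>P) =
              qid_char (\<integral>s. U a \<rho> (f s) s \<partial>lam) (\<integral>s. \<bar>f s\<bar>\<^sup>2 * \<sigma>2 s \<partial>lam)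
                (\<lambda>B. F {(s, x) \<in> space S \<times> UNIV. f s * x \<in> B - {0}}) \<theta>))"
proof -
  interpret bounded_qid_setting P S \<Lambda> \<nu>0 \<nu>1 FA F lam a \<sigma>2 \<rho>
    by (rule bounded_qid_setting.intro) (fact assms)+
  note f = \<open>f \<in> borel_measurable S\<close>
  have "stoch_integrable P S \<Lambda> lam f \<longleftrightarrow>
      integrable lam (\<lambda>s. f s * pure_drift s) \<and> integrable lam (\<lambda>s. (f s)\<^sup>2 * \<sigma>2 s)"
    using defining_sequence_limits(1,3)[OF _ f] integrable_imp_stoch_integrable[OF f]
    unfolding stoch_integrable_def by blast
  then have "stoch_integrable P S \<Lambda> lam f \<longleftrightarrow>
            (\<integral>\<^sup>+s. ennreal \<bar>U a \<rho> (f s) s\<bar> \<partial>lam) < \<infinity> \<and>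
            (\<integral>\<^sup>+s. ennreal (\<bar>f s\<bar>\<^sup>2 * \<sigma>2 s) \<partial>lam) < \<infinity> \<and>
            (\<integral>\<^sup>+s. V0 \<rho> (f s) s \<partial>lam) < \<infinity>"
    unfolding U_integrable_iff[OF f] variance_integrable_iff[OF f] using V0_integral_finite by blast
  moreover have "(\<integral>\<omega>. exp (\<i> * of_real (\<theta> * X \<omega>)) \<partial>P) =
              qid_char (\<integral>s. U a \<rho> (f s) s \<partial>lam) (\<integral>s. \<bar>f s\<bar>\<^sup>2 * \<sigma>2 s \<partial>lam)
                (\<lambda>B. F {(s, x) \<in> space S \<times> UNIV. f s * x \<in> B - {0}}) \<theta>"
    if "is_stoch_integral P S \<Lambda> lam (space S) f X" for X \<theta>
  proof -
    have "integrable lam (\<lambda>s. f s * pure_drift s)"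
      using that defining_sequence_limits(1)[OF _ f] unfolding is_stoch_integral_def by blast
    from exp_char_exponent_eq_qid_char[OF f this] show ?thesis
      unfolding char_stoch_integral[OF f that] .
  qed
  ultimately show ?thesis by blast
qed

end
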